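(* For every nontrivial finite abelian group $G$, $$\mathsf D(G)\le\frac{16}{5}\,\mathsf r(G)\exp(G).$$ Consequently, $\delta(G)<\frac{16}{5}\,\mathsf r(G)\exp(G)$.
   Context: Groups are finite, abelian and written additively; $C_n$ denotes the cyclic group of order $n$. The rank $\mathsf r(G)$ is the minimum number of generators of $G$, and $\exp(G)$ is the exponent of $G$. The Davenport constant $\mathsf D(G)$ is the least integer $\ell$ such that every sequence of $\ell$ elements of $G$ (repetitions allowed) has a nonempty subsequence with sum $0$. If $G\cong C_{n_1}\oplus\cdots\oplus C_{n_s}$ with $1<n_1\mid\cdots\mid n_s$, put $\mathsf D^*(G)=1+\sum_{i=1}^s(n_i-1)$. The Davenport excess is $\delta(G)=\mathsf D(G)-\mathsf D^*(G)$. *)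

theory Defs
  imports Complex_Main "HOL-Algebra.Algebra"
begin

(* The locales of HOL-Algebra are multiplicative: the sum of a family is finprod, 0 is the unit,
   and n x is x [^] n. *)

definition group_rank :: "('a, 'b) monoid_scheme \<Rightarrow> nat" where
  "group_rank G =
     (LEAST r. \<exists>S. S \<subseteq> carrier G \<and> finite S \<and> card S = r \<and> generate G S = carrier G)"

definition group_exponent :: "('a, 'b) monoid_scheme \<Rightarrow> nat" where
  "group_exponent G = (LEAST n. n > 0 \<and> (\<forall>x\<in>carrier G. x [^]\<^bsub>G\<^esub> n = \<one>\<^bsub>G\<^esub>))"

(* A subsequence of x 0, ..., x (l - 1) is given by its set I of indices, so that repeated
   elements count with multiplicity. *)
definition davenport :: "('a, 'b) monoid_scheme \<Rightarrow> nat" where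
  "davenport G =
     (LEAST l. \<forall>x \<in> {..<l} \<rightarrow> carrier G.
        \<exists>I. I \<subseteq> {..<l} \<and> I \<noteq> {} \<and> finprod G x I = \<one>\<^bsub>G\<^esub>)"

definition is_invariant_factors :: "('a, 'b) monoid_scheme \<Rightarrow> nat list \<Rightarrow> bool" where
  "is_invariant_factors G ns \<longleftrightarrow>
     (\<forall>n\<in>set ns. 1 < n) \<and>
     (\<forall>i. Suc i < length ns \<longrightarrow> ns ! i dvd ns ! Suc i) \<and>
     G \<cong> sum_group {..<length ns} (\<lambda>i. integer_mod_group (ns ! i))"

(* For a finite abelian group, such a list exists and is unique by the structure theorem;
   it is empty exactly for the trivial group. *)
definition invariant_factors :: "('a, 'b) monoid_scheme \<Rightarrow> nat list" where
  "invariant_factors G = (THE ns. is_invariant_factors G ns)"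

definition davenport_star :: "('a, 'b) monoid_scheme \<Rightarrow> nat" where
  "davenport_star G = 1 + (\<Sum>n\<leftarrow>invariant_factors G. n - 1)"

definition davenport_excess :: "('a, 'b) monoid_scheme \<Rightarrow> int" where
  "davenport_excess G = int (davenport G) - int (davenport_star G)"

end

theory Submission
  imports Defs "HOL-Number_Theory.Number_Theory" "HOL-Analysis.Harmonic_Numbers"
    "Jordan_Normal_Form.Char_Poly"
begin

text \<open>
  Let \<open>r\<close> be the rank, \<open>n = q m\<close> the exponent with \<open>q = p ^ e\<close> its largest prime power
  component, and write the terms of a sequence as monomials in \<open>r\<close> generators, with exponent
  vectors \<open>v\<^sub>0, v\<^sub>1, \<dots>\<close>. If no nonempty sum of these vectors vanishes modulo \<open>n\<close>, then, for any
  \<open>m\<close>-th roots of unity \<open>a\<^sub>i\<close>, applying the operators \<open>f \<mapsto> f (\<cdot> + v\<^sub>i) - a\<^sub>i f\<close> for all \<open>i\<close> to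
  \<open>m ^ r\<close> times the indicator function of \<open>n \<int> ^ r\<close> yields at \<open>0\<close> the value \<open>m ^ r\<close> times a unit
  of \<open>\<int>[\<omega>]\<close>, where \<open>\<omega> = exp (2 \<pi> i / m)\<close>. On the other hand, this function is the sum over all
  characters \<open>\<theta>\<close> of \<open>(\<int> / m) ^ r\<close> of \<open>\<theta>\<close> times the indicator function of \<open>q \<int> ^ r\<close>, and modulo \<open>p\<close>
  the latter behaves like a polynomial of degree \<open>r (q - 1)\<close>. An operator with \<open>\<theta> v\<^sub>i = a\<^sub>i\<close> (a hit)
  lowers this degree by one, so a character with more than \<open>r (q - 1)\<close> hits contributes \<open>0\<close> modulo \<open>p\<close>.
  As \<open>p\<close> does not divide \<open>m ^ r\<close> and \<open>\<int>[\<omega>] \<inter> \<rat> = \<int>\<close>, this is a contradiction if every character has that many hits.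

  Choosing the \<open>a\<^sub>i\<close> greedily with respect to the weights \<open>t ^ hits\<close>, \<open>t = 5 / 16\<close>, this is achieved
  if the sequence has length \<open>L\<close> with \<open>m ^ r (1 - (1 - t) / m) ^ L < t ^ (r (q - 1))\<close>. Since
  \<open>ln m \<le> \<psi>(q) - ln q\<close> for Chebyshev's function \<open>\<psi>\<close>, the value \<open>L = \<lfloor>16 r n / 5\<rfloor>\<close> suffices as soon as
  \<open>\<psi>(q) \<le> c q + 3\<close> for some \<open>c \<le> 11 / 5 - ln (16 / 5) = 1.0368\<dots>\<close>. Such a bound is obtained
  together with a lower bound for \<open>\<psi>\<close>: up to 65536 by a sieve, and beyond by induction from linear
  inequalities between values \<open>\<psi>(N / k)\<close> and \<open>ln (\<lfloor>N / d\<rfloor>!)\<close>.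
\<close>

hide_const (open) Divisibility.prime

section \<open>A table of Chebyshev's function\<close>

text \<open>\<open>m\<close> counts the entries to skip before the next application and is reset to
  \<open>n\<close>, so \<open>f\<close> reaches every \<open>Suc n\<close>-th entry without index
  arithmetic. This keeps evaluation by \<open>code_simp\<close> cheap.\<close>

fun map_every :: "('a \<Rightarrow> 'a) \<Rightarrow> nat \<Rightarrow> nat \<Rightarrow> 'a list \<Rightarrow> 'a list" where
  "map_every f n m [] = []"
| "map_every f n 0 (x # xs) = f x # map_every f n n xs"
| "map_every f n (Suc m) (x # xs) = x # map_every f n m xs"

lemma length_map_every [simp]: "length (map_every f n m xs) = length xs"
  by (induction f n m xs rule: map_every.induct) auto

text \<open>The divisibility says that \<open>i\<close> is congruent to \<open>m\<close> modulo
  \<open>Suc n\<close>; adding \<open>Suc n - m\<close> avoids a truncated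
  \<open>i - m\<close>.\<close>

lemma nth_map_every:
  assumes "m \<le> n" "i < length xs"
  shows "map_every f n m xs ! i = (if Suc n dvd i + (Suc n - m) then f (xs ! i) else xs ! i)"
  using assms
proof (induction f n m xs arbitrary: i rule: map_every.induct)
  case (2 f n x xs)
  show ?case
  proof (cases i)
    case (Suc j)
    have "Suc n dvd i + Suc n \<longleftrightarrow> Suc n dvd i" by (metis dvd_add_triv_right_iff)
    then show ?thesis using 2 Suc by simp
  qed simp
next
  case (3 f n m x xs)
  show ?case
  proof (cases i)
    case 0
    have "\<not> Suc n dvd n - m" using 3 by (auto dest!: dvd_imp_le)
    then show ?thesis using 0 by simp
  next
    case (Suc j)
    have "j + (Suc n - m) = i + (Suc n - Suc m)" using 3 Suc by simp
    then show ?thesis using 3 Suc by simp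
  qed
qed simp

text \<open>Index \<open>i\<close> of a sieve starting at the odd number \<open>s\<close> stands for \<open>s + 2 i\<close>; the offset is the index of the
  first multiple of \<open>p\<close>.\<close>

definition sieve_offset :: "int \<Rightarrow> int \<Rightarrow> nat" where
  "sieve_offset s p =
     nat (let r = s mod p in if r = 0 then 0 else if r mod 2 = 0 then p - r div 2 else (p - r) div 2)"

fun sieve :: "int list \<Rightarrow> int \<Rightarrow> bool list \<Rightarrow> bool list" where
  "sieve [] s xs = xs"
| "sieve (p # ps) s xs = sieve ps s (map_every (\<lambda>_. False) (nat (p - 1)) (sieve_offset s p) xs)"

fun count_true :: "bool list \<Rightarrow> int" where
  "count_true [] = 0"
| "count_true (x # xs) = (if x then 1 + count_true xs else count_true xs)"

text \<open>Logarithms in units of \<open>ln 2 / 30\<close>, rounded up and down.\<close>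

definition log_table_up :: "int list" where
  "log_table_up = [0, 0, 30, 48, 60, 70, 78, 85, 90, 96, 100, 104, 108, 112, 115, 118, 120, 123, 126, 128,
    130, 132, 134, 136, 138, 140, 142, 143, 145, 146, 148, 149, 150, 152, 153, 154, 156, 157, 158, 159, 160,
    161, 162, 163, 164, 165, 166, 167, 168, 169, 170, 171, 172, 172, 173, 174, 175, 175, 176, 177, 178, 178,
    179, 180, 180]"

definition log_table_low :: "int list" where
  "log_table_low = [0, 0, 30, 47, 60, 69, 77, 84, 90, 95, 99, 103, 107, 111, 114, 117, 120, 122, 125, 127,
    129, 131, 133, 135, 137, 139, 141, 142, 144, 145, 147, 148, 150, 151, 152, 153, 155, 156, 157, 158, 159,
    160, 161, 162, 163, 164, 165, 166, 167, 168, 169, 170, 171, 171, 172, 173, 174, 174, 175, 176, 177, 177,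
    178, 179, 180]"

function log_up :: "int \<Rightarrow> int" where
  "log_up x = (if x \<le> 64 then log_table_up ! nat x else 30 + log_up ((x + 1) div 2))"
  by auto
termination by (relation "measure nat") auto

function log_low :: "int \<Rightarrow> int" where
  "log_low x = (if x \<le> 64 then log_table_low ! nat x else 30 + log_low (x div 2))"
  by auto
termination by (relation "measure nat") auto

fun absorb :: "int \<Rightarrow> int \<Rightarrow> int \<Rightarrow> (int \<times> int) list \<Rightarrow> int \<times> int \<times> (int \<times> int) list" where
  "absorb e U L [] = (U, L, [])"
| "absorb e U L ((q, p) # qs) =
     (if q \<le> e then absorb e (U + log_up p) (L + log_low p) qs else (U, L, (q, p) # qs))"

text \<open>A state \<open>(s, U, L, qs)\<close> holds upper and lower bounds \<open>U\<close>, \<open>L\<close> for \<open>\<psi>(s - 1)\<close>, in units of \<open>ln 2 / 30\<close>, and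
  the list of the pairs \<open>(p ^ k, p)\<close> with \<open>k \<ge> 2\<close> and \<open>p ^ k \<ge> s\<close>.\<close>

type_synonym table_state = "int \<times> int \<times> int \<times> (int \<times> int) list"

text \<open>The block \<open>s..e\<close> contributes \<open>c\<close> odd primes, each with a
  logarithm between those of \<open>s\<close> and \<open>e\<close>, and the absorbed prime powers.
  As psi is monotone, the whole block is safe once the upper bound at \<open>e\<close> lies below
  the upper line at \<open>s - 1\<close> and the lower bound at \<open>s - 1\<close> lies above the
  lower line at \<open>e\<close>. The factors 6931471 and 6931472 enclose
  \<open>10 ^ 7 * ln 2\<close>.\<close>

fun table_step :: "int list \<Rightarrow> nat \<Rightarrow> int \<Rightarrow> table_state \<Rightarrow> table_state option" where
  "table_step ps h len (s, U, L, qs) =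
     (let c = count_true (sieve ps s (replicate h True)); e = s + len - 1
      in case absorb e (U + c * log_up e) (L + c * log_low s) qs of (U', L', qs') \<Rightarrow>
         (if U' * 6931472 \<le> 30 * (10368000 * (s - 1) + 30000000) \<and>
             30 * (9600000 * (e + 1) - 70000000) \<le> L * 6931471
          then Some (s + len, U', L', qs') else None))"

fun table_run :: "int list \<Rightarrow> nat \<Rightarrow> int \<Rightarrow> nat \<Rightarrow> table_state \<Rightarrow> table_state option" where
  "table_run ps h len 0 st = Some st"
| "table_run ps h len (Suc n) st =
     (case table_step ps h len st of None \<Rightarrow> None | Some st' \<Rightarrow> table_run ps h len n st')"

definition odd_primes_256 :: "int list" where
  "odd_primes_256 = [3, 5, 7, 11, 13, 17, 19, 23, 29, 31, 37, 41, 43, 47, 53, 59, 61, 67, 71, 73, 79, 83, 89,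
    97, 101, 103, 107, 109, 113, 127, 131, 137, 139, 149, 151, 157, 163, 167, 173, 179, 181, 191, 193, 197,
    199, 211, 223, 227, 229, 233, 239, 241, 251]"

definition small_powers :: "(int \<times> int) list" where
  "small_powers = [(4, 2), (8, 2), (9, 3), (16, 2), (25, 5), (27, 3), (32, 2), (49, 7), (64, 2), (81, 3),
    (121, 11), (125, 5), (128, 2), (169, 13), (243, 3), (256, 2), (289, 17), (343, 7), (361, 19), (512, 2),
    (529, 23), (625, 5), (729, 3), (841, 29), (961, 31), (1024, 2), (1331, 11), (1369, 37), (1681, 41),
    (1849, 43), (2048, 2), (2187, 3), (2197, 13), (2209, 47), (2401, 7), (2809, 53), (3125, 5), (3481, 59),
    (3721, 61), (4096, 2), (4489, 67), (4913, 17), (5041, 71), (5329, 73), (6241, 79), (6561, 3), (6859, 19),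
    (6889, 83), (7921, 89), (8192, 2), (9409, 97), (10201, 101), (10609, 103), (11449, 107), (11881, 109),
    (12167, 23), (12769, 113), (14641, 11), (15625, 5), (16129, 127), (16384, 2), (16807, 7), (17161, 131),
    (18769, 137), (19321, 139), (19683, 3), (22201, 149), (22801, 151), (24389, 29), (24649, 157),
    (26569, 163), (27889, 167), (28561, 13), (29791, 31), (29929, 173), (32041, 179), (32761, 181),
    (32768, 2), (36481, 191), (37249, 193), (38809, 197), (39601, 199), (44521, 211), (49729, 223),
    (50653, 37), (51529, 227), (52441, 229), (54289, 233), (57121, 239), (58081, 241), (59049, 3),
    (63001, 251), (65536, 2)]"

text \<open>The runs below each go from one power of two to the next. Only primes up to the square
  root of the end take part; they are smaller than the start, so none of them crosses itself
  out.\<close>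

definition octave :: "nat \<Rightarrow> int \<Rightarrow> nat \<Rightarrow> table_state \<Rightarrow> table_state option" where
  "octave h len n st =
     table_run (filter (\<lambda>p. p * p \<le> fst st + len * int n) odd_primes_256) h len n st"

declare log_up.simps [simp del] log_low.simps [simp del] table_step.simps [simp del]

section \<open>Correctness of the sieve and of the logarithm bounds\<close>

definition chebyshev_psi :: "nat \<Rightarrow> real" where
  "chebyshev_psi n = (\<Sum>k\<le>n. mangoldt k)"

lemma chebyshev_psi_mono: "m \<le> n \<Longrightarrow> chebyshev_psi m \<le> chebyshev_psi n"
  unfolding chebyshev_psi_def by (intro sum_mono2) (auto simp: mangoldt_nonneg)

lemma length_sieve [simp]: "length (sieve ps s xs) = length xs"
  by (induction ps s xs rule: sieve.induct) auto

text \<open>With \<open>r = s mod p\<close>, the congruence \<open>2 i = - r\<close> modulo the odd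
  \<open>p\<close> is solved by halving whichever of \<open>2 p - r\<close> and \<open>p - r\<close>
  is even. The case \<open>r = 0\<close> is separate to keep the offset below
  \<open>p\<close>.\<close>

lemma sieve_offset:
  fixes s p :: int
  assumes "odd s" "odd p" "p > 1"
  shows "int (sieve_offset s p) < p" "p dvd s + 2 * int (sieve_offset s p)"
proof -
  define r where "r = s mod p"
  have r: "0 \<le> r" "r < p" using assms by (auto simp: r_def)
  have sr: "s = p * (s div p) + r" by (simp add: r_def)
  define o' where "o' = (if r = 0 then 0 else if r mod 2 = 0 then p - r div 2 else (p - r) div 2)"
  have o_eq: "int (sieve_offset s p) = o'"
  proof -
    have "o' \<ge> 0" using r unfolding o'_def by auto
    then show ?thesis unfolding sieve_offset_def o'_def r_def[symmetric] Let_def by simp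
  qed
  have "o' < p" using r unfolding o'_def by (auto; presburger)
  moreover have "p dvd r + 2 * o'"
  proof (cases "r mod 2 = 0")
    case True
    then have "r + 2 * o' = (if r = 0 then 0 else 2 * p)" unfolding o'_def by (auto; presburger)
    then show ?thesis by auto
  next
    case False
    then have "r + 2 * o' = p" using assms(2) r unfolding o'_def by (auto; presburger)
    then show ?thesis by auto
  qed
  then have "p dvd s + 2 * o'"
    using sr by (metis add.assoc dvd_add_right_iff dvd_triv_left)
  ultimately show "int (sieve_offset s p) < p" "p dvd s + 2 * int (sieve_offset s p)"
    unfolding o_eq by auto
qed

lemma nth_sieve:
  assumes "odd s" "\<And>p. p \<in> set ps \<Longrightarrow> odd p \<and> p > 1" "i < length xs"
  shows "sieve ps s xs ! i \<longleftrightarrow> xs ! i \<and> (\<forall>p\<in>set ps. \<not> p dvd s + 2 * int i)"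
  using assms
proof (induction ps s xs rule: sieve.induct)
  case (2 p ps s xs)
  have p: "odd p" "p > 1" using 2 by auto
  define m where "m = sieve_offset s p"
  have m: "int m < p" "p dvd s + 2 * int m" using sieve_offset[OF 2(2) p] by (auto simp: m_def)
  have "map_every (\<lambda>_. False) (nat (p - 1)) m xs ! i
      \<longleftrightarrow> xs ! i \<and> \<not> Suc (nat (p - 1)) dvd i + (Suc (nat (p - 1)) - m)"
    using nth_map_every[of m "nat (p - 1)" i xs "\<lambda>_. False"] m 2 by auto
  also have "Suc (nat (p - 1)) dvd i + (Suc (nat (p - 1)) - m) \<longleftrightarrow> p dvd int i + (p - int m)"
  proof -
    have "Suc (nat (p - 1)) dvd i + (Suc (nat (p - 1)) - m)
        \<longleftrightarrow> int (Suc (nat (p - 1))) dvd int (i + (Suc (nat (p - 1)) - m))"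
      by (simp only: int_dvd_int_iff)
    also have "int (Suc (nat (p - 1))) = p" using p by simp
    also have "int (i + (Suc (nat (p - 1)) - m)) = int i + (p - int m)"
      using p m by (simp add: of_nat_diff)
    finally show ?thesis .
  qed
  also have "\<dots> \<longleftrightarrow> p dvd 2 * (int i + (p - int m))"
    by (rule coprime_dvd_mult_right_iff[symmetric]) (use p in simp)
  also have "\<dots> \<longleftrightarrow> p dvd s + 2 * int i"
  proof -
    have "s + 2 * int i = 2 * (int i + (p - int m)) + ((s + 2 * int m) + p * (-2))"
      by simp
    moreover have "p dvd (s + 2 * int m) + p * (-2)" by (rule dvd_add[OF m(2)]) simp
    ultimately show ?thesis by (metis dvd_add_left_iff)
  qed
  finally show ?case using 2 unfolding m_def by auto
qed simp

lemma count_true: "of_int (count_true xs) = (\<Sum>i<length xs. of_bool (xs ! i) :: real)"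
proof (induction xs)
  case (Cons x xs)
  show ?case using Cons.IH by (simp add: sum.lessThan_Suc_shift del: sum.lessThan_Suc)
qed simp

text \<open>\<open>30 * ln x \<le> u * ln 2\<close> is equivalent to
  \<open>x ^ 30 \<le> 2 ^ u\<close>, so integer arithmetic verifies the tables.\<close>

lemma log_tables:
  "\<forall>x\<in>set [1..64]. x ^ 30 \<le> 2 ^ nat (log_table_up ! nat x) \<and> 2 ^ nat (log_table_low ! nat x) \<le> x ^ 30
     \<and> 0 \<le> log_table_up ! nat x \<and> 0 \<le> log_table_low ! nat x"
  by code_simp

text \<open>Beyond the table, halving with rounding up costs exactly 30 units, which is
  \<open>ln 2\<close>.\<close>

lemma ln_le_log_up:
  assumes "x \<ge> 1" shows "30 * ln (real_of_int x) \<le> real_of_int (log_up x) * ln 2"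
  using assms
proof (induction x rule: log_up.induct)
  case (1 x)
  show ?case
  proof (cases "x \<le> 64")
    case True
    define u where "u = nat (log_table_up ! nat x)"
    have u: "x ^ 30 \<le> 2 ^ u" "0 \<le> log_table_up ! nat x"
      using log_tables True 1 by (auto simp: u_def)
    have "real_of_int (x ^ 30) \<le> real_of_int (2 ^ u)" using u(1) by (simp only: of_int_le_iff)
    then have "ln (real_of_int x ^ 30) \<le> ln (2 ^ u)" using 1 by (subst ln_le_cancel_iff) auto
    moreover have "real u = real_of_int (log_up x)" using True u by (simp add: u_def log_up.simps)
    ultimately show ?thesis using 1 by (simp add: ln_realpow)
  next
    case False
    define y where "y = (x + 1) div 2"
    have y: "x \<le> 2 * y" "y \<ge> 1" using False by (auto simp: y_def)
    have "ln (real_of_int x) \<le> ln (2 * real_of_int y)" using y 1 by (subst ln_le_cancel_iff) auto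
    also have "\<dots> = ln 2 + ln (real_of_int y)" using y by (simp add: ln_mult)
    finally have "30 * ln (real_of_int x) \<le> 30 * ln 2 + 30 * ln (real_of_int y)" by simp
    also have "30 * ln (real_of_int y) \<le> real_of_int (log_up y) * ln 2"
      using 1(1)[OF False] y(2) by (simp add: y_def)
    finally show ?thesis using False by (simp add: y_def log_up.simps[of x] algebra_simps)
  qed
qed

lemma log_low_le_ln:
  assumes "x \<ge> 1" shows "real_of_int (log_low x) * ln 2 \<le> 30 * ln (real_of_int x)"
  using assms
proof (induction x rule: log_low.induct)
  case (1 x)
  show ?case
  proof (cases "x \<le> 64")
    case True
    define u where "u = nat (log_table_low ! nat x)"
    have u: "2 ^ u \<le> x ^ 30" "0 \<le> log_table_low ! nat x"
      using log_tables True 1 by (auto simp: u_def)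
    have "real_of_int (2 ^ u) \<le> real_of_int (x ^ 30)" using u(1) by (simp only: of_int_le_iff)
    then have "ln (2 ^ u) \<le> ln (real_of_int x ^ 30)" using 1 by (subst ln_le_cancel_iff) auto
    moreover have "real u = real_of_int (log_low x)" using True u by (simp add: u_def log_low.simps)
    ultimately show ?thesis using 1 by (simp add: ln_realpow)
  next
    case False
    define y where "y = x div 2"
    have y: "2 * y \<le> x" "y \<ge> 1" using False by (auto simp: y_def)
    have "real_of_int (log_low y) * ln 2 + 30 * ln 2 \<le> 30 * (ln 2 + ln (real_of_int y))"
      using 1(1)[OF False] y(2) by (simp add: y_def)
    also have "ln 2 + ln (real_of_int y) = ln (2 * real_of_int y)"
      using y by (simp add: ln_mult)
    also have "\<dots> \<le> ln (real_of_int x)" using y 1 by (subst ln_le_cancel_iff) auto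
    finally show ?thesis using False by (simp add: y_def log_low.simps[of x] algebra_simps)
  qed
qed

lemma ln_2_bounds: "6931471 / 10000000 \<le> ln (2::real)" "ln (2::real) \<le> 6931472 / 10000000"
  using ln_approx_bounds[of 2 7] by (simp_all add: eval_nat_numeral)

section \<open>One block of the table, and runs of blocks\<close>

text \<open>The part of the von Mangoldt function that is due to the listed prime powers.\<close>

definition power_weight :: "(int \<times> int) list \<Rightarrow> int \<Rightarrow> real" where
  "power_weight qs x = (\<Sum>(q, p)\<leftarrow>qs. if q = x then ln (real_of_int p) else 0)"

lemma power_weight_zero: "\<forall>(q, p)\<in>set qs. q \<noteq> x \<Longrightarrow> power_weight qs x = 0"
  unfolding power_weight_def by (induction qs) auto

lemma sum_power_weight:
  assumes "\<forall>(q, p)\<in>set qs. s \<le> q"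
  shows "(\<Sum>x\<in>{s..e}. power_weight qs x) = (\<Sum>(q, p)\<leftarrow>qs. if q \<le> e then ln (real_of_int p) else 0)"
  using assms unfolding power_weight_def
  by (induction qs) (auto simp: sum.distrib)

lemma absorb:
  assumes "absorb e U L qs = (U', L', qs')" "sorted (map fst qs)" "\<forall>(q, p)\<in>set qs. p \<ge> 1"
  defines "S \<equiv> (\<Sum>(q, p)\<leftarrow>qs. if q \<le> e then ln (real_of_int p) else 0)"
  shows "30 * S \<le> (U' - U) * ln 2" "(L' - L) * ln 2 \<le> 30 * S" "sorted (map fst qs')"
    "\<forall>(q, p)\<in>set qs'. e < q" "set qs' \<subseteq> set qs" "\<forall>x>e. power_weight qs' x = power_weight qs x"
proof -
  have "30 * S \<le> (U' - U) * ln 2 \<and> (L' - L) * ln 2 \<le> 30 * S \<and> sorted (map fst qs')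
    \<and> (\<forall>(q, p)\<in>set qs'. e < q) \<and> set qs' \<subseteq> set qs \<and> (\<forall>x>e. power_weight qs' x = power_weight qs x)"
    using assms(1-3) unfolding S_def
  proof (induction e U L qs rule: absorb.induct)
    case (2 e U L q p qs)
    show ?case
    proof (cases "q \<le> e")
      case True
      have "30 * ln (real_of_int p) \<le> real_of_int (log_up p) * ln 2"
        "real_of_int (log_low p) * ln 2 \<le> 30 * ln (real_of_int p)"
        using 2(4) by (auto intro: ln_le_log_up log_low_le_ln)
      then show ?thesis using 2 True by (auto simp: algebra_simps power_weight_def)
    next
      case False
      have "(\<Sum>(q, p)\<leftarrow>qs. if q \<le> e then ln (real_of_int p) else 0) = 0"
        using 2(3) False by (induction qs) auto
      moreover have "\<forall>(q, p)\<in>set qs. e < q" using 2(3) False by force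
      ultimately show ?thesis using 2(2-4) False by auto
    qed
  qed auto
  then show "30 * S \<le> (U' - U) * ln 2" "(L' - L) * ln 2 \<le> 30 * S" "sorted (map fst qs')"
    "\<forall>(q, p)\<in>set qs'. e < q" "set qs' \<subseteq> set qs" "\<forall>x>e. power_weight qs' x = power_weight qs x"
    by blast+
qed

lemma exists_prime_factor_le_sqrt:
  assumes "\<not> prime (n::nat)" "n > 1"
  obtains p where "prime p" "p dvd n" "p * p \<le> n"
proof -
  obtain a where a: "a dvd n" "a \<noteq> 1" "a \<noteq> n" using assms by (auto simp: prime_nat_iff)
  then obtain b where ab: "n = a * b" by (auto simp: dvd_def)
  have "a > 1" "b > 1" using a ab assms by (auto simp: nat_neq_iff)
  note ab = ab this
  define c where "c = min a b"
  have c: "c dvd n" "c > 1" "c * c \<le> n"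
    using ab by (auto simp: c_def min_def intro: mult_mono)
  obtain p where p: "prime p" "p dvd c" using c(2) prime_factor_nat[of c] by auto
  have "p \<le> c" using p(2) c(2) by (auto dest: dvd_imp_le)
  then have "p * p \<le> n" using c(3) by (meson le_trans mult_le_mono)
  then show ?thesis using that p c by (meson dvd_trans)
qed

text \<open>Trial division by 2 up to 15 decides primality below
  \<open>256 = 16 * 16\<close>.\<close>

lemma odd_primes_256_prime: "\<forall>p\<in>set odd_primes_256. prime p \<and> odd p \<and> p > 1"
proof
  fix p assume p: "p \<in> set odd_primes_256"
  have "\<forall>p\<in>set odd_primes_256. p mod 2 = 1 \<and> 1 < p \<and> p < 256 \<and> (\<forall>d\<in>set [2..15]. p mod d = 0 \<longrightarrow> p = d)"
    by code_simp
  note c = bspec[OF this p]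
  have p2: "p mod 2 = 1" "1 < p" "p < 256"
    by (rule conjunct1[OF c], rule conjunct1[OF conjunct2[OF c]], rule conjunct1[OF conjunct2[OF conjunct2[OF c]]])
  have small: "p = d" if "d \<in> set [2..15]" "p mod d = 0" for d
    using bspec[OF conjunct2[OF conjunct2[OF conjunct2[OF c]]] that(1)] that(2) by (rule mp)
  have "prime (nat p)"
  proof (rule ccontr)
    assume "\<not> prime (nat p)"
    moreover have "nat p > 1" using p2(2) by simp
    ultimately obtain r where r: "prime r" "r dvd nat p" "r * r \<le> nat p"
      by (rule exists_prime_factor_le_sqrt)
    have "r \<ge> 2" using r(1) by (rule prime_ge_2_nat)
    have "r < 16"
    proof (rule ccontr)
      assume "\<not> r < 16"
      then have "16 * 16 \<le> r * r" by (intro mult_mono) auto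
      then show False using r(3) p2 by linarith
    qed
    then have "int r \<in> set [2..15]" using \<open>r \<ge> 2\<close> by (simp only: set_upto atLeastAtMost_iff) simp
    moreover have "int r dvd p" using r(2) p2(2) by (simp add: int_dvd_int_iff[symmetric])
    then have "p mod int r = 0" by simp
    ultimately have "p = int r" by (rule small)
    then have "r * r \<le> r" using r(3) by simp
    then show False using \<open>r \<ge> 2\<close> by simp
  qed
  then have "prime p" using p2(2) by simp
  moreover have "odd p" using p2(1) by presburger
  ultimately show "prime p \<and> odd p \<and> p > 1" using p2(2) by simp
qed

lemma odd_primes_256_complete:
  assumes "prime (p::int)" "odd p" "p < 256" shows "p \<in> set odd_primes_256"
proof -
  have *: "\<forall>n\<in>set [2..255]. n \<in> set odd_primes_256 \<or> (\<exists>d\<in>set [2,3,5,7,11,13]. n mod d = 0 \<and> n \<noteq> d) \<or> n = 2"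
    by code_simp
  have "p \<ge> 2" using assms(1) by (rule prime_ge_2_int)
  then have "p \<in> set [2..255]" using assms(3) by (simp only: set_upto atLeastAtMost_iff) simp
  note bspec[OF * this]
  then show ?thesis
  proof (elim disjE bexE conjE)
    fix d assume d: "d \<in> set [2, 3, 5, 7, 11, 13]" "p mod d = 0" "p \<noteq> d"
    have "d > 1" using d(1) by auto
    moreover have "d dvd p" using d(2) by (rule mod_0_imp_dvd)
    moreover have "0 \<le> d \<and> d dvd p \<longrightarrow> d = 1 \<or> d = p"
      using assms(1) unfolding prime_int_iff by blast
    ultimately have False using d(3) by linarith
    then show ?thesis ..
  qed (use assms(2) in simp_all)
qed

text \<open>A sieving prime dividing a prime \<open>x\<close> would equal \<open>x\<close>, against
  \<open>B < s * s\<close>. Conversely, a composite odd \<open>x\<close> has an odd prime factor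
  with square at most \<open>B\<close>; it cannot reach 257, hence it is in the list.\<close>

lemma prime_iff_sieve:
  assumes "odd (x::int)" "s \<le> x" "x \<le> B" "B < s * s" "B < 256 * 256 + 2" "s \<ge> 3"
  shows "prime (nat x) \<longleftrightarrow> (\<forall>p\<in>set (filter (\<lambda>p. p * p \<le> B) odd_primes_256). \<not> p dvd x)"
proof
  assume pr: "prime (nat x)"
  show "\<forall>p\<in>set (filter (\<lambda>p. p * p \<le> B) odd_primes_256). \<not> p dvd x"
  proof (intro ballI notI)
    fix p assume p: "p \<in> set (filter (\<lambda>p. p * p \<le> B) odd_primes_256)" "p dvd x"
    have "p > 1" using p odd_primes_256_prime by auto
    have "prime x" using pr assms by (simp add: prime_nat_iff_prime)
    moreover have "0 \<le> p" using \<open>p > 1\<close> by simp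
    ultimately have "p = 1 \<or> p = x" using p(2) unfolding prime_int_iff by blast
    then have "p = x" using \<open>p > 1\<close> by simp
    then have "x * x \<le> B" using p by simp
    moreover have "s * s \<le> x * x" using assms by (intro mult_mono) auto
    ultimately show False using assms by simp
  qed
next
  assume *: "\<forall>p\<in>set (filter (\<lambda>p. p * p \<le> B) odd_primes_256). \<not> p dvd x"
  show "prime (nat x)"
  proof (rule ccontr)
    assume "\<not> prime (nat x)"
    then obtain p where p: "prime p" "p dvd nat x" "p * p \<le> nat x"
      using exists_prime_factor_le_sqrt[of "nat x"] assms by auto
    have x: "int p dvd x" "int p * int p \<le> x"
      using p assms by (auto simp: int_dvd_int_iff[symmetric] simp flip: of_nat_mult)
    have pp: "prime (int p)" using p by simp
    have "odd (int p)" using x(1) assms(1) dvd_trans by blast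
    moreover have "int p < 256"
    proof (rule ccontr)
      assume "\<not> int p < 256"
      then have "256 < int p" using \<open>odd (int p)\<close> by presburger
      then have "257 * 257 \<le> int p * int p" by (intro mult_mono) auto
      then show False using x assms by simp
    qed
    ultimately have "int p \<in> set odd_primes_256" using pp odd_primes_256_complete by blast
    then show False using * x assms(3) by auto
  qed
qed

definition table_inv :: "table_state \<Rightarrow> bool" where
  "table_inv st = (case st of (s, U, L, qs) \<Rightarrow>
     odd s \<and> s \<ge> 3 \<and> sorted (map fst qs) \<and> (\<forall>(q, p)\<in>set qs. s \<le> q \<and> p \<ge> 1) \<and>
     (\<forall>x. s \<le> x \<and> x \<le> 65536 \<longrightarrow>
        mangoldt (nat x) = (if odd x \<and> prime (nat x) then ln (real_of_int x) else 0) + power_weight qs x) \<and>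
     30 * chebyshev_psi (nat (s - 1)) \<le> U * ln 2 \<and> L * ln 2 \<le> 30 * chebyshev_psi (nat (s - 1)))"

text \<open>The slope 1.0368 is just below \<open>11 / 5 - ln (16 / 5)\<close>. The lower line is
  taken at \<open>n + 1\<close> so that it survives rounding an argument \<open>N / k\<close> down
  to \<open>N div k\<close>.\<close>

definition psi_bounds :: "nat \<Rightarrow> bool" where
  "psi_bounds n \<longleftrightarrow> chebyshev_psi n \<le> 10368 / 10000 * n + 3 \<and> 96 / 100 * (n + 1) - 7 \<le> chebyshev_psi n"

lemma table_step:
  assumes "table_step (filter (\<lambda>p. p * p \<le> B) odd_primes_256) h len (s, U, L, qs) = Some st'"
    and inv: "table_inv (s, U, L, qs)" and len: "len = 2 * int h" "h > 0"
    and B: "s + len - 1 \<le> B" "B < s * s" "B \<le> 65537" and e65: "s + len - 1 \<le> 65536"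
  shows "table_inv st' \<and> fst st' = s + len \<and> (\<forall>n. s - 1 \<le> int n \<and> int n < s + len \<longrightarrow> psi_bounds n)"
proof -
  define ps where "ps = filter (\<lambda>p. p * p \<le> B) odd_primes_256"
  define e where "e = s + len - 1"
  define xs where "xs = sieve ps s (replicate h True)"
  define c where "c = count_true xs"
  obtain U' L' qs' where ab: "absorb e (U + c * log_up e) (L + c * log_low s) qs = (U', L', qs')"
    using prod_cases3 by blast
  have chk: "U' * 6931472 \<le> 30 * (10368000 * (s - 1) + 30000000)"
    "30 * (9600000 * (e + 1) - 70000000) \<le> L * 6931471" and st': "st' = (s + len, U', L', qs')"
    using assms(1) ab unfolding table_step.simps Let_def ps_def[symmetric] xs_def[symmetric]
      c_def[symmetric] e_def[symmetric] by (auto split: if_splits)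
  have s: "odd s" "s \<ge> 3" and qs: "sorted (map fst qs)" "\<forall>(q, p)\<in>set qs. s \<le> q \<and> p \<ge> 1"
    and mang: "\<And>x. s \<le> x \<Longrightarrow> x \<le> 65536 \<Longrightarrow>
        mangoldt (nat x) = (if odd x \<and> prime (nat x) then ln (real_of_int x) else 0) + power_weight qs x"
    and UL: "30 * chebyshev_psi (nat (s - 1)) \<le> U * ln 2" "L * ln 2 \<le> 30 * chebyshev_psi (nat (s - 1))"
    using inv unfolding table_inv_def by auto
  define S where "S = (\<Sum>(q, p)\<leftarrow>qs. if q \<le> e then ln (real_of_int p) else 0)"
  have "\<forall>(q, p)\<in>set qs. p \<ge> 1" using qs(2) by auto
  note absb = absorb[OF ab qs(1) this, folded S_def]
  define P where "P = (\<Sum>i<h. if prime (nat (s + 2 * int i)) then ln (real_of_int (s + 2 * int i)) else 0)"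
  have odd_sum: "(\<Sum>x\<in>{s..e}. if odd x \<and> prime (nat x) then ln (real_of_int x) else 0) = P"
  proof -
    have "P = (\<Sum>x\<in>(\<lambda>i. s + 2 * int i) ` {..<h}. if prime (nat x) then ln (real_of_int x) else 0)"
      unfolding P_def by (subst sum.reindex) (auto simp: inj_on_def)
    also have "\<dots> = (\<Sum>x\<in>(\<lambda>i. s + 2 * int i) ` {..<h}. if odd x \<and> prime (nat x) then ln (real_of_int x) else 0)"
      using s by (intro sum.cong) auto
    also have "\<dots> = (\<Sum>x\<in>{s..e}. if odd x \<and> prime (nat x) then ln (real_of_int x) else 0)"
    proof (intro sum.mono_neutral_left ballI)
      fix x assume x: "x \<in> {s..e} - (\<lambda>i. s + 2 * int i) ` {..<h}"
      have "even x"
      proof (rule ccontr)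
        assume "odd x"
        then have "even (x - s)" using s by simp
        then obtain k where k: "x - s = 2 * k" unfolding dvd_def by blast
        have "0 \<le> k" "k < int h" using k x len unfolding e_def by auto
        then have "x = s + 2 * int (nat k)" "nat k < h" using k by auto
        then show False using x by blast
      qed
      then show "(if odd x \<and> prime (nat x) then ln (real_of_int x) else 0) = 0" by simp
    qed (use len in \<open>auto simp: e_def\<close>)
    finally show ?thesis by simp
  qed
  \<comment> \<open>The increase of psi over the block splits into the odd primes \<open>P\<close>
    found by the sieve and the higher prime powers \<open>S\<close> taken from the list.\<close>
  have psi_e: "chebyshev_psi (nat e) = chebyshev_psi (nat (s - 1)) + P + S"
  proof -
    have "chebyshev_psi (nat e) = chebyshev_psi (nat (s - 1)) + (\<Sum>k\<in>{nat s..nat e}. mangoldt k)"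
    proof -
      have "{..nat e} = {..nat (s - 1)} \<union> {nat s..nat e}" "{..nat (s - 1)} \<inter> {nat s..nat e} = {}"
        using s len by (auto simp: e_def)
      then show ?thesis unfolding chebyshev_psi_def by (simp add: sum.union_disjoint)
    qed
    also have "(\<Sum>k\<in>{nat s..nat e}. mangoldt k) = (\<Sum>x\<in>{s..e}. mangoldt (nat x) :: real)"
      by (rule sum.reindex_bij_witness[of _ nat int]) (use s in auto)
    also have "\<dots> = (\<Sum>x\<in>{s..e}. (if odd x \<and> prime (nat x) then ln (real_of_int x) else 0) + power_weight qs x)"
      using e65 by (intro sum.cong mang) (auto simp: e_def)
    also have "\<dots> = P + S"
      unfolding sum.distrib odd_sum S_def using qs(2) by (subst sum_power_weight) auto
    finally show ?thesis by simp
  qed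
  have xs: "length xs = h" "\<And>i. i < h \<Longrightarrow> xs ! i \<longleftrightarrow> prime (nat (s + 2 * int i))"
  proof -
    show "length xs = h" by (simp add: xs_def)
    fix i assume i: "i < h"
    have ps: "\<And>p. p \<in> set ps \<Longrightarrow> odd p \<and> p > 1" using odd_primes_256_prime by (auto simp: ps_def)
    have "xs ! i \<longleftrightarrow> (\<forall>p\<in>set ps. \<not> p dvd s + 2 * int i)"
      unfolding xs_def using nth_sieve[OF s(1), of ps i "replicate h True"] ps i by simp
    also have "\<dots> \<longleftrightarrow> prime (nat (s + 2 * int i))"
      unfolding ps_def using i s len B by (intro prime_iff_sieve[symmetric, where s = s]) auto
    finally show "xs ! i \<longleftrightarrow> prime (nat (s + 2 * int i))" .
  qed
  have c: "real_of_int c = (\<Sum>i<h. of_bool (prime (nat (s + 2 * int i))))"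
    unfolding c_def count_true using xs by simp
  have P_up: "30 * P \<le> (c * log_up e) * ln 2"
  proof -
    have "P \<le> (\<Sum>i<h. of_bool (prime (nat (s + 2 * int i))) * ln (real_of_int e))"
      unfolding P_def using s len by (intro sum_mono) (auto simp: e_def)
    also have "\<dots> = c * ln (real_of_int e)" by (simp add: c sum_distrib_right)
    finally have "30 * P \<le> c * (30 * ln (real_of_int e))" by simp
    also have "\<dots> \<le> c * (log_up e * ln 2)"
      using s len by (intro mult_left_mono ln_le_log_up) (auto simp: e_def c intro!: sum_nonneg)
    finally show ?thesis by simp
  qed
  have P_low: "(c * log_low s) * ln 2 \<le> 30 * P"
  proof -
    have "c * (log_low s * ln 2) \<le> c * (30 * ln (real_of_int s))"
      using s by (intro mult_left_mono log_low_le_ln) (auto simp: c intro!: sum_nonneg)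
    also have "\<dots> = 30 * (\<Sum>i<h. of_bool (prime (nat (s + 2 * int i))) * ln (real_of_int s))"
      by (simp add: c sum_distrib_right)
    also have "\<dots> \<le> 30 * P"
      unfolding P_def using s by (intro mult_left_mono sum_mono) auto
    finally show ?thesis by simp
  qed
  have up: "30 * chebyshev_psi (nat e) \<le> U' * ln 2"
    using psi_e UL(1) P_up absb(1) by (simp add: algebra_simps)
  have low: "L' * ln 2 \<le> 30 * chebyshev_psi (nat e)"
    using psi_e UL(2) P_low absb(2) by (simp add: algebra_simps)
  have "table_inv st'"
    unfolding st' table_inv_def prod.case
  proof (intro conjI allI impI)
    show "odd (s + len)" "3 \<le> s + len" using s len by auto
    show "sorted (map fst qs')" by (rule absb(3))
    show "\<forall>(q, p)\<in>set qs'. s + len \<le> q \<and> 1 \<le> p" using absb(4,5) qs(2) by (fastforce simp: e_def)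
    fix x assume x: "s + len \<le> x \<and> x \<le> 65536"
    then show "mangoldt (nat x) = (if odd x \<and> prime (nat x) then ln (real_of_int x) else 0) + power_weight qs' x"
      using mang[of x] absb(6) len by (simp add: e_def)
  next
    have "s + len - 1 = e" by (simp add: e_def)
    then show "30 * chebyshev_psi (nat (s + len - 1)) \<le> U' * ln 2"
      "L' * ln 2 \<le> 30 * chebyshev_psi (nat (s + len - 1))" using up low by simp_all
  qed
  \<comment> \<open>Monotonicity sandwiches psi at \<open>n\<close> between its values at the two
    ends of the block, for which the check was made.\<close>
  moreover have "psi_bounds n" if n: "s - 1 \<le> int n" "int n < s + len" for n
  proof -
    note ln2 = ln_2_bounds
    have m: "chebyshev_psi n \<le> chebyshev_psi (nat e)" "chebyshev_psi (nat (s - 1)) \<le> chebyshev_psi n"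
      using n by (auto intro!: chebyshev_psi_mono simp: e_def)
    \<comment> \<open>Replacing \<open>ln 2\<close> by a larger decimal needs a nonnegative
      factor.\<close>
    have U0: "0 \<le> real_of_int U'"
    proof -
      have "0 \<le> chebyshev_psi (nat e)" unfolding chebyshev_psi_def by (intro sum_nonneg) (auto simp: mangoldt_nonneg)
      then have "0 \<le> U' * ln 2" using up by linarith
      then show ?thesis by (simp add: zero_le_mult_iff)
    qed
    have "30 * chebyshev_psi n \<le> U' * (6931472 / 10000000)"
      using up m mult_left_mono[OF ln2(2) U0] by linarith
    also have "\<dots> \<le> 30 * (10368 / 10000 * (real_of_int s - 1) + 3)"
    proof -
      have "real_of_int (U' * 6931472) \<le> real_of_int (30 * (10368000 * (s - 1) + 30000000))"
        using chk(1) by (simp only: of_int_le_iff)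
      then have "real_of_int U' * 6931472 \<le> 30 * (10368000 * (real_of_int s - 1) + 30000000)" by simp
      then show ?thesis by (simp add: field_simps)
    qed
    finally have "chebyshev_psi n \<le> 10368 / 10000 * (real_of_int s - 1) + 3"
      by (simp only: mult_le_cancel_left_pos zero_less_numeral)
    also have "\<dots> \<le> 10368 / 10000 * n + 3" using n by simp
    finally have "chebyshev_psi n \<le> 10368 / 10000 * n + 3" .
    moreover have "96 / 100 * (real n + 1) - 7 \<le> chebyshev_psi n"
    \<comment> \<open>For negative \<open>L\<close> the decimal bound on \<open>ln 2\<close> would
      go the wrong way, but then the check forces the lower line to be nonpositive on the whole
      block.\<close>
    proof (cases "L \<ge> 0")
      case True
      have "real_of_int (30 * (9600000 * (e + 1) - 70000000)) \<le> real_of_int (L * 6931471)"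
        using chk(2) by (simp only: of_int_le_iff)
      then have "30 * (9600000 * (real_of_int e + 1) - 70000000) \<le> real_of_int L * 6931471" by simp
      then have "30 * (96 / 100 * (real_of_int e + 1) - 7) \<le> L * (6931471 / 10000000)" by (simp add: field_simps)
      also have "\<dots> \<le> L * ln 2" using ln2 True by (intro mult_left_mono) auto
      finally have "30 * (96 / 100 * (real_of_int e + 1) - 7) \<le> 30 * chebyshev_psi n"
        using UL(2) m by linarith
      then have "96 / 100 * (real_of_int e + 1) - 7 \<le> chebyshev_psi n"
        by (simp only: mult_le_cancel_left_pos zero_less_numeral)
      moreover have "96 / 100 * (real n + 1) - 7 \<le> 96 / 100 * (real_of_int e + 1) - 7"
        using n by (simp add: e_def)
      ultimately show ?thesis by linarith
    next
      case False
      then have "30 * (9600000 * (e + 1) - 70000000) \<le> 0" using chk(2) by simp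
      then have "96 * (e + 1) \<le> 700" by simp
      then have "96 * (int n + 1) \<le> 700" using n by (simp add: e_def)
      then have "real_of_int (96 * (int n + 1)) \<le> 700" by linarith
      then have "96 / 100 * (real n + 1) - 7 \<le> 0" by simp
      also have "0 \<le> chebyshev_psi n" unfolding chebyshev_psi_def by (intro sum_nonneg) (auto simp: mangoldt_nonneg)
      finally show ?thesis .
    qed
    ultimately show ?thesis by (simp add: psi_bounds_def)
  qed
  ultimately show ?thesis using st' by simp
qed

lemma table_run:
  assumes "table_run (filter (\<lambda>p. p * p \<le> B) odd_primes_256) h len n st = Some st'"
    and "table_inv st" "len = 2 * int h" "h > 0"
    and "fst st + len * int n \<le> B" "B < fst st * fst st" "B \<le> 65537"
  shows "table_inv st' \<and> fst st' = fst st + len * int n \<and>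
    (\<forall>k. fst st \<le> int k \<and> int k < fst st' \<longrightarrow> psi_bounds k)"
  using assms
proof (induction n arbitrary: st)
  case (Suc n)
  obtain s U L qs where st: "st = (s, U, L, qs)" by (cases st) auto
  obtain st1 where st1: "table_step (filter (\<lambda>p. p * p \<le> B) odd_primes_256) h len (s, U, L, qs) = Some st1"
    "table_run (filter (\<lambda>p. p * p \<le> B) odd_primes_256) h len n st1 = Some st'"
    using Suc.prems(1) unfolding st by (auto split: option.splits)
  have l: "0 \<le> len * int n" "len * int (Suc n) = len + len * int n" "s \<ge> 3"
    using Suc.prems(2,3) unfolding st by (auto simp: algebra_simps table_inv_def)
  have "s + len - 1 \<le> B" "B < s * s" "s + len - 1 \<le> 65536"
    using Suc.prems(5,6,7) l unfolding st fst_conv by linarith+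
  moreover have inv: "table_inv (s, U, L, qs)" using Suc.prems(2) unfolding st .
  ultimately have 1: "table_inv st1" "fst st1 = s + len" "\<And>n. s - 1 \<le> int n \<Longrightarrow> int n < s + len \<Longrightarrow> psi_bounds n"
    using table_step[OF st1(1) inv Suc.prems(3,4)] Suc.prems(7) by simp_all
  have "s * s \<le> (s + len) * (s + len)" using l Suc.prems(3) by (intro mult_mono) auto
  then have "table_inv st' \<and> fst st' = fst st1 + len * int n \<and>
    (\<forall>k. fst st1 \<le> int k \<and> int k < fst st' \<longrightarrow> psi_bounds k)"
    using Suc.prems l by (intro Suc.IH[OF st1(2)]) (auto simp: st 1)
  then have 2: "table_inv st'" "fst st' = s + len * int (Suc n)"
    "\<And>k. s + len \<le> int k \<Longrightarrow> int k < fst st' \<Longrightarrow> psi_bounds k"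
    using 1(2) l(2) by auto
  show ?case
  proof (intro conjI allI impI)
    fix k assume "fst st \<le> int k \<and> int k < fst st'"
    then show "psi_bounds k" using 1(3)[of k] 2(3)[of k] st by (cases "int k < s + len") auto
  qed (use 2 st in auto)
next
  case 0
  then have st': "st' = st" by simp
  show ?case unfolding st' using 0(2) by (intro conjI allI impI) auto
qed

lemma octave:
  assumes "octave h len n (s, st) = Some st'" "table_inv (s, st)" "len = 2 * int h" "h > 0"
    "s + len * int n < s * s" "s + len * int n \<le> 65537"
  shows "table_inv st'" "fst st' = s + len * int n"
    "\<And>k. s \<le> int k \<Longrightarrow> int k < s + len * int n \<Longrightarrow> psi_bounds k"
proof -
  have "table_run (filter (\<lambda>p. p * p \<le> s + len * int n) odd_primes_256) h len n (s, st) = Some st'"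
    using assms(1) by (simp only: octave_def fst_conv)
  note table_run[OF this assms(2-4), unfolded fst_conv, OF order_refl assms(5,6)]
  then show "table_inv st'" "fst st' = s + len * int n"
    "\<And>k. s \<le> int k \<Longrightarrow> int k < s + len * int n \<Longrightarrow> psi_bounds k" by auto
qed

section \<open>The prime powers up to 65536 and the evaluation of the table\<close>

lemma power_weight_in:
  assumes "distinct (map fst qs)" "(x, p) \<in> set qs"
  shows "power_weight qs x = ln (real_of_int p)"
  using assms
proof (induction qs)
  case (Cons a qs)
  obtain q r where a: "a = (q, r)" by (cases a)
  have tl: "power_weight (a # qs) x = (if q = x then ln (real_of_int r) else 0) + power_weight qs x"
    by (simp add: power_weight_def a)
  show ?case
  proof (cases "q = x")
    case True
    then have x: "x \<notin> fst ` set qs" using Cons.prems(1) a by simp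
    then have "(x, p) \<notin> set qs" by (metis fst_conv image_eqI)
    then have "r = p" using Cons.prems(2) a by simp
    moreover have "\<forall>y\<in>set qs. fst y \<noteq> x" using x by (metis image_eqI)
    then have "power_weight qs x = 0" by (intro power_weight_zero) (simp add: split_beta)
    ultimately show ?thesis using tl True by simp
  next
    case False
    then have "(x, p) \<in> set qs" "distinct (map fst qs)" using Cons.prems a by simp_all
    then show ?thesis using tl False Cons.IH by simp
  qed
qed simp

lemma small_powers_sound:
  "\<forall>x\<in>set small_powers. snd x \<in> set (2 # odd_primes_256) \<and> (\<exists>k\<in>set [2..<17]. fst x = snd x ^ k)"
  by code_simp

lemma small_powers_complete:
  "\<forall>p\<in>set (2 # odd_primes_256). \<forall>k\<in>set [2..<17]. p ^ k \<le> 65536 \<longrightarrow> (p ^ k, p) \<in> set small_powers"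
  by code_simp

lemma small_powers_sorted: "sorted (map fst small_powers)" "distinct (map fst small_powers)"
  unfolding small_powers_def by simp_all

text \<open>Finitely many candidates suffice: \<open>2 ^ 17\<close> and \<open>257 ^ 2\<close>
  exceed 65536, so exponents stay below 17 and bases below 257.\<close>

lemma small_powers_iff:
  "(x, p) \<in> set small_powers \<longleftrightarrow> x \<le> 65536 \<and> (\<exists>k\<ge>2. prime p \<and> x = p ^ k)"
proof
  assume *: "(x, p) \<in> set small_powers"
  have "\<forall>x\<in>set small_powers. fst x \<le> 65536" unfolding small_powers_def by simp
  then have "x \<le> 65536" using * by (auto dest: bspec[OF _ *])
  moreover have p: "p \<in> set (2 # odd_primes_256)" and ex: "\<exists>k\<in>set [2..<17]. x = p ^ k"
    using bspec[OF small_powers_sound *] by (simp_all only: fst_conv snd_conv)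
  have "p = 2 \<or> p \<in> set odd_primes_256" using p by simp
  then have "prime p" using odd_primes_256_prime by auto
  moreover obtain k where "k \<in> set [2..<17]" "x = p ^ k" using ex by blast
  then have "k \<ge> 2" "x = p ^ k" by (simp_all only: set_upt atLeastLessThan_iff)
  ultimately show "x \<le> 65536 \<and> (\<exists>k\<ge>2. prime p \<and> x = p ^ k)" by blast
next
  assume "x \<le> 65536 \<and> (\<exists>k\<ge>2. prime p \<and> x = p ^ k)"
  then obtain k where k: "k \<ge> 2" "prime p" "x = p ^ k" "x \<le> 65536" by blast
  have p2: "p \<ge> 2" using k prime_ge_2_int by blast
  have "k < 17"
  proof (rule ccontr)
    assume "\<not> k < 17"
    then have "(2::int) ^ 17 \<le> 2 ^ k" by (intro power_increasing) auto
    also have "\<dots> \<le> p ^ k" using p2 by (intro power_mono) auto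
    finally show False using k by simp
  qed
  moreover have "p < 257"
  proof (rule ccontr)
    assume "\<not> p < 257"
    then have "(257::int) ^ 2 \<le> p ^ 2" by (intro power_mono) auto
    also have "\<dots> \<le> p ^ k" using p2 k by (intro power_increasing) auto
    finally show False using k by simp
  qed
  then have "p \<in> set (2 # odd_primes_256)"
  proof (cases "p = 2")
    case False
    then have "odd p" using k(2) p2 by (simp add: prime_odd_int)
    then have "p < 256" using \<open>p < 257\<close> by presburger
    then show ?thesis using odd_primes_256_complete k(2) \<open>odd p\<close> by simp
  qed simp
  moreover have "k \<in> set [2..<17]" using k(1) \<open>k < 17\<close> by (simp only: set_upt atLeastLessThan_iff)
  ultimately show "(x, p) \<in> set small_powers" using small_powers_complete k(3,4) by blast
qed

text \<open>From 3 on every prime is odd, so the odd sieve and the list of higher powers together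
  account for every prime power.\<close>

lemma mangoldt_small:
  assumes "3 \<le> x" "x \<le> 65536"
  shows "mangoldt (nat x) = (if odd x \<and> prime (nat x) then ln (real_of_int x) else 0) + power_weight small_powers x"
proof (cases "primepow (nat x)")
  case False
  have "\<forall>(q, p)\<in>set small_powers. q \<noteq> x"
  proof safe
    fix p assume "(x, p) \<in> set small_powers"
    then obtain k where k: "k \<ge> 2" "prime p" "x = p ^ k" using small_powers_iff by auto
    have "nat x = nat p ^ k" using k by (simp add: nat_power_eq prime_ge_0_int)
    moreover have "prime (nat p)" using k by simp
    ultimately have "primepow (nat x)" using k unfolding primepow_def
      by (intro exI[of _ "nat p"] exI[of _ k]) simp
    then show False using False by simp
  qed
  then show ?thesis using False by (auto simp: mangoldt_def power_weight_zero)
next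
  case True
  then obtain p k where pk: "prime p" "k > 0" "nat x = p ^ k" unfolding primepow_def by auto
  have x: "x = int p ^ k" using pk(3) assms by (metis int_nat_eq of_nat_power order_trans zero_le_numeral)
  have m: "mangoldt (nat x) = ln (real p)" using pk by simp
  show ?thesis
  proof (cases "k = 1")
    case True
    then have "nat x = p" "x = int p" using pk x by simp_all
    then have "prime (nat x)" using pk by simp
    then have "odd x" using assms pk(1) \<open>x = int p\<close> by (simp add: prime_odd_nat)
    have "\<forall>(q, r)\<in>set small_powers. q \<noteq> x"
    proof safe
      fix r assume "(x, r) \<in> set small_powers"
      then obtain j where j: "j \<ge> 2" "x = r ^ j" using small_powers_iff by auto
      have "prime x" using pk \<open>x = int p\<close> by simp
      then show False using j by (auto simp: prime_power_iff)
    qed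
    then show ?thesis using \<open>prime (nat x)\<close> \<open>odd x\<close> m \<open>x = int p\<close> by (simp add: power_weight_zero)
  next
    case False
    then have "2 \<le> k \<and> prime (int p) \<and> x = int p ^ k" using pk x by simp
    then have "(x, int p) \<in> set small_powers" unfolding small_powers_iff using assms(2) by blast
    moreover have "\<not> prime (nat x)" using pk False by (simp add: prime_power_iff)
    ultimately show ?thesis using m power_weight_in[OF small_powers_sorted(2)] by simp
  qed
qed

lemma chebyshev_psi_2: "chebyshev_psi 2 = ln 2"
proof -
  have "{..2::nat} = {0, 1, 2}" by auto
  then show ?thesis by (simp add: chebyshev_psi_def)
qed

text \<open>\<open>chebyshev_psi 2 = ln 2\<close> is exactly 30 units, for both bounds.\<close>

lemma table_start: "table_inv (3, 30, 30, small_powers)"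
proof -
  have "\<forall>(q, p)\<in>set small_powers. 3 \<le> q \<and> 1 \<le> p"
    unfolding small_powers_def by simp
  moreover have "chebyshev_psi (nat (3 - 1)) = ln 2" using chebyshev_psi_2 by simp
  ultimately show ?thesis
    unfolding table_inv_def prod.case using small_powers_sorted(1) mangoldt_small by simp
qed

text \<open>Each of these evaluations carries the table from one power of two to the next. Explicit
  intermediate states make them independent computations, and \<open>drop\<close> abbreviates the
  prime powers left.\<close>

lemma octave_1: "octave 1 2 1 (3, 30, 30, small_powers) = Some (5, 120, 107, drop (Suc 0) small_powers)"
  by code_simp

lemma octave_2: "octave 1 2 2 (5, 120, 107, drop (Suc 0) small_powers) = Some (9, 318, 290, drop 2 small_powers)"
  by code_simp

lemma octave_3: "octave 1 2 4 (9, 318, 290, drop 2 small_powers) = Some (17, 619, 581, drop 4 small_powers)"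
  by code_simp

lemma octave_4: "octave 1 2 8 (17, 619, 581, drop 4 small_powers) = Some (33, 1459, 1404, drop 7 small_powers)"
  by code_simp

lemma octave_5: "octave 1 2 16 (33, 1459, 1404, drop 7 small_powers) = Some (65, 2756, 2686, drop 9 small_powers)"
  by code_simp

lemma octave_6: "octave 1 2 32 (65, 2756, 2686, drop 9 small_powers) = Some (129, 5565, 5467, drop 13 small_powers)"
  by code_simp

lemma octave_7: "octave 1 2 64 (129, 5565, 5467, drop 13 small_powers) = Some (257, 10977, 10834, drop 16 small_powers)"
  by code_simp

lemma octave_8: "octave 2 4 64 (257, 10977, 10834, drop 16 small_powers) = Some (513, 22413, 22184, drop 20 small_powers)"
  by code_simp

lemma octave_9: "octave 4 8 64 (513, 22413, 22184, drop 20 small_powers) = Some (1025, 44569, 44191, drop 26 small_powers)"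
  by code_simp

lemma octave_10: "octave 8 16 64 (1025, 44569, 44191, drop 26 small_powers) = Some (2049, 88659, 88014, drop 31 small_powers)"
  by code_simp

lemma octave_11: "octave 16 32 64 (2049, 88659, 88014, drop 31 small_powers) = Some (4097, 178304, 177164, drop 40 small_powers)"
  by code_simp

lemma octave_12: "octave 32 64 64 (4097, 178304, 177164, drop 40 small_powers) = Some (8193, 354901, 352859, drop 50 small_powers)"
  by code_simp

lemma octave_13: "octave 64 128 64 (8193, 354901, 352859, drop 50 small_powers) = Some (16385, 711971, 708243, drop 61 small_powers)"
  by code_simp

lemma octave_14: "octave 128 256 64 (16385, 711971, 708243, drop 61 small_powers) = Some (32769, 1420158, 1413331, drop 78 small_powers)"
  by code_simp

lemma octave_15: "octave 256 512 64 (32769, 1420158, 1413331, drop 78 small_powers) = Some (65537, 2839495, 2826847, [])"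
  by code_simp

lemma small_psi_bounds:
  assumes "n \<le> 65536"
  shows "psi_bounds n"
proof -
  note o1 = octave[OF octave_1 table_start, simplified]
  note o2 = octave[OF octave_2 o1(1), simplified]
  note o3 = octave[OF octave_3 o2(1), simplified]
  note o4 = octave[OF octave_4 o3(1), simplified]
  note o5 = octave[OF octave_5 o4(1), simplified]
  note o6 = octave[OF octave_6 o5(1), simplified]
  note o7 = octave[OF octave_7 o6(1), simplified]
  note o8 = octave[OF octave_8 o7(1), simplified]
  note o9 = octave[OF octave_9 o8(1), simplified]
  note o10 = octave[OF octave_10 o9(1), simplified]
  note o11 = octave[OF octave_11 o10(1), simplified]
  note o12 = octave[OF octave_12 o11(1), simplified]
  note o13 = octave[OF octave_13 o12(1), simplified]
  note o14 = octave[OF octave_14 o13(1), simplified]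
  note o15 = octave[OF octave_15 o14(1), simplified]
  have c0: "psi_bounds n" if "n < 3"
  proof -
    have "{..0::nat} = {0}" "{..1::nat} = {0, Suc 0}" "{..2::nat} = {0, 1, 2}" by auto
    then have "chebyshev_psi 0 = 0" "chebyshev_psi 1 = 0" "chebyshev_psi 2 = ln 2"
      by (simp_all add: chebyshev_psi_def)
    then have "psi_bounds 0" "psi_bounds 1" "psi_bounds 2"
      using ln_2_bounds by (simp_all add: psi_bounds_def)
    then show ?thesis using that by (auto simp: less_Suc_eq numeral_3_eq_3 numeral_2_eq_2)
  qed
  have c1: "psi_bounds n" if "n < 5" using c0 o1(3)[of n] that by (cases "n < 3") auto
  have c2: "psi_bounds n" if "n < 9" using c1 o2(3)[of n] that by (cases "n < 5") auto
  have c3: "psi_bounds n" if "n < 17" using c2 o3(3)[of n] that by (cases "n < 9") auto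
  have c4: "psi_bounds n" if "n < 33" using c3 o4(3)[of n] that by (cases "n < 17") auto
  have c5: "psi_bounds n" if "n < 65" using c4 o5(3)[of n] that by (cases "n < 33") auto
  have c6: "psi_bounds n" if "n < 129" using c5 o6(3)[of n] that by (cases "n < 65") auto
  have c7: "psi_bounds n" if "n < 257" using c6 o7(3)[of n] that by (cases "n < 129") auto
  have c8: "psi_bounds n" if "n < 513" using c7 o8(3)[of n] that by (cases "n < 257") auto
  have c9: "psi_bounds n" if "n < 1025" using c8 o9(3)[of n] that by (cases "n < 513") auto
  have c10: "psi_bounds n" if "n < 2049" using c9 o10(3)[of n] that by (cases "n < 1025") auto
  have c11: "psi_bounds n" if "n < 4097" using c10 o11(3)[of n] that by (cases "n < 2049") auto
  have c12: "psi_bounds n" if "n < 8193" using c11 o12(3)[of n] that by (cases "n < 4097") auto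
  have c13: "psi_bounds n" if "n < 16385" using c12 o13(3)[of n] that by (cases "n < 8193") auto
  have c14: "psi_bounds n" if "n < 32769" using c13 o14(3)[of n] that by (cases "n < 16385") auto
  have c15: "psi_bounds n" if "n < 65537" using c14 o15(3)[of n] that by (cases "n < 32769") auto
  show ?thesis using c15 assms by simp
qed

section \<open>Chebyshev's bounds by linear programming\<close>

text \<open>Passing from \<open>N\<close> to \<open>Suc N\<close> raises the quotient by one exactly
  for the divisors \<open>j\<close> of \<open>Suc N\<close>, and the von Mangoldt function sums to
  the logarithm over these.\<close>

lemma ln_fact_eq_mangoldt: "ln (fact N) = (\<Sum>j\<le>N. mangoldt j * real (N div j))"
proof (induction N)
  case (Suc N)
  have *: "real (Suc N div j) = real (N div j) + of_bool (j dvd Suc N)" for j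
    by (simp add: div_Suc dvd_eq_mod_eq_0)
  have "(\<Sum>j\<le>Suc N. mangoldt j * real (Suc N div j))
      = (\<Sum>j\<le>Suc N. mangoldt j * real (N div j)) + (\<Sum>j\<le>Suc N. mangoldt j * of_bool (j dvd Suc N))"
    unfolding * by (simp only: distrib_left sum.distrib)
  also have "(\<Sum>j\<le>Suc N. mangoldt j * real (N div j)) = ln (fact N)"
    using Suc.IH by simp
  also have "(\<Sum>j\<le>Suc N. mangoldt j * of_bool (j dvd Suc N)) = (\<Sum>j | j dvd Suc N. mangoldt j :: real)"
    by (rule sum.mono_neutral_cong_right) (auto dest: dvd_imp_le)
  also have "\<dots> = ln (real (Suc N))" using mangoldt_sum[of "Suc N", where ?'a = real] by simp
  finally show ?case by (simp add: ln_mult)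
qed simp

text \<open>This form depends on \<open>j\<close> only through \<open>mangoldt j\<close> and
  \<open>N div j\<close>, as does the formula for factorials, so the two can be compared term by
  term.\<close>

lemma chebyshev_psi_div:
  assumes "k > 0"
  shows "chebyshev_psi (N div k) = (\<Sum>j\<le>N. mangoldt j * of_bool (k \<le> N div j))"
  unfolding chebyshev_psi_def
proof (rule sum.mono_neutral_cong_left)
  have *: "k \<le> N div j \<longleftrightarrow> j \<le> N div k" if "j > 0" for j
    using assms that by (simp add: less_eq_div_iff_mult_less_eq mult.commute)
  show "{..N div k} \<subseteq> {..N}" using div_le_dividend le_trans by fastforce
  show "\<forall>j\<in>{..N} - {..N div k}. mangoldt j * of_bool (k \<le> N div j) = (0::real)"
    using * by (metis DiffE atMost_iff bot_nat_0.not_eq_extremum linorder_not_le mult_zero_right not_less_zero of_bool_eq(1))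
  show "mangoldt j = mangoldt j * of_bool (k \<le> N div j)" if "j \<in> {..N div k}" for j
    using *[of j] that by (cases "j = 0") auto
qed simp

lemma ln_fact_div:
  assumes "d > 0"
  shows "ln (fact (N div d)) = (\<Sum>j\<le>N. mangoldt j * real (N div j div d))"
proof -
  have "ln (fact (N div d)) = (\<Sum>j\<le>N div d. mangoldt j * real (N div d div j))"
    by (rule ln_fact_eq_mangoldt)
  also have "\<dots> = (\<Sum>j\<le>N. mangoldt j * real (N div d div j))"
    by (rule sum.mono_neutral_left) (auto simp: div_le_dividend intro: le_trans)
  also have "\<dots> = (\<Sum>j\<le>N. mangoldt j * real (N div j div d))"
    by (simp add: div_mult2_eq[symmetric] mult.commute)
  finally show ?thesis .
qed

text \<open>The von Mangoldt weights are nonnegative, so an inequality in the single integer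
  variable \<open>y = N div j\<close> can be summed over \<open>j\<close>.\<close>

lemma chebyshev_psi_le_combination:
  fixes cs :: "(nat \<times> real) list" and ws :: "(nat \<times> real) list"
  assumes "\<And>y. y \<ge> 1 \<Longrightarrow> s \<le> (\<Sum>(d, c)\<leftarrow>cs. c * real (y div d)) + (\<Sum>(k, w)\<leftarrow>ws. w * of_bool (k \<le> y))"
    and "\<forall>(d, c)\<in>set cs. d > 0" "\<forall>(k, w)\<in>set ws. k > 0"
  shows "s * chebyshev_psi N
    \<le> (\<Sum>(d, c)\<leftarrow>cs. c * ln (fact (N div d))) + (\<Sum>(k, w)\<leftarrow>ws. w * chebyshev_psi (N div k))"
proof -
  have 1: "(\<Sum>(d, c)\<leftarrow>cs. c * ln (fact (N div d)))
      = (\<Sum>j\<le>N. mangoldt j * (\<Sum>(d, c)\<leftarrow>cs. c * real (N div j div d)))"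
    using assms(2)
    by (induction cs) (auto simp: ln_fact_div sum_distrib_left sum.distrib algebra_simps)
  have 2: "(\<Sum>(k, w)\<leftarrow>ws. w * chebyshev_psi (N div k))
      = (\<Sum>j\<le>N. mangoldt j * (\<Sum>(k, w)\<leftarrow>ws. w * of_bool (k \<le> N div j)))"
    using assms(3)
    by (induction ws) (auto simp: chebyshev_psi_div sum_distrib_left sum.distrib algebra_simps
        simp del: sum_mult_of_bool_eq sum_of_bool_mult_eq)
  have "s * chebyshev_psi N = (\<Sum>j\<le>N. mangoldt j * s)"
    unfolding chebyshev_psi_def by (simp add: sum_distrib_left mult.commute)
  also have "\<dots> \<le> (\<Sum>j\<le>N. mangoldt j * ((\<Sum>(d, c)\<leftarrow>cs. c * real (N div j div d))
      + (\<Sum>(k, w)\<leftarrow>ws. w * of_bool (k \<le> N div j))))"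
  proof (rule sum_mono)
    fix j assume "j \<in> {..N}"
    show "mangoldt j * s \<le> mangoldt j * ((\<Sum>(d, c)\<leftarrow>cs. c * real (N div j div d))
      + (\<Sum>(k, w)\<leftarrow>ws. w * of_bool (k \<le> N div j)))"
    proof (cases "j = 0")
      case False
      then have "N div j \<ge> 1" using \<open>j \<in> {..N}\<close> by (simp add: Suc_le_eq div_greater_zero_iff)
      then show ?thesis by (intro mult_left_mono assms(1)) (auto simp: mangoldt_nonneg)
    qed simp
  qed
  also have "\<dots> = (\<Sum>(d, c)\<leftarrow>cs. c * ln (fact (N div d))) + (\<Sum>(k, w)\<leftarrow>ws. w * chebyshev_psi (N div k))"
    unfolding 1 2 by (simp only: distrib_left sum.distrib)
  finally show ?thesis .
qed

section \<open>Explicit Stirling bounds\<close>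

text \<open>The induction step amounts to
  \<open>(M + 1/2) * (ln (M + 1) - ln M) \<ge> 1\<close>.\<close>

lemma ln_fact_upper:
  assumes "M \<ge> 1" shows "ln (fact M) \<le> (M + 1/2) * ln M - M + 1"
  using assms
proof (induction M rule: nat_induct_at_least)
  case (Suc M)
  have "2 * (real (Suc M) - real M) / (real M + real (Suc M)) \<le> ln (real (Suc M)) - ln (real M)"
    using Suc.hyps by (intro ln_inverse_approx_ge) auto
  then have "2 \<le> (2 * real M + 1) * (ln (real (Suc M)) - ln (real M))"
    by (simp add: field_simps)
  moreover have "ln (fact (Suc M)) = ln (real (Suc M)) + ln (fact M)"
    unfolding fact_Suc of_nat_mult of_nat_fact by (subst ln_mult) auto
  ultimately show ?case using Suc.IH Suc.hyps by (simp add: algebra_simps del: fact_Suc)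
qed simp

lemma ln_fact_lower: "(real M + 1/2) * ln (real M + 1) - real M - 1/4 \<le> ln (fact M)"
proof -
  \<comment> \<open>The constant \<open>1/4\<close> is refined to a telescoping error: the
    trapezoidal estimate of the logarithm loses \<open>1/4 * (1 / x - 1 / (x + 1))\<close> per
    step.\<close>
  have *: "(real M + 1/2) * ln (real M + 1) - real M - 1/4 * (1 - 1 / (real M + 1)) \<le> ln (fact M)"
  proof (induction M)
    case (Suc M)
    define x where "x = real M + 1"
    have x: "x \<ge> 1" by (simp add: x_def)
    have "ln (x + 1) - ln x \<le> (inverse x + inverse (x + 1)) / 2"
      using ln_inverse_approx_le[of x 1] x by simp
    then have "(x + 1/2) * (ln (x + 1) - ln x) \<le> (x + 1/2) * ((inverse x + inverse (x + 1)) / 2)"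
      using x by (intro mult_left_mono) auto
    also have "\<dots> = 1 + (1/4) * (1 / x - 1 / (x + 1))"
    proof -
      define p where "p = x * (x + 1)"
      have p: "p > 0" using x unfolding p_def by (intro mult_pos_pos) auto
      have inv: "inverse x + inverse (x + 1) = (2 * x + 1) / p" "1 / x - 1 / (x + 1) = 1 / p"
        using x by (auto simp: p_def field_simps)
      have "(x + 1/2) * (2 * x + 1) / 2 = p + 1/4" by (simp add: p_def algebra_simps)
      then have "(x + 1/2) * ((2 * x + 1) / p / 2) = (p + 1/4) / p"
        by (metis times_divide_eq_right divide_divide_eq_left mult.commute)
      also have "\<dots> = 1 + 1/4 * (1 / p)" using p by (simp add: field_simps)
      finally show ?thesis unfolding inv .
    qed
    finally have "(x + 1/2) * ln (x + 1) \<le> (x + 1/2) * ln x + 1 + (1/4) * (1 / x - 1 / (x + 1))"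
      by (simp add: algebra_simps)
    moreover have "(x - 1/2) * ln x - (x - 1) - 1/4 * (1 - 1 / x) \<le> ln (fact M)"
      using Suc.IH by (simp add: x_def algebra_simps)
    moreover have "ln (fact (Suc M)) = ln x + ln (fact M)"
      by (simp add: x_def ln_mult add.commute)
    ultimately have "(x + 1/2) * ln (x + 1) - x - 1/4 * (1 - 1 / (x + 1)) \<le> ln (fact (Suc M))"
      by (simp add: algebra_simps diff_divide_distrib del: fact_Suc)
    then show ?case by (simp add: x_def algebra_simps del: fact_Suc)
  qed simp
  have "1 / (real M + 1) \<ge> 0" by simp
  then have "1/4 * (1 - 1 / (real M + 1)) \<le> 1/4" by simp
  then show ?thesis using * by linarith
qed

lemma x_ln_x_minus_x_mono:
  fixes x y :: real
  assumes "1 \<le> x" "x \<le> y"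
  shows "x * ln x - x \<le> y * ln y - y"
proof -
  have "1 - x / y \<le> ln (y / x)"
    using ln_le_minus_one[of "x / y"] assms by (simp add: ln_div)
  then have "y * (1 - x / y) \<le> y * (ln y - ln x)"
    using assms by (intro mult_left_mono) (auto simp: ln_div)
  moreover have "(y - x) * ln x \<ge> 0" using assms by simp
  ultimately show ?thesis using assms by (simp add: algebra_simps)
qed

text \<open>Stirling is applied at the integer part \<open>M\<close> of \<open>x\<close>; since
  \<open>x * ln x - x\<close> is increasing from 1 on, the main term can be moved from
  \<open>M\<close> up to \<open>x\<close>, and from \<open>x\<close> up to
  \<open>M + 1\<close>.\<close>

lemma ln_fact_div_approx:
  assumes "d > 0" "d \<le> N"
  defines "x \<equiv> real N / real d"
  shows "\<bar>ln (fact (N div d)) - (x * ln x - x)\<bar> \<le> ln x / 2 + 1"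
proof -
  define M where "M = N div d"
  have M: "M \<ge> 1" using assms by (simp add: M_def Suc_le_eq div_greater_zero_iff)
  have xM: "real M \<le> x" unfolding x_def M_def by (rule of_nat_div_le_of_nat)
  have "N < d * (M + 1)" using assms(1) div_mult_mod_eq[of N d] mod_less_divisor[of d N] unfolding M_def
    by (metis add_less_cancel_left distrib_left mult.commute mult.right_neutral)
  then have "real N < real d * (real M + 1)" by (metis of_nat_1 of_nat_add of_nat_less_iff of_nat_mult)
  then have xM': "x \<le> real M + 1" using assms(1) by (simp add: x_def field_simps)
  have x1: "x \<ge> 1" using xM M by simp
  have "ln (fact M) \<le> (M + 1/2) * ln M - M + 1" using M by (rule ln_fact_upper)
  also have "\<dots> \<le> (x * ln x - x) + ln x / 2 + 1"
  proof -
    have "ln (real M) \<le> ln x" using M xM by simp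
    then show ?thesis using x_ln_x_minus_x_mono[of "real M" x] M xM
      by (simp add: algebra_simps del: ln_le_cancel_iff)
  qed
  finally have up: "ln (fact M) \<le> (x * ln x - x) + ln x / 2 + 1" .
  have "(x * ln x - x) - ln x / 2 \<le> (real M + 1/2) * ln (real M + 1) - real M - 1/4 + 1"
  proof -
    have "x * ln x - x \<le> (real M + 1) * ln (real M + 1) - (real M + 1)"
      using x1 xM' by (rule x_ln_x_minus_x_mono)
    also have "\<dots> = (real M + 1/2) * ln (real M + 1) - real M - 1 + ln (real M + 1) / 2"
      by (simp add: algebra_simps)
    finally have "x * ln x - x \<le> (real M + 1/2) * ln (real M + 1) - real M - 1 + ln (real M + 1) / 2" .
    moreover have "ln (real M + 1) - ln x \<le> 1"
    proof -
      have "ln (real M + 1) - ln x = ln ((real M + 1) / x)" using x1 M by (simp add: ln_div)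
      also have "\<dots> \<le> (real M + 1) / x - 1" using x1 by (intro ln_le_minus_one) auto
      also have "\<dots> \<le> 1" using xM M x1 by (simp add: field_simps)
      finally show ?thesis .
    qed
    ultimately show ?thesis by linarith
  qed
  then have "(x * ln x - x) - ln x / 2 - 1 \<le> ln (fact M)" using ln_fact_lower[of M] by linarith
  then show ?thesis using up unfolding M_def by (simp add: abs_le_iff)
qed

text \<open>When the numbers \<open>c / d\<close> sum to zero, the terms of order
  \<open>N * ln N\<close> cancel and only a linear main term remains.\<close>

lemma combination_le:
  fixes cs :: "(nat \<times> real) list"
  assumes "\<forall>(d, c)\<in>set cs. 0 < d \<and> d \<le> N" "(\<Sum>(d, c)\<leftarrow>cs. c / real d) = 0" "N > 0"
  shows "(\<Sum>(d, c)\<leftarrow>cs. c * ln (fact (N div d)))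
    \<le> - real N * (\<Sum>(d, c)\<leftarrow>cs. c / real d * ln d) + (\<Sum>(d, c)\<leftarrow>cs. \<bar>c\<bar> * ((ln N - ln d) / 2 + 1))"
proof -
  have 1: "(\<Sum>(d, c)\<leftarrow>cs. c * ln (fact (N div d)))
    \<le> real N * (ln N - 1) * (\<Sum>(d, c)\<leftarrow>cs. c / real d) - real N * (\<Sum>(d, c)\<leftarrow>cs. c / real d * ln d)
      + (\<Sum>(d, c)\<leftarrow>cs. \<bar>c\<bar> * ((ln N - ln d) / 2 + 1))"
    using assms(1)
  proof (induction cs)
    case (Cons a cs)
    obtain d c where a: "a = (d, c)" by (cases a)
    have d: "d > 0" "d \<le> N" using Cons.prems a by auto
    define x where "x = real N / real d"
    have lnx: "ln x = ln N - ln d" unfolding x_def using d assms(3) by (simp add: ln_div)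
    have "c * (ln (fact (N div d)) - (x * ln x - x)) \<le> \<bar>c\<bar> * \<bar>ln (fact (N div d)) - (x * ln x - x)\<bar>"
      by (metis abs_ge_self abs_mult)
    also have "\<dots> \<le> \<bar>c\<bar> * (ln x / 2 + 1)"
      using ln_fact_div_approx[OF d, folded x_def] by (intro mult_left_mono) auto
    finally have "c * ln (fact (N div d)) \<le> c * (x * ln x - x) + \<bar>c\<bar> * (ln x / 2 + 1)"
      by (simp add: algebra_simps)
    also have "c * (x * ln x - x) = real N * (ln N - 1) * (c / real d) - real N * (c / real d * ln d)"
      unfolding lnx using d by (simp add: x_def algebra_simps add_divide_distrib diff_divide_distrib)
    finally show ?case using Cons unfolding a lnx by (simp add: algebra_simps)
  qed simp
  show ?thesis using 1 unfolding assms(2) by simp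
qed

text \<open>A certificate \<open>cs, ws\<close> (in units of \<open>1 / 100\<close>) stands for the function
  \<open>A y + \<Sum> c \<lfloor>y / d\<rfloor> + \<Sum> w [k \<le> y]\<close>, \<open>(d, c) \<in> cs\<close>, \<open>(k, w) \<in> ws\<close>, where \<open>A = - \<Sum> c / d\<close>. It is to be
  bounded below by \<open>b / 1000000\<close> for all integers \<open>y \<ge> 1\<close>, which is checked block by block from the increments;
  \<open>a\<close> is a lower bound for \<open>1000000 A\<close>.\<close>

type_synonym certificate = "(int \<times> int) list"

fun add_periodic :: "certificate \<Rightarrow> int \<Rightarrow> int list \<Rightarrow> int list" where
  "add_periodic [] y xs = xs"
| "add_periodic ((d, c) # cs) y xs =
     add_periodic cs y (map_every (\<lambda>x. x + c) (nat (d - 1)) (nat ((- y) mod d)) xs)"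

fun add_points :: "certificate \<Rightarrow> int \<Rightarrow> int \<Rightarrow> int list \<Rightarrow> int list" where
  "add_points [] y len xs = xs"
| "add_points ((k, w) # ws) y len xs =
     add_points ws y len
       (if y \<le> k \<and> k < y + len then xs[nat (k - y) := xs ! nat (k - y) + w] else xs)"

text \<open>The factor 10000 converts increments in hundredths into millionths, the unit of
  \<open>a\<close>, \<open>b\<close> and \<open>S\<close>.\<close>

fun prefix_sums_ge :: "int \<Rightarrow> int \<Rightarrow> int \<Rightarrow> int list \<Rightarrow> int option" where
  "prefix_sums_ge a b S [] = Some S"
| "prefix_sums_ge a b S (x # xs) =
     (let S' = S + a + 10000 * x in if b \<le> S' then prefix_sums_ge a b S' xs else None)"

fun certify :: "certificate \<Rightarrow> certificate \<Rightarrow> int \<Rightarrow> int \<Rightarrow> nat \<Rightarrow> int \<Rightarrow> nat \<Rightarrow> int \<Rightarrow> int \<Rightarrow> bool" where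
  "certify cs ws a b h len 0 y S = True"
| "certify cs ws a b h len (Suc n) y S =
     (case prefix_sums_ge a b S (add_points ws y len (add_periodic cs y (replicate h 0))) of
        None \<Rightarrow> False
      | Some S' \<Rightarrow> certify cs ws a b h len n (y + len) S')"

definition cert_sum :: "certificate \<Rightarrow> certificate \<Rightarrow> int \<Rightarrow> int" where
  "cert_sum cs ws y = (\<Sum>(d, c)\<leftarrow>cs. c * (y div d)) + (\<Sum>(k, w)\<leftarrow>ws. w * of_bool (k \<le> y))"

section \<open>Soundness of the certificate check\<close>

lemma length_add_periodic [simp]: "length (add_periodic cs y xs) = length xs"
  by (induction cs y xs rule: add_periodic.induct) auto

lemma length_add_points [simp]: "length (add_points ws y len xs) = length xs"
  by (induction ws y len xs rule: add_points.induct) auto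

lemma nth_add_periodic:
  assumes "\<forall>(d, c)\<in>set cs. d > 0" "i < length xs"
  shows "add_periodic cs y xs ! i = xs ! i + (\<Sum>(d, c)\<leftarrow>cs. c * of_bool (d dvd y + int i))"
  using assms
proof (induction cs y xs rule: add_periodic.induct)
  case (2 d c cs y xs)
  have d: "d > 0" using 2 by auto
  define m where "m = nat ((- y) mod d)"
  have m: "int m = (- y) mod d" "int m < d" using d by (auto simp: m_def)
  have "Suc (nat (d - 1)) dvd i + (Suc (nat (d - 1)) - m) \<longleftrightarrow> d dvd int i + (d - int m)"
  proof -
    have "Suc (nat (d - 1)) dvd i + (Suc (nat (d - 1)) - m)
        \<longleftrightarrow> int (Suc (nat (d - 1))) dvd int (i + (Suc (nat (d - 1)) - m))"
      by (simp only: int_dvd_int_iff)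
    also have "int (Suc (nat (d - 1))) = d" using d by simp
    also have "int (i + (Suc (nat (d - 1)) - m)) = int i + (d - int m)"
      using d m(2) by (simp add: of_nat_diff)
    finally show ?thesis .
  qed
  also have "\<dots> \<longleftrightarrow> d dvd y + int i"
  proof -
    have "d dvd (- y) - int m" unfolding m(1) by (rule dvd_minus_mod)
    then have "d dvd (y + int m) - d" by (metis dvd_diff dvd_minus_iff dvd_refl minus_diff_eq diff_minus_eq_add add.commute uminus_add_conv_diff)
    moreover have "y + int i = (int i + (d - int m)) + ((y + int m) - d)" by simp
    ultimately show ?thesis by (metis dvd_add_left_iff)
  qed
  finally have "map_every (\<lambda>x. x + c) (nat (d - 1)) m xs ! i = xs ! i + c * of_bool (d dvd y + int i)"
    using nth_map_every[of m "nat (d - 1)" i xs "\<lambda>x. x + c"] m 2(3) by auto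
  then show ?case using 2 by (simp add: m_def)
qed simp

lemma nth_add_points:
  assumes "i < length xs" "len = int (length xs)"
  shows "add_points ws y len xs ! i = xs ! i + (\<Sum>(k, w)\<leftarrow>ws. w * of_bool (k = y + int i))"
  using assms
proof (induction ws y len xs rule: add_points.induct)
  case (2 k w ws y len xs)
  define xs' where "xs' = (if y \<le> k \<and> k < y + len then xs[nat (k - y) := xs ! nat (k - y) + w] else xs)"
  have "xs' ! i = xs ! i + w * of_bool (k = y + int i)"
    using 2(2,3) unfolding xs'_def by (auto simp: nth_list_update)
  moreover have "length xs' = length xs" by (simp add: xs'_def)
  ultimately show ?case using 2 unfolding add_points.simps xs'_def[symmetric] by simp
qed simp

lemma cert_sum_step:
  assumes "\<forall>(d, c)\<in>set cs. d > 0"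
  shows "cert_sum cs ws y - cert_sum cs ws (y - 1)
    = (\<Sum>(d, c)\<leftarrow>cs. c * of_bool (d dvd y)) + (\<Sum>(k, w)\<leftarrow>ws. w * of_bool (k = y))"
proof -
  have div: "y div d = (y - 1) div d + of_bool (d dvd y)" if "d > 0" for d
  proof (cases "d dvd y")
    case True
    then obtain q where "y = d * q" by auto
    moreover have "(d * q - 1) div d = q - 1"
      using that by (intro int_div_pos_eq[of _ _ _ "d - 1"]) (auto simp: algebra_simps)
    ultimately show ?thesis using that by simp
  next
    case False
    then have "y mod d \<noteq> 0" by (simp add: dvd_eq_mod_eq_0)
    then have "0 < y mod d" "y mod d < d"
      using that pos_mod_bound[of d y] pos_mod_sign[of d y] by linarith+
    moreover have "y = d * (y div d) + y mod d" by simp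
    ultimately have "(y - 1) div d = y div d"
      by (intro int_div_pos_eq[of _ _ _ "y mod d - 1"]) auto
    then show ?thesis using False by simp
  qed
  have 1: "(\<Sum>(d, c)\<leftarrow>cs. c * (y div d)) - (\<Sum>(d, c)\<leftarrow>cs. c * ((y - 1) div d))
      = (\<Sum>(d, c)\<leftarrow>cs. c * of_bool (d dvd y))"
    using assms by (induction cs) (auto simp: div algebra_simps)
  have 2: "(\<Sum>(k, w)\<leftarrow>ws. w * of_bool (k \<le> y)) - (\<Sum>(k, w)\<leftarrow>ws. w * of_bool (k \<le> y - 1))
      = (\<Sum>(k, w)\<leftarrow>ws. w * of_bool (k = y))"
    by (induction ws) (auto simp: algebra_simps)
  show ?thesis using 1 2 unfolding cert_sum_def by simp
qed

lemma prefix_sums_ge: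
  assumes "prefix_sums_ge a b S xs = Some S'"
    and "\<And>i. i < length xs \<Longrightarrow> xs ! i = cert_sum cs ws (y + int i) - cert_sum cs ws (y + int i - 1)"
    and "S = a * (y - 1) + 10000 * cert_sum cs ws (y - 1)"
  shows "S' = a * (y + int (length xs) - 1) + 10000 * cert_sum cs ws (y + int (length xs) - 1)"
    and "\<And>z. y \<le> z \<Longrightarrow> z < y + int (length xs) \<Longrightarrow> b \<le> a * z + 10000 * cert_sum cs ws z"
proof -
  have "S' = a * (y + int (length xs) - 1) + 10000 * cert_sum cs ws (y + int (length xs) - 1) \<and>
    (\<forall>z. y \<le> z \<and> z < y + int (length xs) \<longrightarrow> b \<le> a * z + 10000 * cert_sum cs ws z)"
    using assms
  proof (induction a b S xs arbitrary: y rule: prefix_sums_ge.induct)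
    case (2 a b S x xs)
    define S1 where "S1 = S + a + 10000 * x"
    have b: "b \<le> S1" and run: "prefix_sums_ge a b S1 xs = Some S'"
      using 2(2) by (auto simp: S1_def Let_def split: if_splits)
    have "x = cert_sum cs ws y - cert_sum cs ws (y - 1)" using 2(3)[of 0] by simp
    then have S1: "S1 = a * y + 10000 * cert_sum cs ws y" unfolding S1_def 2(4) by (simp add: algebra_simps)
    have "xs ! i = cert_sum cs ws (y + 1 + int i) - cert_sum cs ws (y + 1 + int i - 1)" if "i < length xs" for i
      using 2(3)[of "Suc i"] that by (simp add: ac_simps)
    then have IH: "S' = a * (y + 1 + int (length xs) - 1) + 10000 * cert_sum cs ws (y + 1 + int (length xs) - 1)"
      "\<And>z. y + 1 \<le> z \<Longrightarrow> z < y + 1 + int (length xs) \<Longrightarrow> b \<le> a * z + 10000 * cert_sum cs ws z"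
      using 2(1)[OF S1_def b run, of "y + 1"] S1 by auto
    show ?case
    proof (intro conjI allI impI)
      fix z assume z: "y \<le> z \<and> z < y + int (length (x # xs))"
      show "b \<le> a * z + 10000 * cert_sum cs ws z"
        using IH(2)[of z] z b S1 by (cases "z = y") auto
    qed (use IH(1) in \<open>simp add: algebra_simps\<close>)
  qed auto
  then show "S' = a * (y + int (length xs) - 1) + 10000 * cert_sum cs ws (y + int (length xs) - 1)"
    "\<And>z. y \<le> z \<Longrightarrow> z < y + int (length xs) \<Longrightarrow> b \<le> a * z + 10000 * cert_sum cs ws z" by blast+
qed

lemma certify:
  assumes "certify cs ws a b h (int h) n y S"
    and cs: "\<forall>(d, c)\<in>set cs. d > 0"
    and "S = a * (y - 1) + 10000 * cert_sum cs ws (y - 1)"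
    and "y \<le> z" "z < y + int h * int n"
  shows "b \<le> a * z + 10000 * cert_sum cs ws z"
  using assms(1,3-)
proof (induction n arbitrary: y S)
  case (Suc n)
  define xs where "xs = add_points ws y (int h) (add_periodic cs y (replicate h 0))"
  have len: "length xs = h" by (simp add: xs_def)
  obtain S' where S': "prefix_sums_ge a b S xs = Some S'" "certify cs ws a b h (int h) n (y + int h) S'"
    using Suc.prems(1) unfolding xs_def by (auto split: option.splits)
  have "xs ! i = cert_sum cs ws (y + int i) - cert_sum cs ws (y + int i - 1)" if "i < length xs" for i
    unfolding xs_def cert_sum_step[OF cs] using that len
    by (subst nth_add_points) (auto simp: nth_add_periodic[OF cs])
  note ps = prefix_sums_ge[OF S'(1) this Suc.prems(2), unfolded len]
  show ?case
  proof (cases "z < y + int h")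
    case True
    then show ?thesis using ps(2) Suc.prems(3) by simp
  next
    case False
    then show ?thesis using Suc.prems(4) ps(1)
      by (intro Suc.IH[OF S'(2)]) (auto simp: algebra_simps)
  qed
qed simp

lemma frac_div_le:
  assumes "d > 0" shows "real y / real d - real (y div d) \<le> 1 - 1 / real d"
proof -
  have "y = d * (y div d) + y mod d" by simp
  then have "real y = real d * real (y div d) + real (y mod d)" by (metis of_nat_add of_nat_mult)
  moreover have "real (y mod d) \<le> real d - 1" using mod_less_divisor[of d y] assms by linarith
  ultimately show ?thesis using assms by (simp add: field_simps)
qed

definition scale_cert :: "certificate \<Rightarrow> (nat \<times> real) list" where
  "scale_cert = map (\<lambda>(d, c). (nat d, real_of_int c / 100))"

definition lead_coeff_cert :: "certificate \<Rightarrow> real" where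
  "lead_coeff_cert cs = - (\<Sum>(d, c)\<leftarrow>scale_cert cs. c / real d)"

text \<open>Together with \<open>lead_coeff_cert cs\<close> at \<open>d = 1\<close>, the first sum
  is minus the sum of \<open>c\<close> times the fractional part of \<open>y / d\<close>. Inside the
  checked range the computation applies. Beyond it all weights in \<open>ws\<close> are active, and
  a fractional part is at most \<open>1 - 1 / d\<close>, so only positive \<open>c\<close> can cost
  anything.\<close>

lemma certificate_valid:
  assumes cert: "certify cs ws a b h (int h) n 1 0"
    and cs: "\<forall>(d, c)\<in>set cs. d > 0" and ws: "\<forall>(k, w)\<in>set ws. 0 < k \<and> k \<le> int h * int n"
    and a: "real_of_int a \<le> 1000000 * lead_coeff_cert cs"
    and tail: "b / 1000000 \<le> (\<Sum>(k, w)\<leftarrow>scale_cert ws. w) - (\<Sum>(d, c)\<leftarrow>scale_cert cs. max 0 c * (1 - 1 / real d))"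
    and y: "y \<ge> (1::nat)"
  shows "b / 1000000 \<le> (\<Sum>(d, c)\<leftarrow>(1, lead_coeff_cert cs) # scale_cert cs. c * real (y div d))
    + (\<Sum>(k, w)\<leftarrow>scale_cert ws. w * of_bool (k \<le> y))"
proof (cases "int y < 1 + int h * int n")
  case True
  have "cert_sum cs ws 0 = 0"
  proof -
    have "(\<Sum>(d, c)\<leftarrow>cs. c * (0 div d)) = 0" by (induction cs) auto
    moreover have "(\<Sum>(k, w)\<leftarrow>ws. w * of_bool (k \<le> 0)) = 0" using ws by (induction ws) auto
    ultimately show ?thesis by (simp add: cert_sum_def)
  qed
  then have "b \<le> a * int y + 10000 * cert_sum cs ws (int y)"
    using y True by (intro certify[OF cert cs]) auto
  then have "real_of_int b \<le> real_of_int (a * int y + 10000 * cert_sum cs ws (int y))"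
    by (simp only: of_int_le_iff)
  also have "\<dots> = a * real y + 10000 * real_of_int (cert_sum cs ws (int y))" by simp
  also have "\<dots> \<le> 1000000 * lead_coeff_cert cs * real y + 10000 * real_of_int (cert_sum cs ws (int y))"
    using a by (intro add_right_mono mult_right_mono) auto
  also have "real_of_int (cert_sum cs ws (int y))
      = 100 * ((\<Sum>(d, c)\<leftarrow>scale_cert cs. c * real (y div d)) + (\<Sum>(k, w)\<leftarrow>scale_cert ws. w * of_bool (k \<le> y)))"
  proof -
    have "real_of_int (\<Sum>(d, c)\<leftarrow>cs. c * (int y div d)) = 100 * (\<Sum>(d, c)\<leftarrow>scale_cert cs. c * real (y div d))"
      using cs
    proof (induction cs)
      case (Cons p cs)
      obtain d c where p: "p = (d, c)" by (cases p)
      have "int y div d = int (y div nat d)" using Cons.prems p by (simp add: zdiv_int)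
      then have "real_of_int (int y div d) = real (y div nat d)" by simp
      then show ?case using Cons p by (simp add: scale_cert_def algebra_simps)
    qed (simp add: scale_cert_def)
    moreover have "real_of_int (\<Sum>(k, w)\<leftarrow>ws. w * of_bool (k \<le> int y))
        = 100 * (\<Sum>(k, w)\<leftarrow>scale_cert ws. w * of_bool (k \<le> y))"
      using ws by (induction ws) (auto simp: scale_cert_def nat_le_iff algebra_simps)
    ultimately show ?thesis by (simp add: cert_sum_def algebra_simps)
  qed
  finally show ?thesis by (simp add: field_simps)
next
  case False
  have W: "(\<Sum>(k, w)\<leftarrow>scale_cert ws. w * of_bool (k \<le> y)) = (\<Sum>(k, w)\<leftarrow>scale_cert ws. w)"
    using ws False by (induction ws) (auto simp: scale_cert_def nat_le_iff)
  have "lead_coeff_cert cs * real y + (\<Sum>(d, c)\<leftarrow>scale_cert cs. c * real (y div d))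
      \<ge> - (\<Sum>(d, c)\<leftarrow>scale_cert cs. max 0 c * (1 - 1 / real d))"
    using cs unfolding lead_coeff_cert_def
  proof (induction cs)
    case (Cons p cs)
    obtain d c where p: "p = (d, c)" by (cases p)
    define d' c' where "d' = nat d" and "c' = real_of_int c / 100"
    have d': "d' > 0" using Cons.prems p by (simp add: d'_def)
    have fr: "0 \<le> real y / real d' - real (y div d')" using of_nat_div_le_of_nat[of y d'] by simp
    have "c' * (real y / real d' - real (y div d')) \<le> max 0 c' * (real y / real d' - real (y div d'))"
      using fr by (intro mult_right_mono) auto
    also have "\<dots> \<le> max 0 c' * (1 - 1 / real d')"
      using frac_div_le[OF d', of y] by (intro mult_left_mono) auto
    finally show ?case using Cons p
      by (simp add: scale_cert_def d'_def[symmetric] c'_def[symmetric] algebra_simps)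
  qed (simp add: scale_cert_def)
  then show ?thesis using tail W by simp
qed

text \<open>Positive \<open>b\<close> yields an upper bound for psi at \<open>N\<close>, negative
  \<open>b\<close> a lower bound. Since every \<open>k\<close> exceeds 1, the induction hypothesis
  covers \<open>N div k\<close>: nonnegative weights use its upper line, negative weights its lower
  line.\<close>

lemma combination_bound:
  assumes cert: "certify cs ws a b h (int h) n 1 0"
    and cs: "\<forall>(d, c)\<in>set cs. 0 < d \<and> d \<le> 65536" and ws: "\<forall>(k, w)\<in>set ws. 1 < k \<and> k \<le> int h * int n"
    and a: "real_of_int a \<le> 1000000 * lead_coeff_cert cs"
    and tail: "b / 1000000 \<le> (\<Sum>(k, w)\<leftarrow>scale_cert ws. w) - (\<Sum>(d, c)\<leftarrow>scale_cert cs. max 0 c * (1 - 1 / real d))"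
    and N: "N \<ge> 65536" and IH: "\<And>m. m < N \<Longrightarrow> psi_bounds m"
  shows "b / 1000000 * chebyshev_psi N \<le>
      - real N * (\<Sum>(d, c)\<leftarrow>scale_cert cs. c / real d * ln d)
      + (\<bar>lead_coeff_cert cs\<bar> + (\<Sum>(d, c)\<leftarrow>scale_cert cs. \<bar>c\<bar>)) * (ln N / 2 + 1)
      - (\<Sum>(d, c)\<leftarrow>scale_cert cs. \<bar>c\<bar> * ln d) / 2
      + real N * (\<Sum>(k, w)\<leftarrow>scale_cert ws. (if w \<ge> 0 then 10368 / 10000 else 96 / 100) * w / real k)
      + (\<Sum>(k, w)\<leftarrow>scale_cert ws. (if w \<ge> 0 then 3 else -7) * w)"
proof -
  define cs' where "cs' = (1::nat, lead_coeff_cert cs) # scale_cert cs"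
  have pos: "\<forall>(d, c)\<in>set cs. d > 0" "\<forall>(k, w)\<in>set ws. 0 < k \<and> k \<le> int h * int n"
    using cs ws by auto
  have cs': "\<forall>(d, c)\<in>set cs'. 0 < d \<and> d \<le> N" "\<forall>(d, c)\<in>set cs'. 0 < d"
    using cs N by (auto simp: cs'_def scale_cert_def)
  have ws': "\<forall>(k, w)\<in>set (scale_cert ws). 1 < k" "\<forall>(k, w)\<in>set (scale_cert ws). 0 < k"
    using ws by (auto simp: scale_cert_def)
  have "b / 1000000 * chebyshev_psi N \<le> (\<Sum>(d, c)\<leftarrow>cs'. c * ln (fact (N div d)))
      + (\<Sum>(k, w)\<leftarrow>scale_cert ws. w * chebyshev_psi (N div k))"
    using certificate_valid[OF cert pos a tail] unfolding cs'_def[symmetric]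
    by (intro chebyshev_psi_le_combination cs' ws')
  also have "(\<Sum>(d, c)\<leftarrow>cs'. c * ln (fact (N div d)))
      \<le> - real N * (\<Sum>(d, c)\<leftarrow>cs'. c / real d * ln d) + (\<Sum>(d, c)\<leftarrow>cs'. \<bar>c\<bar> * ((ln N - ln d) / 2 + 1))"
    using N by (intro combination_le cs') (auto simp: cs'_def lead_coeff_cert_def)
  also have "(\<Sum>(d, c)\<leftarrow>cs'. c / real d * ln d) = (\<Sum>(d, c)\<leftarrow>scale_cert cs. c / real d * ln d)"
    by (simp add: cs'_def)
  also have "(\<Sum>(d, c)\<leftarrow>cs'. \<bar>c\<bar> * ((ln N - ln d) / 2 + 1))
      = (\<bar>lead_coeff_cert cs\<bar> + (\<Sum>(d, c)\<leftarrow>scale_cert cs. \<bar>c\<bar>)) * (ln N / 2 + 1)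
        - (\<Sum>(d, c)\<leftarrow>scale_cert cs. \<bar>c\<bar> * ln d) / 2"
  proof -
    have "(\<Sum>(d, c)\<leftarrow>xs. \<bar>c\<bar> * ((ln N - ln (real d)) / 2 + 1))
        = (\<Sum>(d, c)\<leftarrow>xs. \<bar>c\<bar>) * (ln N / 2 + 1) - (\<Sum>(d, c)\<leftarrow>xs. \<bar>c\<bar> * ln (real d)) / 2"
      for xs :: "(nat \<times> real) list"
      by (induction xs) (auto simp: algebra_simps add_divide_distrib diff_divide_distrib)
    then show ?thesis by (simp add: cs'_def algebra_simps)
  qed
  also have "(\<Sum>(k, w)\<leftarrow>scale_cert ws. w * chebyshev_psi (N div k))
      \<le> real N * (\<Sum>(k, w)\<leftarrow>scale_cert ws. (if w \<ge> 0 then 10368 / 10000 else 96 / 100) * w / real k)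
        + (\<Sum>(k, w)\<leftarrow>scale_cert ws. (if w \<ge> 0 then 3 else -7) * w)"
  proof -
    have "(\<Sum>(k, w)\<leftarrow>xs. w * chebyshev_psi (N div k))
      \<le> real N * (\<Sum>(k, w)\<leftarrow>xs. (if w \<ge> 0 then 10368 / 10000 else 96 / 100) * w / real k)
        + (\<Sum>(k, w)\<leftarrow>xs. (if w \<ge> 0 then 3 else -7) * w)"
      if "\<forall>(k, w)\<in>set xs. 1 < k" for xs :: "(nat \<times> real) list"
      using that
    proof (induction xs)
      case (Cons p xs)
      obtain k w where p: "p = (k, w)" by (cases p)
      have k: "k > 1" using Cons.prems p by simp
      have "N div k < N" using k N by (intro div_less_dividend) auto
      then have b: "chebyshev_psi (N div k) \<le> 10368 / 10000 * real (N div k) + 3"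
        "96 / 100 * (real (N div k) + 1) - 7 \<le> chebyshev_psi (N div k)"
        using IH unfolding psi_bounds_def by blast+
      have "0 \<le> 1 / real k" by simp
      \<comment> \<open>Here the \<open>n + 1\<close> in \<open>psi_bounds\<close> absorbs the
        rounding of \<open>N / k\<close>.\<close>
      then have le: "real N / real k \<le> real (N div k) + 1" using frac_div_le[of k N] k by linarith
      have "96 / 100 * (real N / real k) \<le> 96 / 100 * (real (N div k) + 1)"
        using le by (intro mult_left_mono) auto
      moreover have "10368 / 10000 * real (N div k) \<le> 10368 / 10000 * (real N / real k)"
        by (intro mult_left_mono of_nat_div_le_of_nat) auto
      ultimately have b': "chebyshev_psi (N div k) \<le> 10368 / 10000 * (real N / real k) + 3"
        "96 / 100 * (real N / real k) - 7 \<le> chebyshev_psi (N div k)" using b by linarith+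
      have "w * chebyshev_psi (N div k) \<le> real N * ((if w \<ge> 0 then 10368 / 10000 else 96 / 100) * w / real k)
          + (if w \<ge> 0 then 3 else -7) * w"
      proof (cases "w \<ge> 0")
        case True
        then show ?thesis using mult_left_mono[OF b'(1) True] by (simp add: algebra_simps)
      next
        case False
        then show ?thesis using mult_left_mono_neg[OF b'(2), of w] by (simp add: algebra_simps)
      qed
      then show ?case using Cons p by (simp add: algebra_simps)
    qed simp
    then show ?thesis using ws'(1) by blast
  qed
  finally show ?thesis by linarith
qed

text \<open>The coefficients were found by linear programming. The large last weight sits at the end of the
  checked range; beyond it, it outweighs the worst case of the fractional parts.\<close>

definition cs_upper :: certificate where
  "cs_upper = [(2, -100), (3, -100), (5, -100), (6, 100), (7, -100), (10, 100), (11, -100), (13, -100),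
    (14, 100), (15, 90), (17, -69), (19, -98), (20, -2), (21, 83), (22, 92), (23, -100), (26, 100),
    (30, -125), (32, -8), (33, 8), (34, 69), (35, 3), (38, 34), (42, -115), (44, -13), (45, -40), (46, 71),
    (48, -25), (50, -6), (54, -2), (55, 2), (56, -16), (57, 64), (63, 32), (64, -31), (70, -3), (72, -26)]"

definition ws_upper :: certificate where
  "ws_upper = [(15, 10), (17, -31), (21, 17), (22, 8), (29, -65), (35, 97), (39, 64), (40, 2), (41, -68),
    (56, 16), (57, 34), (59, -39), (79, -97), (88, 21), (91, 75), (92, 29), (95, 98), (96, 33), (101, -100),
    (103, -76), (120, 30), (137, -1), (149, -6), (190, 24), (210, 46), (221, 18), (256, 1), (304, 29),
    (307, -75), (396, 6), (429, 47), (461, -6), (672, 47), (673, -12), (937, -5), (1729, 12), (1863, 1),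
    (2436, 11), (3000, 795)]"

lemma certify_upper: "certify cs_upper ws_upper 1000050 1000000 200 200 15 1 0"
  by code_simp

definition cs_lower :: certificate where
  "cs_lower = [(2, 100), (3, 100), (5, 100), (6, -100), (7, 100), (10, -100), (11, 73), (13, 100), (14, -100),
    (15, -100), (17, 45), (19, 55), (21, -45), (22, -18), (23, 45), (26, -64), (28, 45), (30, 145)]"

definition ws_lower :: certificate where
  "ws_lower = [(11, 27), (17, 55), (19, 45), (21, -55), (26, -36), (29, 55), (31, 55), (33, -73), (34, -45),
    (38, -55), (42, 45), (43, 100), (53, 19), (55, -73), (61, 55), (63, -55), (65, -45), (73, 100), (83, 35),
    (90, -45), (91, -73), (103, 55), (107, 9), (109, 100), (114, -55), (115, -45), (131, 46), (140, -18),
    (152, -10), (182, -9), (227, 1), (229, 45), (241, 1), (271, 35), (272, -9), (297, -27), (383, 36),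
    (385, -27), (503, 27), (593, 9), (594, -18), (663, -8), (715, -18), (1051, 18), (1283, 18), (1307, 46),
    (2000, 425)]"

lemma certify_lower: "certify cs_lower ws_lower (-999878) (-1000000) 200 200 10 1 0"
  by code_simp

section \<open>Numerical bounds and the induction for psi\<close>

lemma ln_composites:
  "ln (4::real) = ln 2 + ln 2" "ln (6::real) = ln 2 + ln 3" "ln (8::real) = ln 2 + ln 4"
  "ln (9::real) = ln 3 + ln 3" "ln (10::real) = ln 2 + ln 5" "ln (12::real) = ln 2 + ln 6"
  "ln (14::real) = ln 2 + ln 7" "ln (15::real) = ln 3 + ln 5" "ln (16::real) = ln 2 + ln 8"
  "ln (18::real) = ln 2 + ln 9" "ln (20::real) = ln 2 + ln 10" "ln (21::real) = ln 3 + ln 7"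
  "ln (22::real) = ln 2 + ln 11" "ln (24::real) = ln 2 + ln 12" "ln (25::real) = ln 5 + ln 5"
  "ln (26::real) = ln 2 + ln 13" "ln (27::real) = ln 3 + ln 9" "ln (28::real) = ln 2 + ln 14"
  "ln (30::real) = ln 2 + ln 15" "ln (32::real) = ln 2 + ln 16" "ln (33::real) = ln 3 + ln 11"
  "ln (34::real) = ln 2 + ln 17" "ln (35::real) = ln 5 + ln 7" "ln (36::real) = ln 2 + ln 18"
  "ln (38::real) = ln 2 + ln 19" "ln (42::real) = ln 2 + ln 21" "ln (44::real) = ln 2 + ln 22"
  "ln (45::real) = ln 3 + ln 15" "ln (46::real) = ln 2 + ln 23" "ln (48::real) = ln 2 + ln 24"
  "ln (49::real) = ln 7 + ln 7" "ln (50::real) = ln 2 + ln 25" "ln (54::real) = ln 2 + ln 27"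
  "ln (55::real) = ln 5 + ln 11" "ln (56::real) = ln 2 + ln 28" "ln (57::real) = ln 3 + ln 19"
  "ln (60::real) = ln 2 + ln 30" "ln (63::real) = ln 3 + ln 21" "ln (64::real) = ln 2 + ln 32"
  "ln (66::real) = ln 2 + ln 33" "ln (70::real) = ln 2 + ln 35" "ln (72::real) = ln 2 + ln 36"
  "ln (81::real) = ln 3 + ln 27" "ln (84::real) = ln 2 + ln 42" "ln (90::real) = ln 2 + ln 45"
  "ln (120::real) = ln 2 + ln 60" "ln (121::real) = ln 11 + ln 11" "ln (128::real) = ln 2 + ln 64"
  "ln (132::real) = ln 2 + ln 66" "ln (144::real) = ln 2 + ln 72" "ln (168::real) = ln 2 + ln 84"
  "ln (169::real) = ln 13 + ln 13" "ln (180::real) = ln 2 + ln 90" "ln (243::real) = ln 3 + ln 81"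
  "ln (256::real) = ln 2 + ln 128" "ln (264::real) = ln 2 + ln 132" "ln (288::real) = ln 2 + ln 144"
  "ln (289::real) = ln 17 + ln 17" "ln (360::real) = ln 2 + ln 180" "ln (361::real) = ln 19 + ln 19"
  "ln (528::real) = ln 2 + ln 264" "ln (529::real) = ln 23 + ln 23"
  by (simp_all flip: ln_mult_pos)

text \<open>Each logarithm comes from two close integers composed of that prime and smaller ones:
  \<open>3 ^ 5\<close> and \<open>2 ^ 8\<close> for 3, and otherwise a neighbouring pair such as 24
  and 25 or 120 and 121, whose larger member is the square of the prime.\<close>

lemma ln_prime_bounds:
  "1098604 / 1000000 \<le> ln (3::real)" "ln (3::real) \<le> 1098621 / 1000000"
  "1609417 / 1000000 \<le> ln (5::real)" "ln (5::real) \<le> 1609458 / 1000000"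
  "1945890 / 1000000 \<le> ln (7::real)" "ln (7::real) \<le> 1945931 / 1000000"
  "2397875 / 1000000 \<le> ln (11::real)" "ln (11::real) \<le> 2397916 / 1000000"
  "2564929 / 1000000 \<le> ln (13::real)" "ln (13::real) \<le> 2564970 / 1000000"
  "2833193 / 1000000 \<le> ln (17::real)" "ln (17::real) \<le> 2833234 / 1000000"
  "2944418 / 1000000 \<le> ln (19::real)" "ln (19::real) \<le> 2944459 / 1000000"
  "3135474 / 1000000 \<le> ln (23::real)" "ln (23::real) \<le> 3135515 / 1000000"
proof -
  show b3: "1098604 / 1000000 \<le> ln (3::real)" "ln (3::real) \<le> 1098621 / 1000000"
    using ln_inverse_approx_ge[of 243 256] ln_inverse_approx_le[of 243 13] ln_2_bounds
    by (simp_all add: ln_composites)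
  show b5: "1609417 / 1000000 \<le> ln (5::real)" "ln (5::real) \<le> 1609458 / 1000000"
    using ln_inverse_approx_ge[of 24 25] ln_inverse_approx_le[of 24 1] ln_2_bounds b3
    by (simp_all add: ln_composites)
  show b7: "1945890 / 1000000 \<le> ln (7::real)" "ln (7::real) \<le> 1945931 / 1000000"
    using ln_inverse_approx_ge[of 48 49] ln_inverse_approx_le[of 48 1] ln_2_bounds b3 b5
    by (simp_all add: ln_composites)
  show b11: "2397875 / 1000000 \<le> ln (11::real)" "ln (11::real) \<le> 2397916 / 1000000"
    using ln_inverse_approx_ge[of 120 121] ln_inverse_approx_le[of 120 1] ln_2_bounds b3 b5 b7
    by (simp_all add: ln_composites)
  show b13: "2564929 / 1000000 \<le> ln (13::real)" "ln (13::real) \<le> 2564970 / 1000000"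
    using ln_inverse_approx_ge[of 168 169] ln_inverse_approx_le[of 168 1] ln_2_bounds b3 b5 b7 b11
    by (simp_all add: ln_composites)
  show b17: "2833193 / 1000000 \<le> ln (17::real)" "ln (17::real) \<le> 2833234 / 1000000"
    using ln_inverse_approx_ge[of 288 289] ln_inverse_approx_le[of 288 1] ln_2_bounds b3 b5 b7 b11 b13
    by (simp_all add: ln_composites)
  show b19: "2944418 / 1000000 \<le> ln (19::real)" "ln (19::real) \<le> 2944459 / 1000000"
    using ln_inverse_approx_ge[of 360 361] ln_inverse_approx_le[of 360 1] ln_2_bounds b3 b5 b7 b11 b13 b17
    by (simp_all add: ln_composites)
  show b23: "3135474 / 1000000 \<le> ln (23::real)" "ln (23::real) \<le> 3135515 / 1000000"
    using ln_inverse_approx_ge[of 528 529] ln_inverse_approx_le[of 528 1] ln_2_bounds b3 b5 b7 b11 b13 b17 b19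
    by (simp_all add: ln_composites)
qed

text \<open>The tangent at \<open>2 ^ 16\<close> makes the final comparison linear in
  \<open>N\<close>.\<close>

lemma ln_le_tangent_65536: "N \<ge> 1 \<Longrightarrow> ln (real N) \<le> 16 * ln 2 + real N / 65536 - 1"
proof -
  assume N: "N \<ge> 1"
  have "ln (real N / 65536) \<le> real N / 65536 - 1" using N by (intro ln_le_minus_one) auto
  moreover have "ln (real N / 65536) = ln (real N) - ln (2 ^ 16)" using N by (subst ln_div) auto
  moreover have "ln ((2::real) ^ 16) = 16 * ln 2" by (subst ln_realpow) auto
  ultimately show ?thesis by simp
qed

lemma lead_coeff_upper: "1000050 \<le> 1000000 * lead_coeff_cert cs_upper" "\<bar>lead_coeff_cert cs_upper\<bar> \<le> 10001 / 10000"
  by (simp_all add: lead_coeff_cert_def scale_cert_def cs_upper_def)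

lemma lead_coeff_lower: "- 999878 \<le> 1000000 * lead_coeff_cert cs_lower" "\<bar>lead_coeff_cert cs_lower\<bar> \<le> 9999 / 10000"
  by (simp_all add: lead_coeff_cert_def scale_cert_def cs_lower_def)

lemma constants_upper:
  shows "- (\<Sum>(d, c)\<leftarrow>scale_cert cs_upper. c / real d * ln d) \<le> 100980 / 100000"
    and "(\<Sum>(d, c)\<leftarrow>scale_cert cs_upper. \<bar>c\<bar>) = 2227 / 100"
    and "62 \<le> (\<Sum>(d, c)\<leftarrow>scale_cert cs_upper. \<bar>c\<bar> * ln d)"
    and "(\<Sum>(k, w)\<leftarrow>scale_cert ws_upper. (if w \<ge> 0 then 10368 / 10000 else 96 / 100) * w / real k) \<le> 2316 / 100000"
    and "(\<Sum>(k, w)\<leftarrow>scale_cert ws_upper. (if w \<ge> 0 then 3 else -7) * w) = 878 / 10"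
proof -
  show "- (\<Sum>(d, c)\<leftarrow>scale_cert cs_upper. c / real d * ln d) \<le> 100980 / 100000"
    unfolding scale_cert_def cs_upper_def
    by (simp add: ln_composites add_divide_distrib diff_divide_distrib) (use ln_2_bounds ln_prime_bounds in linarith)
  show "62 \<le> (\<Sum>(d, c)\<leftarrow>scale_cert cs_upper. \<bar>c\<bar> * ln d)"
    unfolding scale_cert_def cs_upper_def
    by (simp add: ln_composites add_divide_distrib diff_divide_distrib) (use ln_2_bounds ln_prime_bounds in linarith)
qed (simp_all add: scale_cert_def cs_upper_def ws_upper_def)

lemma constants_lower:
  shows "- (\<Sum>(d, c)\<leftarrow>scale_cert cs_lower. c / real d * ln d) \<le> - 103990 / 100000"
    and "(\<Sum>(d, c)\<leftarrow>scale_cert cs_lower. \<bar>c\<bar>) = 1435 / 100"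
    and "33 \<le> (\<Sum>(d, c)\<leftarrow>scale_cert cs_lower. \<bar>c\<bar> * ln d)"
    and "(\<Sum>(k, w)\<leftarrow>scale_cert ws_lower. (if w \<ge> 0 then 10368 / 10000 else 96 / 100) * w / real k) \<le> 7630 / 100000"
    and "(\<Sum>(k, w)\<leftarrow>scale_cert ws_lower. (if w \<ge> 0 then 3 else -7) * w) = 9979 / 100"
proof -
  show "- (\<Sum>(d, c)\<leftarrow>scale_cert cs_lower. c / real d * ln d) \<le> - 103990 / 100000"
    unfolding scale_cert_def cs_lower_def
    by (simp add: ln_composites add_divide_distrib diff_divide_distrib) (use ln_2_bounds ln_prime_bounds in linarith)
  show "33 \<le> (\<Sum>(d, c)\<leftarrow>scale_cert cs_lower. \<bar>c\<bar> * ln d)"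
    unfolding scale_cert_def cs_lower_def
    by (simp add: ln_composites add_divide_distrib diff_divide_distrib) (use ln_2_bounds ln_prime_bounds in linarith)
qed (simp_all add: scale_cert_def cs_lower_def ws_lower_def)

text \<open>Both bounds go through one induction because the certificates have weights of both
  signs.\<close>

theorem psi_bounds: "psi_bounds N"
proof (induction N rule: less_induct)
  case (less N)
  show ?case
  proof (cases "N \<le> 65536")
    case True
    then show ?thesis by (rule small_psi_bounds)
  next
    case False
    then have N: "N \<ge> 65536" by simp
    define t where "t = ln (real N) / 2 + 1"
    have t: "0 \<le> t" "t \<le> 8 * ln 2 + real N / 131072 + 1 / 2"
      using ln_le_tangent_65536[of N] N by (simp_all add: t_def)
    have lnt: "t \<le> 604518 / 100000 + real N / 131072" using t(2) ln_2_bounds(2) by simp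
    have up: "1000000 / 1000000 * chebyshev_psi N \<le> real N * (100980 / 100000)
        + (10001 / 10000 + 2227 / 100) * t - 62 / 2 + real N * (2316 / 100000) + 878 / 10"
    proof -
      have "(\<bar>lead_coeff_cert cs_upper\<bar> + 2227 / 100) * t \<le> (10001 / 10000 + 2227 / 100) * t"
        using lead_coeff_upper(2) t by (intro mult_right_mono) auto
      moreover have "real N * - (\<Sum>(d, c)\<leftarrow>scale_cert cs_upper. c / real d * ln d) \<le> real N * (100980 / 100000)"
        "real N * (\<Sum>(k, w)\<leftarrow>scale_cert ws_upper. (if w \<ge> 0 then 10368 / 10000 else 96 / 100) * w / real k)
          \<le> real N * (2316 / 100000)"
        by (intro mult_left_mono constants_upper; simp)+
      moreover have "of_int 1000000 / 1000000 * chebyshev_psi N \<le>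
          - real N * (\<Sum>(d, c)\<leftarrow>scale_cert cs_upper. c / real d * ln d)
          + (\<bar>lead_coeff_cert cs_upper\<bar> + (\<Sum>(d, c)\<leftarrow>scale_cert cs_upper. \<bar>c\<bar>)) * (ln N / 2 + 1)
          - (\<Sum>(d, c)\<leftarrow>scale_cert cs_upper. \<bar>c\<bar> * ln d) / 2
          + real N * (\<Sum>(k, w)\<leftarrow>scale_cert ws_upper. (if w \<ge> 0 then 10368 / 10000 else 96 / 100) * w / real k)
          + (\<Sum>(k, w)\<leftarrow>scale_cert ws_upper. (if w \<ge> 0 then 3 else -7) * w)"
        using certify_upper less.IH N lead_coeff_upper(1)
        by (intro combination_bound[where h = 200 and n = 15 and a = 1000050])
          (simp_all add: scale_cert_def cs_upper_def ws_upper_def)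
      ultimately show ?thesis
        using constants_upper(3) unfolding constants_upper(2,5) t_def[symmetric] by simp
    qed
    have low: "- 1000000 / 1000000 * chebyshev_psi N \<le> real N * (- 103990 / 100000)
        + (9999 / 10000 + 1435 / 100) * t - 33 / 2 + real N * (7630 / 100000) + 9979 / 100"
    proof -
      have "(\<bar>lead_coeff_cert cs_lower\<bar> + 1435 / 100) * t \<le> (9999 / 10000 + 1435 / 100) * t"
        using lead_coeff_lower(2) t by (intro mult_right_mono) auto
      moreover have "real N * - (\<Sum>(d, c)\<leftarrow>scale_cert cs_lower. c / real d * ln d) \<le> real N * (- 103990 / 100000)"
        "real N * (\<Sum>(k, w)\<leftarrow>scale_cert ws_lower. (if w \<ge> 0 then 10368 / 10000 else 96 / 100) * w / real k)
          \<le> real N * (7630 / 100000)"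
        by (intro mult_left_mono constants_lower; simp)+
      moreover have "of_int (- 1000000) / 1000000 * chebyshev_psi N \<le>
          - real N * (\<Sum>(d, c)\<leftarrow>scale_cert cs_lower. c / real d * ln d)
          + (\<bar>lead_coeff_cert cs_lower\<bar> + (\<Sum>(d, c)\<leftarrow>scale_cert cs_lower. \<bar>c\<bar>)) * (ln N / 2 + 1)
          - (\<Sum>(d, c)\<leftarrow>scale_cert cs_lower. \<bar>c\<bar> * ln d) / 2
          + real N * (\<Sum>(k, w)\<leftarrow>scale_cert ws_lower. (if w \<ge> 0 then 10368 / 10000 else 96 / 100) * w / real k)
          + (\<Sum>(k, w)\<leftarrow>scale_cert ws_lower. (if w \<ge> 0 then 3 else -7) * w)"
        using certify_lower less.IH N lead_coeff_lower(1)
        by (intro combination_bound[where h = 200 and n = 10 and a = "- 999878"])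
          (simp_all add: scale_cert_def cs_lower_def ws_lower_def)
      ultimately show ?thesis
        using constants_lower(3) unfolding constants_lower(2,5) t_def[symmetric] by simp
    qed
    \<comment> \<open>The slopes are \<open>1.0098 + 0.02316 = 1.03296 < 1.0368\<close> and
      \<open>1.0399 - 0.0763 = 0.9636 > 0.96\<close>. From 65536 on, these gaps absorb the
      logarithmic and constant terms.\<close>
    have N': "real N \<ge> 65536" using N by simp
    have "chebyshev_psi N \<le> 10368 / 10000 * real N + 3" using up lnt N' by (simp add: field_simps)
    moreover have "96 / 100 * (real N + 1) - 7 \<le> chebyshev_psi N" using low lnt N' by (simp add: field_simps)
    ultimately show ?thesis by (simp add: psi_bounds_def)
  qed
qed

section \<open>Zero sums modulo \<open>q m\<close>\<close>

lemma exists_heavy_class: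
  fixes w :: "'x \<Rightarrow> real"
  assumes "finite K" "m > 0" "\<And>x. x \<in> K \<Longrightarrow> val x < m"
  shows "\<exists>c<m. (\<Sum>x\<in>K. w x) / real m \<le> (\<Sum>x\<in>{x\<in>K. val x = c}. w x)"
proof (rule ccontr)
  assume "\<not> ?thesis"
  then have "(\<Sum>c<m. (\<Sum>x\<in>{x\<in>K. val x = c}. w x)) < (\<Sum>c<m. (\<Sum>x\<in>K. w x) / real m)"
    using assms(2) by (intro sum_strict_mono) (auto simp: not_le)
  moreover have "(\<Sum>c<m. (\<Sum>x\<in>{x\<in>K. val x = c}. w x)) = (\<Sum>x\<in>K. w x)"
    using assms by (intro sum.group) auto
  ultimately show False using assms(2) by simp
qed

text \<open>Each step picks a residue class carrying at least the average share \<open>1 / m\<close>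
  of the weight. A hit multiplies a weight by \<open>t\<close>, so the total shrinks at least by the
  factor \<open>1 - (1 - t) / m\<close>.\<close>

lemma greedy_hits:
  fixes t :: real
  assumes "finite K" "m > 0" "0 < t" "t < 1" "\<And>i x. i < L \<Longrightarrow> x \<in> K \<Longrightarrow> val i x < m"
  shows "\<exists>a. (\<forall>i<L. a i < m) \<and>
    (\<Sum>x\<in>K. t ^ card {i. i < L \<and> val i x = a i}) \<le> real (card K) * (1 - (1 - t) / real m) ^ L"
  using assms(5)
proof (induction L)
  case (Suc L)
  obtain a where a: "\<forall>i<L. a i < m"
    "(\<Sum>x\<in>K. t ^ card {i. i < L \<and> val i x = a i}) \<le> real (card K) * (1 - (1 - t) / real m) ^ L"
    using Suc by auto
  define w where "w = (\<lambda>x. t ^ card {i. i < L \<and> val i x = a i})"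
  obtain c where c: "c < m" "(\<Sum>x\<in>K. w x) / real m \<le> (\<Sum>x\<in>{x\<in>K. val L x = c}. w x)"
    using exists_heavy_class[OF assms(1,2), of "val L" w] Suc.prems by auto
  define a' where "a' = a(L := c)"
  have split: "{i. i < Suc L \<and> val i x = a' i}
      = (if val L x = c then insert L {i. i < L \<and> val i x = a i} else {i. i < L \<and> val i x = a i})" for x
    by (auto simp: a'_def less_Suc_eq)
  have "(\<Sum>x\<in>K. t ^ card {i. i < Suc L \<and> val i x = a' i}) = (\<Sum>x\<in>K. w x - (1 - t) * (if val L x = c then w x else 0))"
    unfolding split by (intro sum.cong) (auto simp: w_def algebra_simps)
  also have "\<dots> = (\<Sum>x\<in>K. w x) - (1 - t) * (\<Sum>x\<in>{x\<in>K. val L x = c}. w x)"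
    using assms(1) by (simp add: sum_subtractf sum_distrib_left[symmetric] sum.If_cases Int_def)
  also have "\<dots> \<le> (\<Sum>x\<in>K. w x) - (1 - t) * ((\<Sum>x\<in>K. w x) / real m)"
    using c(2) assms(4) by (intro diff_left_mono mult_left_mono) auto
  also have "\<dots> = (1 - (1 - t) / real m) * (\<Sum>x\<in>K. w x)" by (simp add: algebra_simps)
  also have "\<dots> \<le> (1 - (1 - t) / real m) * (real (card K) * (1 - (1 - t) / real m) ^ L)"
  proof (intro mult_left_mono)
    have "(1 - t) / real m \<le> 1" using assms(2-4) by (simp add: divide_le_eq)
    then show "0 \<le> 1 - (1 - t) / real m" by simp
  qed (use a(2) in \<open>simp add: w_def\<close>)
  finally have "(\<Sum>x\<in>K. t ^ card {i. i < Suc L \<and> val i x = a' i}) \<le> real (card K) * (1 - (1 - t) / real m) ^ Suc L"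
    by (simp add: ac_simps)
  moreover have "\<forall>i<Suc L. a' i < m" using a(1) c(1) by (auto simp: a'_def less_Suc_eq)
  ultimately show ?case by blast
qed simp

text \<open>A single \<open>x\<close> with at most \<open>k\<close> hits would already contribute
  \<open>t ^ k\<close> to the total weight.\<close>

lemma many_hits:
  fixes t :: real
  assumes "finite K" "m > 0" "0 < t" "t < 1" "\<And>i x. i < L \<Longrightarrow> x \<in> K \<Longrightarrow> val i x < m"
    and "real (card K) * (1 - (1 - t) / real m) ^ L < t ^ k"
  shows "\<exists>a. (\<forall>i<L. a i < m) \<and> (\<forall>x\<in>K. k < card {i. i < L \<and> val i x = a i})"
proof -
  obtain a where a: "\<forall>i<L. a i < m"
    "(\<Sum>x\<in>K. t ^ card {i. i < L \<and> val i x = a i}) \<le> real (card K) * (1 - (1 - t) / real m) ^ L"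
    using greedy_hits[OF assms(1-4), of L val] assms(5) by blast
  have "k < card {i. i < L \<and> val i x = a i}" if "x \<in> K" for x
  proof (rule ccontr)
    assume "\<not> k < card {i. i < L \<and> val i x = a i}"
    then have "t ^ k \<le> t ^ card {i. i < L \<and> val i x = a i}"
      using assms(3,4) by (intro power_decreasing) auto
    also have "\<dots> \<le> (\<Sum>x\<in>K. t ^ card {i. i < L \<and> val i x = a i})"
      using assms(1,3) that by (intro member_le_sum) auto
    finally show False using a(2) assms(6) by simp
  qed
  then show ?thesis using a(1) by blast
qed

section \<open>The ring generated by a root of unity\<close>

text \<open>The only multiplicative rule is multiplication by the root, which keeps inductions
  short; closure under products follows.\<close>

inductive_set cyclotomic_ring :: "complex \<Rightarrow> complex set" for \<omega> where
  one: "1 \<in> cyclotomic_ring \<omega>"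
| add: "x \<in> cyclotomic_ring \<omega> \<Longrightarrow> y \<in> cyclotomic_ring \<omega> \<Longrightarrow> x + y \<in> cyclotomic_ring \<omega>"
| uminus: "x \<in> cyclotomic_ring \<omega> \<Longrightarrow> - x \<in> cyclotomic_ring \<omega>"
| mult_root: "x \<in> cyclotomic_ring \<omega> \<Longrightarrow> \<omega> * x \<in> cyclotomic_ring \<omega>"

lemma cyclotomic_ring_zero: "0 \<in> cyclotomic_ring \<omega>"
  using cyclotomic_ring.add[OF cyclotomic_ring.one cyclotomic_ring.uminus[OF cyclotomic_ring.one]] by simp

lemma cyclotomic_ring_diff:
  "x \<in> cyclotomic_ring \<omega> \<Longrightarrow> y \<in> cyclotomic_ring \<omega> \<Longrightarrow> x - y \<in> cyclotomic_ring \<omega>"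
  using cyclotomic_ring.add[OF _ cyclotomic_ring.uminus] by fastforce

lemma cyclotomic_ring_mult:
  assumes "x \<in> cyclotomic_ring \<omega>" "y \<in> cyclotomic_ring \<omega>"
  shows "x * y \<in> cyclotomic_ring \<omega>"
  using assms(1)
proof induction
  case (mult_root x)
  then show ?case using cyclotomic_ring.mult_root[of "x * y"] by (simp add: mult.assoc)
qed (use assms(2) in \<open>auto simp: distrib_right intro: cyclotomic_ring.intros\<close>)

lemma cyclotomic_ring_power: "x \<in> cyclotomic_ring \<omega> \<Longrightarrow> x ^ k \<in> cyclotomic_ring \<omega>"
  by (induction k) (auto intro: cyclotomic_ring.one cyclotomic_ring_mult)

lemma cyclotomic_ring_root: "\<omega> \<in> cyclotomic_ring \<omega>"
  using cyclotomic_ring.mult_root[OF cyclotomic_ring.one] by simp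

lemma cyclotomic_ring_prod:
  "(\<And>i. i \<in> A \<Longrightarrow> f i \<in> cyclotomic_ring \<omega>) \<Longrightarrow> prod f A \<in> cyclotomic_ring \<omega>"
  by (induction A rule: infinite_finite_induct) (auto intro: cyclotomic_ring.one cyclotomic_ring_mult)

lemma cyclotomic_ring_of_nat: "of_nat k \<in> cyclotomic_ring \<omega>"
  by (induction k) (auto intro: cyclotomic_ring_zero cyclotomic_ring.intros)

lemma cyclotomic_ring_coeffs:
  assumes "x \<in> cyclotomic_ring \<omega>" "\<omega> ^ m = 1" "m > 0"
  shows "\<exists>c :: nat \<Rightarrow> int. x = (\<Sum>j<m. of_int (c j) * \<omega> ^ j)"
  using assms(1)
proof induction
  case one
  have "(\<Sum>j<m. of_int (of_bool (j = 0)) * \<omega> ^ j) = (\<Sum>j\<in>{0}. \<omega> ^ j)"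
    using assms(3) by (intro sum.mono_neutral_cong_right) auto
  then show ?case by (intro exI[of _ "\<lambda>j. of_bool (j = 0)"]) simp
next
  case (add x y)
  then obtain c d :: "nat \<Rightarrow> int" where
    "x = (\<Sum>j<m. of_int (c j) * \<omega> ^ j)" "y = (\<Sum>j<m. of_int (d j) * \<omega> ^ j)" by blast
  then show ?case by (intro exI[of _ "\<lambda>j. c j + d j"]) (simp add: sum.distrib distrib_right)
next
  case (uminus x)
  then obtain c :: "nat \<Rightarrow> int" where "x = (\<Sum>j<m. of_int (c j) * \<omega> ^ j)" by blast
  then show ?case by (intro exI[of _ "\<lambda>j. - c j"]) (simp add: sum_negf)
next
  case (mult_root x)
  then obtain c :: "nat \<Rightarrow> int" where c: "x = (\<Sum>j<m. of_int (c j) * \<omega> ^ j)" by blast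
  \<comment> \<open>Multiplication by the root rotates the coefficients, because its
    \<open>m\<close>-th power is 1.\<close>
  define d where "d = (\<lambda>j. if j = 0 then c (m - 1) else c (j - 1))"
  obtain k where k: "m = Suc k" using assms(3) by (cases m) auto
  have "\<omega> * x = (\<Sum>j<Suc k. of_int (c j) * \<omega> ^ Suc j)"
    unfolding c k by (simp only: sum_distrib_left) (simp add: ac_simps)
  also have "\<dots> = (\<Sum>j<k. of_int (c j) * \<omega> ^ Suc j) + of_int (c k)"
    using assms(2) unfolding k by simp
  also have "\<dots> = (\<Sum>j<Suc k. of_int (d j) * \<omega> ^ j)"
    by (subst sum.lessThan_Suc_shift) (simp add: d_def k)
  finally show ?case unfolding k by blast
qed

text \<open>Multiplication by \<open>x\<close> acts on the powers of the root through an integer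
  matrix. So \<open>x\<close> is an eigenvalue, hence a root of a monic integer polynomial, and a
  rational algebraic integer is an integer.\<close>

lemma rational_in_cyclotomic_ring:
  assumes "x \<in> cyclotomic_ring \<omega>" "\<omega> ^ m = 1" "m > 0" "x \<in> \<rat>"
  shows "x \<in> \<int>"
proof -
  have "\<exists>c :: nat \<Rightarrow> int. x * \<omega> ^ i = (\<Sum>j<m. of_int (c j) * \<omega> ^ j)" for i
    using assms by (intro cyclotomic_ring_coeffs cyclotomic_ring_mult cyclotomic_ring_power cyclotomic_ring_root)
  then obtain C :: "nat \<Rightarrow> nat \<Rightarrow> int" where C: "\<And>i. x * \<omega> ^ i = (\<Sum>j<m. of_int (C i j) * \<omega> ^ j)"
    by metis
  define A where "A = mat m m (\<lambda>(i, j). C i j)"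
  define B :: "complex mat" where "B = map_mat of_int A"
  define v where "v = vec m (\<lambda>j. \<omega> ^ j)"
  have A: "A \<in> carrier_mat m m" by (simp add: A_def)
  have B: "B \<in> carrier_mat m m" by (simp add: B_def A_def)
  have "B *\<^sub>v v = x \<cdot>\<^sub>v v"
  proof (rule eq_vecI)
    fix i assume "i < dim_vec (x \<cdot>\<^sub>v v)"
    then have i: "i < m" by (simp add: v_def)
    have "(B *\<^sub>v v) $ i = (\<Sum>j<m. of_int (C i j) * \<omega> ^ j)"
      using i by (simp add: B_def A_def v_def scalar_prod_def atLeast0LessThan)
    then show "(B *\<^sub>v v) $ i = (x \<cdot>\<^sub>v v) $ i" using i C[of i] by (simp add: v_def)
  qed (simp add: B_def A_def v_def)
  moreover have "v \<noteq> 0\<^sub>v m"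
  proof
    assume "v = 0\<^sub>v m"
    then have "v $ 0 = 0\<^sub>v m $ 0" by simp
    then show False using assms(3) by (simp add: v_def)
  qed
  ultimately have "eigenvalue B x"
    unfolding eigenvalue_def eigenvector_def using B by (intro exI[of _ v]) (auto simp: v_def)
  then have "poly (char_poly B) x = 0" using eigenvalue_root_char_poly[OF B] by simp
  also have "char_poly B = map_poly of_int (char_poly A)"
    unfolding B_def by (rule of_int_hom.char_poly_hom[OF A])
  finally have root: "poly (map_poly of_int (char_poly A)) x = 0" .
  have "lead_coeff (char_poly A) = 1" using degree_monic_char_poly[OF A] by auto
  then have "algebraic_int x"
    using root unfolding algebraic_int_altdef_ipoly by (intro exI[of _ "char_poly A"]) auto
  then show ?thesis using assms(4) by (rule rational_algebraic_int_is_int)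
qed

definition multiples_in_ring :: "nat \<Rightarrow> complex \<Rightarrow> complex set" where
  "multiples_in_ring p \<omega> = (\<lambda>x. of_nat p * x) ` cyclotomic_ring \<omega>"

lemma multiples_zero: "0 \<in> multiples_in_ring p \<omega>"
  unfolding multiples_in_ring_def using cyclotomic_ring_zero by force

lemma multiples_add:
  "x \<in> multiples_in_ring p \<omega> \<Longrightarrow> y \<in> multiples_in_ring p \<omega> \<Longrightarrow> x + y \<in> multiples_in_ring p \<omega>"
  unfolding multiples_in_ring_def by (auto simp flip: distrib_left intro!: imageI cyclotomic_ring.add)

lemma multiples_mult:
  "r \<in> cyclotomic_ring \<omega> \<Longrightarrow> x \<in> multiples_in_ring p \<omega> \<Longrightarrow> r * x \<in> multiples_in_ring p \<omega>"
  unfolding multiples_in_ring_def by (auto simp: mult.left_commute[of r] intro!: imageI cyclotomic_ring_mult)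

lemma multiples_diff:
  assumes "x \<in> multiples_in_ring p \<omega>" "y \<in> multiples_in_ring p \<omega>"
  shows "x - y \<in> multiples_in_ring p \<omega>"
  using multiples_add[OF assms(1) multiples_mult[OF cyclotomic_ring.uminus[OF cyclotomic_ring.one] assms(2)]] by simp

lemma multiples_sum:
  "(\<And>i. i \<in> A \<Longrightarrow> f i \<in> multiples_in_ring p \<omega>) \<Longrightarrow> sum f A \<in> multiples_in_ring p \<omega>"
  by (induction A rule: infinite_finite_induct) (auto intro: multiples_zero multiples_add)

lemma multiples_of_nat: "p dvd k \<Longrightarrow> of_nat k \<in> multiples_in_ring p \<omega>"
  unfolding multiples_in_ring_def by (auto elim!: dvdE intro!: imageI cyclotomic_ring_of_nat)

text \<open>The quotient \<open>k / p\<close> would be a rational element of the ring, hence an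
  integer.\<close>

lemma of_nat_not_multiple:
  assumes "\<omega> ^ m = 1" "m > 0" "p > 0" "of_nat k \<in> multiples_in_ring p \<omega>"
  shows "p dvd k"
proof -
  obtain x where x: "x \<in> cyclotomic_ring \<omega>" "of_nat k = of_nat p * x"
    using assms(4) unfolding multiples_in_ring_def by auto
  then have "x = of_nat k / of_nat p" using assms(3) by simp
  then have "x \<in> \<int>" using rational_in_cyclotomic_ring[OF x(1) assms(1,2)] by simp
  then obtain y where "x = of_int y" by (auto elim: Ints_cases)
  then have "(of_int (int k) :: complex) = of_int (int p * y)" using x(2) by simp
  then have "int k = int p * y" by (simp only: of_int_eq_iff)
  then have "int p dvd int k" by simp
  then show ?thesis by (simp only: int_dvd_int_iff)
qed

section \<open>Degree of functions modulo \<open>p\<close>\<close>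

definition vadd :: "(nat \<Rightarrow> nat) \<Rightarrow> (nat \<Rightarrow> nat) \<Rightarrow> nat \<Rightarrow> nat" where
  "vadd z v = (\<lambda>j. z j + v j)"

lemma vadd_commute: "vadd (vadd z u) v = vadd (vadd z v) u"
  by (auto simp: vadd_def)

text \<open>For an additive subgroup \<open>P\<close>: all \<open>d\<close>-fold differences of \<open>f\<close> lie in \<open>P\<close>, as for polynomials of degree
  less than \<open>d\<close>.\<close>

fun degree_less :: "complex set \<Rightarrow> nat \<Rightarrow> ((nat \<Rightarrow> nat) \<Rightarrow> complex) \<Rightarrow> bool" where
  "degree_less P 0 f = (\<forall>z. f z \<in> P)"
| "degree_less P (Suc d) f = (\<forall>v. degree_less P d (\<lambda>z. f (vadd z v) - f z))"

lemma degree_less_add: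
  assumes "degree_less (multiples_in_ring p \<omega>) d f" "degree_less (multiples_in_ring p \<omega>) d g"
  shows "degree_less (multiples_in_ring p \<omega>) d (\<lambda>z. f z + g z)"
  using assms
proof (induction d arbitrary: f g)
  case (Suc d)
  have "(\<lambda>z. f (vadd z v) + g (vadd z v) - (f z + g z)) =
      (\<lambda>z. (f (vadd z v) - f z) + (g (vadd z v) - g z))" for v by auto
  then show ?case using Suc by simp
qed (simp add: multiples_add)

lemma degree_less_cmult:
  assumes "degree_less (multiples_in_ring p \<omega>) d f" "r \<in> cyclotomic_ring \<omega>"
  shows "degree_less (multiples_in_ring p \<omega>) d (\<lambda>z. r * f z)"
  using assms
proof (induction d arbitrary: f)
  case (Suc d)
  have "(\<lambda>z. r * f (vadd z v) - r * f z) = (\<lambda>z. r * (f (vadd z v) - f z))" for v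
    by (auto simp: algebra_simps)
  then show ?case using Suc by simp
qed (simp add: multiples_mult)

lemma degree_less_shift:
  assumes "degree_less P d f" shows "degree_less P d (\<lambda>z. f (vadd z u))"
  using assms
proof (induction d arbitrary: f)
  case (Suc d)
  then have "degree_less P d (\<lambda>z. f (vadd (vadd z u) v) - f (vadd z u))" for v
    using Suc.IH[of "\<lambda>z. f (vadd z v) - f z"] by simp
  then show ?case by (simp add: vadd_commute[of _ u])
qed simp

lemma degree_less_Suc:
  assumes "degree_less (multiples_in_ring p \<omega>) d f"
  shows "degree_less (multiples_in_ring p \<omega>) (Suc d) f"
  using assms by (induction d arbitrary: f) (auto intro: multiples_diff)

lemma degree_less_mono:
  assumes "degree_less (multiples_in_ring p \<omega>) d f" "d \<le> e"
  shows "degree_less (multiples_in_ring p \<omega>) e f"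
  using assms(2,1) by (induction rule: dec_induct) (auto intro: degree_less_Suc simp del: degree_less.simps)

text \<open>The difference of a product is the difference of \<open>f\<close> times a shift of
  \<open>g\<close>, plus \<open>f\<close> times the difference of \<open>g\<close>; both summands
  have a smaller \<open>a + b\<close>. Degrees below \<open>a\<close> and below \<open>b\<close> add
  up to one below \<open>a + b - 1\<close>.\<close>

lemma degree_less_mult:
  assumes "degree_less (multiples_in_ring p \<omega>) a f" "degree_less (multiples_in_ring p \<omega>) b g"
    and "\<And>z. f z \<in> cyclotomic_ring \<omega>" "\<And>z. g z \<in> cyclotomic_ring \<omega>"
  shows "degree_less (multiples_in_ring p \<omega>) (a + b - 1) (\<lambda>z. f z * g z)"
  using assms
proof (induction "a + b" arbitrary: a b f g rule: less_induct)
  case less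
  show ?case
  proof (cases "a = 0 \<or> b = 0")
    case True
    have "f z * g z \<in> multiples_in_ring p \<omega>" for z
    proof (cases "a = 0")
      case True
      then have "f z \<in> multiples_in_ring p \<omega>" using less.prems(1) by simp
      then have "g z * f z \<in> multiples_in_ring p \<omega>" by (rule multiples_mult[OF less.prems(4)])
      then show ?thesis by (simp only: mult.commute)
    next
      case False
      then have "g z \<in> multiples_in_ring p \<omega>" using less.prems(2) \<open>a = 0 \<or> b = 0\<close> by simp
      then show ?thesis by (rule multiples_mult[OF less.prems(3)])
    qed
    then have "degree_less (multiples_in_ring p \<omega>) 0 (\<lambda>z. f z * g z)" by simp
    then show ?thesis by (rule degree_less_mono) simp
  next
    case False
    then obtain a' b' where ab: "a = Suc a'" "b = Suc b'" by (metis not0_implies_Suc)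
    have "degree_less (multiples_in_ring p \<omega>) (a' + b') (\<lambda>z. f (vadd z v) * g (vadd z v) - f z * g z)" for v
    proof -
      have "degree_less (multiples_in_ring p \<omega>) (a' + b - 1) (\<lambda>z. (f (vadd z v) - f z) * g (vadd z v))"
        using less.prems ab by (intro less.hyps degree_less_shift) (auto intro: cyclotomic_ring_diff)
      moreover have "degree_less (multiples_in_ring p \<omega>) (a + b' - 1) (\<lambda>z. f z * (g (vadd z v) - g z))"
        using less.prems ab by (intro less.hyps) (auto intro: cyclotomic_ring_diff)
      ultimately have "degree_less (multiples_in_ring p \<omega>) (a' + b')
          (\<lambda>z. (f (vadd z v) - f z) * g (vadd z v) + f z * (g (vadd z v) - g z))"
        using ab by (intro degree_less_add) simp_all
      then show ?thesis by (simp add: algebra_simps)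
    qed
    then show ?thesis using ab by simp
  qed
qed

definition forward_diff :: "(nat \<Rightarrow> complex) \<Rightarrow> nat \<Rightarrow> complex" where
  "forward_diff \<phi> = (\<lambda>x. \<phi> (Suc x) - \<phi> x)"

text \<open>A step of width \<open>w\<close> is a sum of \<open>w\<close> unit steps, so for
  functions of one coordinate only unit differences need checking.\<close>

lemma forward_diff_iter_shift:
  "(forward_diff ^^ d) (\<lambda>x. \<phi> (x + w) - \<phi> x) y = (\<Sum>i<w. (forward_diff ^^ Suc d) \<phi> (y + i))"
proof (induction d arbitrary: \<phi>)
  case 0
  show ?case using sum_lessThan_telescope[of "\<lambda>i. \<phi> (y + i)" w] by (simp add: forward_diff_def)
next
  case (Suc d)
  have "forward_diff (\<lambda>x. \<phi> (x + w) - \<phi> x) = (\<lambda>x. forward_diff \<phi> (x + w) - forward_diff \<phi> x)"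
    by (auto simp: forward_diff_def)
  then show ?case using Suc.IH[of "forward_diff \<phi>"] by (simp only: funpow_Suc_right o_apply)
qed

lemma degree_less_coordinate:
  assumes "\<And>x. (forward_diff ^^ d) \<phi> x \<in> multiples_in_ring p \<omega>"
  shows "degree_less (multiples_in_ring p \<omega>) d (\<lambda>z. \<phi> (z j))"
  using assms
proof (induction d arbitrary: \<phi>)
  case (Suc d)
  have "degree_less (multiples_in_ring p \<omega>) d (\<lambda>z. \<phi> (z j + v j) - \<phi> (z j))" for v
    using Suc.prems by (intro Suc.IH[of "\<lambda>x. \<phi> (x + v j) - \<phi> x"])
      (simp only: forward_diff_iter_shift multiples_sum)
  then show ?case by (simp add: vadd_def)
qed simp

lemma forward_diff_iter:
  "(forward_diff ^^ n) \<phi> x = (\<Sum>k\<le>n. (-1) ^ (n + k) * of_nat (n choose k) * \<phi> (x + k))"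
proof (induction n arbitrary: x)
  case (Suc n)
  define S where "S = (\<lambda>x. \<Sum>k\<le>n. (-1) ^ (n + k) * of_nat (n choose k) * \<phi> (x + k))"
  have "(\<Sum>k\<le>Suc n. (-1) ^ (Suc n + k) * of_nat (Suc n choose k) * \<phi> (x + k))
      = (-1) ^ Suc n * \<phi> x + (\<Sum>k\<le>n. (-1) ^ (n + k) * of_nat (Suc n choose Suc k) * \<phi> (x + Suc k))"
    by (subst sum.atMost_Suc_shift) simp
  also have "(\<Sum>k\<le>n. (-1) ^ (n + k) * of_nat (Suc n choose Suc k) * \<phi> (x + Suc k))
      = S (Suc x) + (\<Sum>k\<le>n. (-1) ^ (n + k) * of_nat (n choose Suc k) * \<phi> (x + Suc k))"
    unfolding S_def by (simp add: sum.distrib[symmetric] algebra_simps)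
  also have "(-1) ^ Suc n * \<phi> x + (S (Suc x) + (\<Sum>k\<le>n. (-1) ^ (n + k) * of_nat (n choose Suc k) * \<phi> (x + Suc k)))
      = S (Suc x) - (\<Sum>k\<le>Suc n. (-1) ^ (n + k) * of_nat (n choose k) * \<phi> (x + k))"
    using sum.atMost_Suc_shift[of "\<lambda>k. (-1) ^ (n + k) * of_nat (n choose k) * \<phi> (x + k)" n]
    by (simp add: sum_negf del: sum.atMost_Suc)
  also have "(\<Sum>k\<le>Suc n. (-1) ^ (n + k) * of_nat (n choose k) * \<phi> (x + k)) = S x"
    by (simp add: S_def binomial_eq_0)
  finally show ?case using Suc.IH by (simp add: forward_diff_def S_def)
qed simp

text \<open>As \<open>p ^ e\<close> divides \<open>k * (p ^ e choose k)\<close>, a binomial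
  coefficient prime to \<open>p\<close> would force \<open>p ^ e\<close> to divide
  \<open>k\<close>.\<close>

lemma prime_dvd_choose_prime_power:
  assumes "prime (p::nat)" "0 < k" "k < p ^ e"
  shows "p dvd (p ^ e choose k)"
proof (rule ccontr)
  assume "\<not> p dvd (p ^ e choose k)"
  then have "coprime (p ^ e) (p ^ e choose k)"
    using assms(1) by (simp add: prime_imp_coprime coprime_power_left_iff)
  moreover have "p ^ e dvd k * (p ^ e choose k)"
    using times_binomial_minus1_eq[OF assms(2), of "p ^ e"] by simp
  ultimately have "p ^ e dvd k" by (simp add: coprime_dvd_mult_left_iff)
  then show False using assms(2,3) by (auto dest: dvd_imp_le)
qed

text \<open>The inner binomial coefficients vanish modulo \<open>p\<close>. The two end terms have
  equal indicators by periodicity; their signs cancel for odd \<open>q\<close>, and for even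
  \<open>q\<close> they add up to a multiple of 2.\<close>

lemma forward_diff_prime_power:
  assumes "prime p" "q = p ^ e"
  shows "(forward_diff ^^ q) (\<lambda>x. of_bool (q dvd x)) x \<in> multiples_in_ring p \<omega>"
proof -
  define g :: "nat \<Rightarrow> complex" where "g = (\<lambda>k. (-1) ^ (q + k) * of_nat (q choose k) * of_bool (q dvd x + k))"
  have q: "q > 0" using assms by (simp add: prime_gt_0_nat)
  have unit: "(-1) ^ k * of_bool b \<in> cyclotomic_ring \<omega>" for k b
    by (intro cyclotomic_ring_mult cyclotomic_ring_power cyclotomic_ring.uminus cyclotomic_ring.one)
      (auto intro: cyclotomic_ring.one cyclotomic_ring_zero)
  have "(\<Sum>k\<in>{0<..<q}. g k) \<in> multiples_in_ring p \<omega>"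
  proof (rule multiples_sum)
    fix k assume k: "k \<in> {0<..<q}"
    have "g k = ((-1) ^ (q + k) * of_bool (q dvd x + k)) * of_nat (q choose k)" by (simp add: g_def)
    also have "\<dots> \<in> multiples_in_ring p \<omega>"
      using k assms by (intro multiples_mult unit multiples_of_nat) (auto intro: prime_dvd_choose_prime_power)
    finally show "g k \<in> multiples_in_ring p \<omega>" .
  qed
  moreover have "g 0 + g q \<in> multiples_in_ring p \<omega>"
  proof (cases "p = 2")
    case True
    have "g 0 + g q = (((-1) ^ q + 1) * of_bool (q dvd x))"
      unfolding g_def by (simp add: algebra_simps flip: power_add mult_2)
    \<comment> \<open>With \<open>p = 2\<close> the value \<open>q = 1\<close> is possible too,
      hence the case distinction on parity.\<close>
    moreover have "((-1) ^ q + 1 :: complex) = of_nat (if even q then 2 else 0)" by simp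
    ultimately have "g 0 + g q = of_nat (if even q then 2 else 0) * of_bool (q dvd x)" by simp
    then have "g 0 + g q = of_nat ((if even q then 2 else 0) * of_bool (q dvd x))" by simp
    then show ?thesis using True by (metis multiples_of_nat dvd_0_right dvd_mult2 dvd_refl)
  next
    case False
    then have "odd p" using assms(1) by (metis primes_dvd_imp_eq two_is_prime_nat)
    then have "odd q" using assms(2) by simp
    then have "g 0 + g q = 0" unfolding g_def by (simp flip: mult_2)
    then show ?thesis by (simp add: multiples_zero)
  qed
  moreover have "(forward_diff ^^ q) (\<lambda>x. of_bool (q dvd x)) x = (g 0 + g q) + (\<Sum>k\<in>{0<..<q}. g k)"
  proof -
    have "{..q} = insert 0 (insert q {0<..<q})" using q by auto
    then have "(\<Sum>k\<le>q. g k) = (g 0 + g q) + (\<Sum>k\<in>{0<..<q}. g k)" using q by simp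
    then show ?thesis unfolding forward_diff_iter g_def .
  qed
  ultimately show ?thesis by (simp add: multiples_add)
qed

text \<open>Each coordinate contributes degree at most \<open>q - 1\<close>, and degrees add under
  products.\<close>

lemma degree_less_divisible:
  assumes "prime p" "q = p ^ e"
  shows "degree_less (multiples_in_ring p \<omega>) (r * (q - 1) + 1) (\<lambda>z. \<Prod>j<r. of_bool (q dvd z j))"
proof (induction r)
  case (Suc r)
  have q: "q > 0" using assms by (simp add: prime_gt_0_nat)
  have b: "of_bool c \<in> cyclotomic_ring \<omega>" for c by (auto intro: cyclotomic_ring.one cyclotomic_ring_zero)
  have "degree_less (multiples_in_ring p \<omega>) (r * (q - 1) + 1 + q - 1)
      (\<lambda>z. (\<Prod>j<r. of_bool (q dvd z j)) * of_bool (q dvd z r))"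
    using degree_less_coordinate[of q "\<lambda>x. of_bool (q dvd x)" p \<omega> r] forward_diff_prime_power[OF assms]
    by (intro degree_less_mult Suc.IH b cyclotomic_ring_prod) auto
  moreover have "r * (q - 1) + 1 + q - 1 = Suc r * (q - 1) + 1" using q by simp
  ultimately show ?case by (simp only: prod.lessThan_Suc)
qed (simp add: multiples_zero)

section \<open>Twisted shift operators and their action on characters\<close>

fun twisted_shifts :: "(nat \<Rightarrow> nat \<Rightarrow> nat) \<Rightarrow> (nat \<Rightarrow> complex) \<Rightarrow> nat \<Rightarrow>
    ((nat \<Rightarrow> nat) \<Rightarrow> complex) \<Rightarrow> (nat \<Rightarrow> nat) \<Rightarrow> complex" where
  "twisted_shifts v a 0 f = f"
| "twisted_shifts v a (Suc i) f =
     (\<lambda>z. twisted_shifts v a i f (vadd z (v i)) - a i * twisted_shifts v a i f z)"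

text \<open>A product of the differences "shift by \<open>v i\<close> minus \<open>a i\<close>" is
  multiplied out: \<open>I\<close> collects the factors from which the shift is taken.\<close>

lemma twisted_shifts_expand:
  "twisted_shifts v a L f z = (\<Sum>I\<in>Pow {..<L}. (\<Prod>i\<in>{..<L} - I. - a i) * f (\<lambda>j. z j + (\<Sum>i\<in>I. v i j)))"
proof (induction L arbitrary: z)
  case (Suc L)
  let ?g = "\<lambda>I. (\<Prod>i\<in>{..<Suc L} - I. - a i) * f (\<lambda>j. z j + (\<Sum>i\<in>I. v i j))"
  have P: "Pow {..<Suc L} = Pow {..<L} \<union> insert L ` Pow {..<L}"
    by (simp add: lessThan_Suc Pow_insert)
  have "(\<Sum>I\<in>Pow {..<Suc L}. ?g I) = (\<Sum>I\<in>Pow {..<L}. ?g I) + (\<Sum>I\<in>insert L ` Pow {..<L}. ?g I)"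
    unfolding P by (rule sum.union_disjoint) auto
  also have "(\<Sum>I\<in>insert L ` Pow {..<L}. ?g I) = (\<Sum>I\<in>Pow {..<L}. ?g (insert L I))"
    by (rule sum.reindex_cong[where l = "insert L"]) (auto simp: inj_on_def)
  also have "\<dots> = twisted_shifts v a L f (vadd z (v L))"
    unfolding Suc.IH
  proof (rule sum.cong)
    fix I assume I: "I \<in> Pow {..<L}"
    then have "finite I" "L \<notin> I" using finite_subset by auto
    moreover have "{..<Suc L} - insert L I = {..<L} - I" by auto
    ultimately show "?g (insert L I) = (\<Prod>i\<in>{..<L} - I. - a i) * f (\<lambda>j. vadd z (v L) j + (\<Sum>i\<in>I. v i j))"
      by (simp add: vadd_def ac_simps)
  qed simp
  also have "(\<Sum>I\<in>Pow {..<L}. ?g I) = - a L * twisted_shifts v a L f z"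
    unfolding Suc.IH sum_distrib_left
  proof (rule sum.cong)
    fix I assume I: "I \<in> Pow {..<L}"
    then have "{..<Suc L} - I = insert L ({..<L} - I)" by auto
    then show "?g I = - a L * ((\<Prod>i\<in>{..<L} - I. - a i) * f (\<lambda>j. z j + (\<Sum>i\<in>I. v i j)))" by simp
  qed simp
  finally show ?case by simp
qed simp

lemma twisted_shifts_sum:
  "twisted_shifts v a L (\<lambda>z. \<Sum>k\<in>K. f k z) z = (\<Sum>k\<in>K. twisted_shifts v a L (f k) z)"
  by (induction L arbitrary: z) (simp_all add: sum_subtractf sum_distrib_left)

text \<open>One operator turns \<open>\<theta> * G\<close> into \<open>\<theta>\<close> times
  \<open>\<theta> (v i)\<close> times the difference of \<open>G\<close>, plus
  \<open>(\<theta> (v i) - a i) * G\<close>. On a hit the second term disappears and the degree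
  bound drops by one.\<close>

lemma twisted_shifts_character:
  assumes "\<And>z u. \<theta> (vadd z u) = \<theta> z * \<theta> u" "\<And>z. \<theta> z \<in> cyclotomic_ring \<omega>"
    and "\<And>i. i < L \<Longrightarrow> a i \<in> cyclotomic_ring \<omega>" "degree_less (multiples_in_ring p \<omega>) d G"
  shows "\<exists>G'. (\<forall>z. twisted_shifts v a L (\<lambda>z. \<theta> z * G z) z = \<theta> z * G' z) \<and>
    degree_less (multiples_in_ring p \<omega>) (d - card {i. i < L \<and> \<theta> (v i) = a i}) G'"
  using assms(3)
proof (induction L)
  case 0
  show ?case using assms(4) by (intro exI[of _ G]) simp
next
  case (Suc L)
  define c where "c = card {i. i < L \<and> \<theta> (v i) = a i}"
  obtain G' where G': "\<And>z. twisted_shifts v a L (\<lambda>z. \<theta> z * G z) z = \<theta> z * G' z"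
    "degree_less (multiples_in_ring p \<omega>) (d - c) G'"
    using Suc by (auto simp: c_def)
  define H where "H = (\<lambda>z. \<theta> (v L) * (G' (vadd z (v L)) - G' z) + (\<theta> (v L) - a L) * G' z)"
  have eq: "twisted_shifts v a (Suc L) (\<lambda>z. \<theta> z * G z) z = \<theta> z * H z" for z
    unfolding twisted_shifts.simps G'(1) assms(1) H_def by (simp add: algebra_simps)
  have set: "{i. i < Suc L \<and> \<theta> (v i) = a i} =
      (if \<theta> (v L) = a L then insert L {i. i < L \<and> \<theta> (v i) = a i} else {i. i < L \<and> \<theta> (v i) = a i})"
    by (auto simp: less_Suc_eq)
  \<comment> \<open>If the truncated bound is already 0, all values lie in the ideal and so do their
    differences.\<close>
  have diff: "degree_less (multiples_in_ring p \<omega>) (d - Suc c) (\<lambda>z. G' (vadd z (v L)) - G' z)"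
  proof (cases "d - c")
    case 0
    then show ?thesis using G'(2) by (auto intro: multiples_diff)
  next
    case (Suc b)
    then have "d - Suc c = b" by simp
    then show ?thesis using G'(2) Suc by simp
  qed
  have aL: "a L \<in> cyclotomic_ring \<omega>" using Suc.prems by simp
  have "degree_less (multiples_in_ring p \<omega>) (d - card {i. i < Suc L \<and> \<theta> (v i) = a i}) H"
  proof (cases "\<theta> (v L) = a L")
    case True
    then have "H = (\<lambda>z. \<theta> (v L) * (G' (vadd z (v L)) - G' z))" by (auto simp: H_def)
    moreover have "card {i. i < Suc L \<and> \<theta> (v i) = a i} = Suc c"
      unfolding set using True by (simp add: c_def)
    ultimately show ?thesis using degree_less_cmult[OF diff assms(2)] by simp
  next
    case False
    have "degree_less (multiples_in_ring p \<omega>) (d - c) (\<lambda>z. G' (vadd z (v L)) - G' z)"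
      using diff by (rule degree_less_mono) simp
    then have "degree_less (multiples_in_ring p \<omega>) (d - c) H"
      unfolding H_def using G'(2) assms(2) aL
      by (intro degree_less_add degree_less_cmult cyclotomic_ring_diff)
    then show ?thesis using False unfolding set by (simp add: c_def)
  qed
  then show ?case using eq by blast
qed

section \<open>Character sums and the zero-sum criterion\<close>

lemma sum_roots_of_unity:
  assumes "m > 0"
  defines "\<omega> \<equiv> exp (2 * of_real pi * \<i> / of_nat m)"
  shows "(\<Sum>k<m. \<omega> ^ (k * x)) = of_nat m * of_bool (m dvd x)"
proof -
  have w: "\<omega> ^ j = exp (2 * of_real pi * \<i> * of_nat j / of_nat m)" for j
    unfolding \<omega>_def exp_of_nat_mult[symmetric] by (simp add: ac_simps)
  have one: "\<omega> ^ j = 1 \<longleftrightarrow> m dvd j" for j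
    using assms(1) complex_root_unity_eq_1[of m j] unfolding w by simp
  show ?thesis
  proof (cases "m dvd x")
    case True
    then have "\<omega> ^ (k * x) = 1" for k unfolding one by simp
    then show ?thesis using True by simp
  next
    case False
    then have "\<omega> ^ x \<noteq> 1" using one by simp
    moreover have "(\<omega> ^ x) ^ m = 1" unfolding power_mult[symmetric] one by simp
    ultimately have "(\<Sum>k<m. (\<omega> ^ x) ^ k) = 0" by (simp add: geometric_sum)
    then show ?thesis using False by (simp add: power_mult[symmetric] mult.commute)
  qed
qed

theorem zero_sum_mod:
  fixes v :: "nat \<Rightarrow> nat \<Rightarrow> nat" and t :: real
  assumes p: "prime p" "q = p ^ e" and m: "m > 0" "coprime p m" and t: "0 < t" "t < 1"
    and L: "real (m ^ r) * (1 - (1 - t) / real m) ^ L < t ^ (r * (q - 1))"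
  shows "\<exists>I. I \<subseteq> {..<L} \<and> I \<noteq> {} \<and> (\<forall>j<r. q * m dvd (\<Sum>i\<in>I. v i j))"
proof (rule ccontr)
  assume contra: "\<not> ?thesis"
  define \<omega> where "\<omega> = exp (2 * of_real pi * \<i> / of_nat m)"
  have \<omega>m: "\<omega> ^ m = 1"
    unfolding \<omega>_def exp_of_nat_mult[symmetric] using m(1) by simp
  have \<omega>R: "\<omega> ^ k \<in> cyclotomic_ring \<omega>" for k by (intro cyclotomic_ring_power cyclotomic_ring_root)
  define K where "K = ({..<r} \<rightarrow>\<^sub>E {..<m})"
  define val where "val = (\<lambda>i \<kappa>. (\<Sum>j<r. \<kappa> j * v i j) mod m)"
  have "finite K" "card K = m ^ r" by (simp_all add: K_def finite_PiE card_PiE)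
  then obtain c where c: "\<forall>i<L. c i < m" "\<And>\<kappa>. \<kappa> \<in> K \<Longrightarrow> r * (q - 1) < card {i. i < L \<and> val i \<kappa> = c i}"
    using many_hits[of K m t L val "r * (q - 1)"] m(1) t L by (auto simp: val_def)
  define a where "a = (\<lambda>i. \<omega> ^ c i)"
  define \<theta> where "\<theta> = (\<lambda>\<kappa> z. \<omega> ^ (\<Sum>j<r. \<kappa> j * z j))"
  define H :: "(nat \<Rightarrow> nat) \<Rightarrow> complex" where "H = (\<lambda>z. \<Prod>j<r. of_bool (q dvd z j))"
  define f :: "(nat \<Rightarrow> nat) \<Rightarrow> complex" where "f = (\<lambda>z. \<Prod>j<r. of_nat m * of_bool (q * m dvd z j))"
  have "coprime q m" using p(2) m(2) by simp
  then have qm: "q * m dvd x \<longleftrightarrow> m dvd x \<and> q dvd x" for x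
    by (metis divides_mult dvd_mult_left dvd_mult_right)
  \<comment> \<open>Orthogonality in each coordinate writes \<open>m\<close> times divisibility by
    \<open>m\<close> as a sum over \<open>m\<close> roots of unity; multiplying out gives one
    character for each element of \<open>K\<close>.\<close>
  have f_sum: "f = (\<lambda>z. \<Sum>\<kappa>\<in>K. \<theta> \<kappa> z * H z)"
  proof
    fix z
    have "f z = (\<Prod>j<r. of_nat m * of_bool (m dvd z j)) * H z"
      unfolding f_def H_def by (simp add: qm prod.distrib[symmetric] of_bool_conj mult.assoc)
    also have "(\<Prod>j<r. of_nat m * of_bool (m dvd z j) :: complex) = (\<Prod>j<r. \<Sum>k<m. \<omega> ^ (k * z j))"
      unfolding \<omega>_def using m(1) by (simp add: sum_roots_of_unity)
    also have "\<dots> = (\<Sum>\<kappa>\<in>K. \<Prod>j<r. \<omega> ^ (\<kappa> j * z j))"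
      unfolding K_def by (rule prod_sum_PiE) auto
    finally show "f z = (\<Sum>\<kappa>\<in>K. \<theta> \<kappa> z * H z)"
      by (simp add: \<theta>_def sum_distrib_right power_sum)
  qed
  define Z where "Z = (\<lambda>_::nat. 0::nat)"
  have "twisted_shifts v a L f Z \<in> multiples_in_ring p \<omega>"
    unfolding f_sum twisted_shifts_sum
  proof (rule multiples_sum)
    fix \<kappa> assume \<kappa>: "\<kappa> \<in> K"
    obtain G' where G': "\<forall>z. twisted_shifts v a L (\<lambda>z. \<theta> \<kappa> z * H z) z = \<theta> \<kappa> z * G' z"
      "degree_less (multiples_in_ring p \<omega>) (r * (q - 1) + 1 - card {i. i < L \<and> \<theta> \<kappa> (v i) = a i}) G'"
      using twisted_shifts_character[of "\<theta> \<kappa>" \<omega> L a p "r * (q - 1) + 1" H v]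
        degree_less_divisible[OF p, of \<omega> r]
      by (auto simp: \<theta>_def a_def H_def vadd_def \<omega>R algebra_simps sum.distrib power_add)
    have "{i. i < L \<and> val i \<kappa> = c i} \<subseteq> {i. i < L \<and> \<theta> \<kappa> (v i) = a i}"
    proof safe
      fix i assume i: "i < L" "val i \<kappa> = c i"
      define s where "s = (\<Sum>j<r. \<kappa> j * v i j)"
      have "\<omega> ^ s = \<omega> ^ (m * (s div m) + s mod m)" by simp
      also have "\<dots> = \<omega> ^ (s mod m)" unfolding power_add power_mult \<omega>m by simp
      finally show "\<theta> \<kappa> (v i) = a i" using i(2) by (simp add: \<theta>_def a_def val_def s_def)
    qed
    then have "card {i. i < L \<and> val i \<kappa> = c i} \<le> card {i. i < L \<and> \<theta> \<kappa> (v i) = a i}"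
      by (intro card_mono) auto
    then have "r * (q - 1) + 1 - card {i. i < L \<and> \<theta> \<kappa> (v i) = a i} = 0" using c(2)[OF \<kappa>] by simp
    then have "G' Z \<in> multiples_in_ring p \<omega>" using G'(2) by simp
    then show "twisted_shifts v a L (\<lambda>z. \<theta> \<kappa> z * H z) Z \<in> multiples_in_ring p \<omega>"
      using G'(1) \<omega>R by (simp add: \<theta>_def multiples_mult)
  qed
  also have "twisted_shifts v a L f Z = (\<Prod>i<L. - a i) * of_nat (m ^ r)"
  proof -
    \<comment> \<open>By the assumption for contradiction, only the empty subset contributes at the
      origin.\<close>
    have "f (\<lambda>j. Z j + (\<Sum>i\<in>I. v i j)) = 0" if "I \<in> Pow {..<L} - {{}}" for I
    proof -
      have "\<not> (\<forall>j<r. q * m dvd (\<Sum>i\<in>I. v i j))"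
      proof
        assume "\<forall>j<r. q * m dvd (\<Sum>i\<in>I. v i j)"
        then have "\<exists>I. I \<subseteq> {..<L} \<and> I \<noteq> {} \<and> (\<forall>j<r. q * m dvd (\<Sum>i\<in>I. v i j))"
          using that by (intro exI[of _ I] conjI) simp_all
        then show False using contra by contradiction
      qed
      then obtain j where "j < r" "\<not> q * m dvd (\<Sum>i\<in>I. v i j)" by auto
      then show ?thesis unfolding f_def Z_def by (intro prod_zero) auto
    qed
    then have "twisted_shifts v a L f Z = (\<Sum>I\<in>{{}}. (\<Prod>i\<in>{..<L} - I. - a i) * f (\<lambda>j. Z j + (\<Sum>i\<in>I. v i j)))"
      unfolding twisted_shifts_expand by (intro sum.mono_neutral_right) auto
    then show ?thesis by (simp add: f_def Z_def)
  qed
  finally have *: "(\<Prod>i<L. - a i) * of_nat (m ^ r) \<in> multiples_in_ring p \<omega>" .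
  \<comment> \<open>Each \<open>a i\<close> is an \<open>m\<close>-th root of unity, so
    \<open>a i ^ (m - 1)\<close> is its inverse in the ring; cancelling these units isolates
    \<open>m ^ r\<close>.\<close>
  have "(\<Prod>i<L. - (a i ^ (m - 1))) \<in> cyclotomic_ring \<omega>"
    by (intro cyclotomic_ring_prod cyclotomic_ring.uminus cyclotomic_ring_power) (simp add: a_def \<omega>R)
  from multiples_mult[OF this *]
  have "(\<Prod>i<L. - (a i ^ (m - 1))) * (\<Prod>i<L. - a i) * of_nat (m ^ r) \<in> multiples_in_ring p \<omega>"
    by (simp only: mult.assoc)
  moreover have "(\<Prod>i<L. - (a i ^ (m - 1))) * (\<Prod>i<L. - a i) = 1"
  proof -
    have "a i ^ (m - 1) * a i = 1" for i
    proof -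
      have "a i ^ (m - 1) * a i = a i ^ m" using m(1) by (cases m) simp_all
      also have "\<dots> = (\<omega> ^ m) ^ c i" by (simp add: a_def power_mult[symmetric] mult.commute)
      finally show ?thesis by (simp add: \<omega>m)
    qed
    then show ?thesis by (simp add: prod.distrib[symmetric])
  qed
  ultimately have "of_nat (m ^ r) \<in> multiples_in_ring p \<omega>" by simp
  then have "p dvd m ^ r"
    using of_nat_not_multiple[OF \<omega>m m(1), of p "m ^ r"] p(1) prime_gt_0_nat by blast
  then have "p dvd m" using p(1) prime_dvd_power by blast
  then show False using p(1) m(2) by (metis coprime_absorb_left not_prime_unit)
qed

section \<open>The Davenport constant\<close>

lemma mangoldt_zeroI:
  assumes "prime a" "prime b" "a \<noteq> b" "a dvd n" "b dvd n"
  shows "mangoldt n = (0::real)"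
proof -
  have "\<not> primepow n"
  proof
    assume "primepow n"
    then obtain p k where pk: "prime p" "n = p ^ k" unfolding primepow_def by auto
    then have "a dvd p" "b dvd p" using assms prime_dvd_power by blast+
    then have "a = p" "b = p" using assms(1,2) pk(1) primes_dvd_imp_eq by blast+
    then show False using assms(3) by simp
  qed
  then show ?thesis by (simp add: mangoldt_def)
qed

lemma chebyshev_psi_step: "n > 0 \<Longrightarrow> chebyshev_psi n = chebyshev_psi (n - 1) + mangoldt n"
  by (cases n) (simp_all add: chebyshev_psi_def)

text \<open>For small \<open>q\<close> the additive 3 of \<open>psi_bounds\<close> is too expensive,
  so the values are computed.\<close>

lemma chebyshev_psi_small:
  assumes "2 \<le> n" "n \<le> 12"
  shows "chebyshev_psi n \<le> 10368 / 10000 * real n"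
proof -
  have prime_vals: "mangoldt 3 = ln (3::real)" "mangoldt 5 = ln (5::real)" "mangoldt 7 = ln (7::real)" "mangoldt 11 = ln (11::real)"
    by simp_all
  have power_vals: "mangoldt 4 = ln (2::real)" "mangoldt 8 = ln (2::real)" "mangoldt 9 = ln (3::real)"
    using mangoldt_primepow'[of 2 2, where ?'a = real] mangoldt_primepow'[of 2 3, where ?'a = real]
      mangoldt_primepow'[of 3 2, where ?'a = real] by simp_all
  have zero_vals: "mangoldt 6 = (0::real)" "mangoldt 10 = (0::real)" "mangoldt 12 = (0::real)"
    using mangoldt_zeroI[of 2 3 6] mangoldt_zeroI[of 2 5 10] mangoldt_zeroI[of 2 3 12] by simp_all
  note vals = prime_vals power_vals zero_vals
  have p3: "chebyshev_psi 3 = ln 2 + ln 3" using chebyshev_psi_step[of 3] chebyshev_psi_2 vals by simp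
  have p4: "chebyshev_psi 4 = 2 * ln 2 + ln 3" using chebyshev_psi_step[of 4] p3 vals by simp
  have p5: "chebyshev_psi 5 = 2 * ln 2 + ln 3 + ln 5" using chebyshev_psi_step[of 5] p4 vals by simp
  have p6: "chebyshev_psi 6 = 2 * ln 2 + ln 3 + ln 5" using chebyshev_psi_step[of 6] p5 vals by simp
  have p7: "chebyshev_psi 7 = 2 * ln 2 + ln 3 + ln 5 + ln 7" using chebyshev_psi_step[of 7] p6 vals by simp
  have p8: "chebyshev_psi 8 = 3 * ln 2 + ln 3 + ln 5 + ln 7" using chebyshev_psi_step[of 8] p7 vals by simp
  have p9: "chebyshev_psi 9 = 3 * ln 2 + 2 * ln 3 + ln 5 + ln 7" using chebyshev_psi_step[of 9] p8 vals by simp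
  have p10: "chebyshev_psi 10 = 3 * ln 2 + 2 * ln 3 + ln 5 + ln 7" using chebyshev_psi_step[of 10] p9 vals by simp
  have p11: "chebyshev_psi 11 = 3 * ln 2 + 2 * ln 3 + ln 5 + ln 7 + ln 11" using chebyshev_psi_step[of 11] p10 vals by simp
  have p12: "chebyshev_psi 12 = 3 * ln 2 + 2 * ln 3 + ln 5 + ln 7 + ln 11" using chebyshev_psi_step[of 12] p11 vals by simp
  have "n = 2 \<or> n = 3 \<or> n = 4 \<or> n = 5 \<or> n = 6 \<or> n = 7 \<or> n = 8 \<or> n = 9 \<or> n = 10 \<or> n = 11 \<or> n = 12"
    using assms by presburger
  then show ?thesis
    using chebyshev_psi_2 p3 p4 p5 p6 p7 p8 p9 p10 p11 p12 ln_2_bounds(2) ln_prime_bounds(2,4,6,8)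
    by (elim disjE) simp_all
qed

text \<open>Every prime power dividing \<open>n\<close> is at most the largest prime power component \<open>q\<close>, so \<open>ln n \<le> \<psi>(q)\<close>.\<close>

lemma largest_prime_power_factor:
  assumes "n \<ge> (2::nat)"
  obtains p e m where "prime p" "e > 0" "n = p ^ e * m" "coprime p m" "m > 0"
    "ln (real m) \<le> chebyshev_psi (p ^ e) - ln (real (p ^ e))"
proof -
  define Q where "Q = (\<lambda>p. p ^ multiplicity p n) ` prime_factors n"
  obtain p0 where "prime p0" "p0 dvd n" using assms prime_factor_nat[of n] by auto
  then have "p0 \<in> prime_factors n" using assms by (simp add: prime_factors_dvd)
  then have Q: "finite Q" "Q \<noteq> {}" by (auto simp: Q_def)
  define q where "q = Max Q"
  have "q \<in> Q" unfolding q_def using Q by (rule Max_in)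
  then obtain p where p: "p \<in> prime_factors n" "q = p ^ multiplicity p n" by (auto simp: Q_def)
  have pp: "prime p" "p dvd n" using p(1) assms by (auto simp: prime_factors_dvd)
  have n0: "n \<noteq> 0" using assms by simp
  have "\<not> is_unit p" using pp(1) not_prime_unit by blast
  then obtain m where m: "n = p ^ multiplicity p n * m" "\<not> p dvd m"
    using multiplicity_decompose'[of n p] n0 by metis
  have m0: "m > 0" using m n0 by (cases m) auto
  have q0: "q > 0" using pp(1) p(2) by (simp add: prime_gt_0_nat)
  have "ln (real n) = (\<Sum>d | d dvd n. mangoldt d)" using mangoldt_sum[of n, where ?'a = real] n0 by simp
  also have "\<dots> = (\<Sum>d | d dvd n \<and> primepow d. mangoldt d)"
    using n0 by (intro sum.mono_neutral_right) (auto simp: mangoldt_def)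
  also have "\<dots> \<le> chebyshev_psi q"
    unfolding chebyshev_psi_def
  proof (intro sum_mono2)
    \<comment> \<open>A prime power divisor is at most the full component of its prime, and
      \<open>q\<close> is the largest component.\<close>
    show "{d. d dvd n \<and> primepow d} \<subseteq> {..q}"
    proof safe
      fix d assume d: "d dvd n" "primepow d"
      then obtain s k where sk: "prime s" "k > 0" "d = s ^ k" unfolding primepow_def by auto
      have "k \<le> multiplicity s n"
        using d sk n0 by (intro multiplicity_geI) (auto simp: prime_gt_1_nat)
      then have "d \<le> s ^ multiplicity s n"
        unfolding sk(3) using prime_ge_1_nat[OF sk(1)] by (intro power_increasing)
      moreover have "s dvd n" using d(1) sk by (meson dvd_power dvd_trans)
      then have "s ^ multiplicity s n \<in> Q" using sk(1) n0 by (auto simp: Q_def prime_factors_dvd)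
      then have "s ^ multiplicity s n \<le> q" unfolding q_def using Q(1) by (intro Max_ge)
      ultimately show "d \<le> q" by simp
    qed
  qed (auto simp: mangoldt_nonneg)
  finally have "ln (real n) \<le> chebyshev_psi q" .
  moreover have "real n = real q * real m" using m(1) p(2) by (metis of_nat_mult)
  then have "ln (real n) = ln (real q) + ln (real m)" using q0 m0 by (simp add: ln_mult)
  ultimately have "ln (real m) \<le> chebyshev_psi (p ^ multiplicity p n) - ln (real (p ^ multiplicity p n))"
    unfolding p(2) by simp
  moreover have "coprime p m" using pp(1) m(2) by (rule prime_imp_coprime)
  moreover have "multiplicity p n > 0" using pp n0 by (simp add: prime_multiplicity_gt_zero_iff)
  ultimately show ?thesis using that pp(1) m(1) m0 by blast
qed

text \<open>After taking logarithms and using \<open>ln x \<le> x - 1\<close>, the length yields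
  \<open>16 / 5 * 11 / 16 = 11 / 5\<close> per unit of \<open>r * q\<close>. For a length factor
  \<open>C\<close>, the margin \<open>C * (1 - t) + ln t\<close> is largest at
  \<open>t = 1 / C\<close>, whence 5/16. The \<open>- 1\<close> allows for rounding the length
  down.\<close>

lemma expected_hits_bound:
  assumes "q \<ge> 2" "m > 0" "ln (real m) \<le> chebyshev_psi q - ln (real q)" "r > 0"
    and L: "real L \<ge> 16 / 5 * real r * real (q * m) - 1"
  shows "real (m ^ r) * (1 - (1 - 5 / 16) / real m) ^ L < (5 / 16) ^ (r * (q - 1))"
proof -
  define x where "x = 1 - (1 - 5 / 16) / real m"
  have mr: "real m \<ge> 1" using assms(2) by simp
  have x: "x > 0" using mr by (simp add: x_def field_simps)
  have "ln x \<le> - (11 / 16 / real m)" using ln_le_minus_one[OF x] by (simp add: x_def)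
  then have "real L * ln x \<le> real L * - (11 / 16 / real m)" by (intro mult_left_mono) auto
  also have "\<dots> \<le> (16 / 5 * real r * real (q * m) - 1) * - (11 / 16 / real m)"
    using L mr by (intro mult_right_mono_neg) auto
  also have "\<dots> = - (11 / 5 * real r * real q) + 11 / 16 / real m"
    using mr by (simp add: field_simps)
  also have "11 / 16 / real m \<le> 11 / 16 * real r"
  proof -
    have "11 / 16 / real m \<le> 11 / 16" using mr by (simp add: field_simps)
    also have "11 / 16 \<le> 11 / 16 * real r" using assms(4) by simp
    finally show ?thesis .
  qed
  finally have Lx: "real L * ln x \<le> real r * (11 / 16 - 11 / 5 * real q)" by (simp add: algebra_simps)
  have "ln (real m) + 11 / 16 + real (q - 1) * ln (16 / 5) < 11 / 5 * real q"
  proof -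
    have "ln (16 / 5) = ln (16::real) - ln 5" by (subst ln_div) simp_all
    then have "ln (16 / 5) \<le> (116318 / 100000 :: real)"
      using ln_composites ln_2_bounds(2) ln_prime_bounds(3) by simp
    then have "real (q - 1) * ln (16 / 5) \<le> real (q - 1) * (116318 / 100000)"
      by (intro mult_left_mono) auto
    also have "\<dots> = 116318 / 100000 * real q - 116318 / 100000"
      using assms(1) by (simp add: of_nat_diff left_diff_distrib)
    finally have q1: "real (q - 1) * ln (16 / 5) \<le> 116318 / 100000 * real q - 116318 / 100000" .
    have qr: "real q \<ge> 2" using assms(1) by simp
    have lnq: "ln 2 \<le> ln (real q)" using assms(1) by simp
    show ?thesis
    \<comment> \<open>The slopes add up to 2.19998. With the additive 3, the constants
      \<open>3 + 11 / 16 - 1.16318 = 2.52432\<close> stay below \<open>ln 13\<close> but not below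
      \<open>ln 12\<close>.\<close>
    proof (cases "q \<le> 12")
      case True
      have "chebyshev_psi q \<le> 10368 / 10000 * real q" using assms(1) True by (rule chebyshev_psi_small)
      then show ?thesis using assms(3) q1 qr lnq ln_2_bounds(1) by linarith
    next
      case False
      then have "ln 13 \<le> ln (real q)" by simp
      moreover have "chebyshev_psi q \<le> 10368 / 10000 * real q + 3" using psi_bounds[of q] by (simp add: psi_bounds_def)
      ultimately show ?thesis using assms(3) q1 qr ln_prime_bounds(9) by linarith
    qed
  qed
  then have "real r * (ln (real m) + 11 / 16 + real (q - 1) * ln (16 / 5)) < real r * (11 / 5 * real q)"
    using assms(4) by (intro mult_strict_left_mono) auto
  then have "real r * ln (real m) + real L * ln x < real r * real (q - 1) * - ln (16 / 5)"
    using Lx by (simp add: algebra_simps)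
  also have "- ln (16 / 5) = ln (5 / 16 :: real)" by (simp add: ln_div)
  finally have "real r * ln (real m) + real L * ln x < real (r * (q - 1)) * ln (5 / 16)" by simp
  moreover have "ln (real (m ^ r) * x ^ L) = real r * ln (real m) + real L * ln x"
    using mr x by (simp add: ln_mult ln_realpow)
  moreover have "ln ((5 / 16 :: real) ^ (r * (q - 1))) = real (r * (q - 1)) * ln (5 / 16)"
    by (rule ln_realpow)
  ultimately have "ln (real (m ^ r) * x ^ L) < ln ((5 / 16 :: real) ^ (r * (q - 1)))" by simp
  then show ?thesis unfolding x_def[symmetric] using mr x by (subst (asm) ln_less_cancel_iff) auto
qed

section \<open>Exponent, rank and the transfer to groups\<close>

lemma group_exponent:
  assumes "comm_group G" "finite (carrier G)"
  shows "group_exponent G > 0" "\<And>x. x \<in> carrier G \<Longrightarrow> x [^]\<^bsub>G\<^esub> group_exponent G = \<one>\<^bsub>G\<^esub>"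
proof -
  interpret comm_group G by (rule assms(1))
  have "card (carrier G) > 0 \<and> (\<forall>x\<in>carrier G. x [^]\<^bsub>G\<^esub> card (carrier G) = \<one>\<^bsub>G\<^esub>)"
    using assms(2) pow_order_eq_1 order_gt_0_iff_finite by (simp add: Coset.order_def)
  then have "group_exponent G > 0 \<and> (\<forall>x\<in>carrier G. x [^]\<^bsub>G\<^esub> group_exponent G = \<one>\<^bsub>G\<^esub>)"
    unfolding group_exponent_def by (rule LeastI)
  then show "group_exponent G > 0" "\<And>x. x \<in> carrier G \<Longrightarrow> x [^]\<^bsub>G\<^esub> group_exponent G = \<one>\<^bsub>G\<^esub>" by auto
qed

lemma group_exponent_ge_2:
  assumes "comm_group G" "finite (carrier G)" "\<not> trivial_group G"
  shows "group_exponent G \<ge> 2"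
proof (rule ccontr)
  interpret comm_group G by (rule assms(1))
  assume "\<not> group_exponent G \<ge> 2"
  then have one: "group_exponent G = 1" using group_exponent(1)[OF assms(1,2)] by simp
  have "x = \<one>\<^bsub>G\<^esub>" if "x \<in> carrier G" for x
    using group_exponent(2)[OF assms(1,2) that] that unfolding one by (simp add: nat_pow_eone)
  then have "carrier G = {\<one>\<^bsub>G\<^esub>}" by auto
  then show False using assms(3) by (simp add: trivial_group_def is_group)
qed

lemma group_rank_generators:
  assumes "comm_group G" "finite (carrier G)"
  obtains s where "s ` {..<group_rank G} \<subseteq> carrier G" "generate G (s ` {..<group_rank G}) = carrier G"
proof -
  interpret comm_group G by (rule assms(1))
  have "generate G (carrier G) = carrier G"
    using generate_incl[of "carrier G"] generate.incl[of _ "carrier G" G] by blast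
  then have "\<exists>S. S \<subseteq> carrier G \<and> finite S \<and> card S = card (carrier G) \<and> generate G S = carrier G"
    using assms(2) by blast
  then have "\<exists>S. S \<subseteq> carrier G \<and> finite S \<and> card S = group_rank G \<and> generate G S = carrier G"
    unfolding group_rank_def by (rule LeastI)
  then obtain S where S: "S \<subseteq> carrier G" "finite S" "card S = group_rank G" "generate G S = carrier G" by blast
  obtain s where "bij_betw s {0..<card S} S" using ex_bij_betw_nat_finite[OF S(2)] by blast
  then have "s ` {..<group_rank G} = S" using S(3) by (simp add: bij_betw_def atLeast0LessThan)
  then show ?thesis using that[of s] S by simp
qed

lemma group_rank_pos:
  assumes "comm_group G" "finite (carrier G)" "\<not> trivial_group G"
  shows "group_rank G > 0"
proof (rule ccontr)
  interpret comm_group G by (rule assms(1))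
  obtain s where s: "generate G (s ` {..<group_rank G}) = carrier G"
    using group_rank_generators[OF assms(1,2)] by metis
  assume "\<not> group_rank G > 0"
  then have "carrier G = {\<one>\<^bsub>G\<^esub>}" using s by (simp add: generate_empty)
  then show False using assms(3) by (simp add: trivial_group_def is_group)
qed

text \<open>Natural exponents suffice because an inverse is the power \<open>n - 1\<close>, with
  \<open>n\<close> the exponent of the group.\<close>

lemma generated_monomial:
  assumes "comm_group G" "finite (carrier G)" "s ` {..<r} \<subseteq> carrier G" "g \<in> generate G (s ` {..<r})"
  shows "\<exists>v :: nat \<Rightarrow> nat. g = finprod G (\<lambda>j. s j [^]\<^bsub>G\<^esub> v j) {..<r}"
  using assms(4)
proof induction
  interpret comm_group G by (rule assms(1))
  have sc: "\<And>j. j < r \<Longrightarrow> s j \<in> carrier G" using assms(3) by auto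
  have single: "s i [^]\<^bsub>G\<^esub> k = finprod G (\<lambda>j. s j [^]\<^bsub>G\<^esub> (if i = j then k else 0)) {..<r}"
    if "i < r" for i and k :: nat
  proof -
    have "finprod G (\<lambda>j. s j [^]\<^bsub>G\<^esub> (if i = j then k else 0)) {..<r}
        = finprod G (\<lambda>j. if i = j then s j [^]\<^bsub>G\<^esub> k else \<one>\<^bsub>G\<^esub>) {..<r}"
      using sc by (intro finprod_cong') auto
    also have "\<dots> = s i [^]\<^bsub>G\<^esub> k" using that sc by (intro finprod_singleton) auto
    finally show ?thesis ..
  qed
  {
    case one
    have "finprod G (\<lambda>j. s j [^]\<^bsub>G\<^esub> (0::nat)) {..<r} = \<one>\<^bsub>G\<^esub>" by (simp add: finprod_one_eqI)
    then show ?case by (intro exI[of _ "\<lambda>_. 0"]) simp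
  next
    case (incl h)
    then obtain i where "i < r" "h = s i" by auto
    then show ?case using single[of i 1] sc by (intro exI[of _ "\<lambda>j. if i = j then 1 else 0"]) (simp add: nat_pow_eone)
  next
    case (inv h)
    then obtain i where i: "i < r" "h = s i" by auto
    define n where "n = group_exponent G"
    have n: "n > 0" "s i [^]\<^bsub>G\<^esub> n = \<one>\<^bsub>G\<^esub>"
      using group_exponent[OF assms(1,2)] sc i by (auto simp: n_def)
    have "s i [^]\<^bsub>G\<^esub> (n - 1) \<otimes>\<^bsub>G\<^esub> s i = \<one>\<^bsub>G\<^esub>"
      using n by (cases n) simp_all
    then have "inv\<^bsub>G\<^esub> (s i) = s i [^]\<^bsub>G\<^esub> (n - 1)"
      using sc i by (intro inv_equality) auto
    then show ?case using single[of i "n - 1"] i by (intro exI[of _ "\<lambda>j. if i = j then n - 1 else 0"]) simp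
  next
    case (eng h1 h2)
    then obtain v w :: "nat \<Rightarrow> nat" where
      "h1 = finprod G (\<lambda>j. s j [^]\<^bsub>G\<^esub> v j) {..<r}" "h2 = finprod G (\<lambda>j. s j [^]\<^bsub>G\<^esub> w j) {..<r}" by blast
    then have "h1 \<otimes>\<^bsub>G\<^esub> h2 = finprod G (\<lambda>j. s j [^]\<^bsub>G\<^esub> v j \<otimes>\<^bsub>G\<^esub> s j [^]\<^bsub>G\<^esub> w j) {..<r}"
      using sc by (simp add: finprod_multf Pi_def)
    also have "\<dots> = finprod G (\<lambda>j. s j [^]\<^bsub>G\<^esub> (v j + w j)) {..<r}"
      using sc by (intro finprod_cong') (auto simp: nat_pow_mult)
    finally show ?case by (intro exI[of _ "\<lambda>j. v j + w j"])
  }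
qed

lemma finprod_monomials:
  assumes "comm_group G" "s ` {..<r} \<subseteq> carrier G" "finite I"
  shows "finprod G (\<lambda>i. finprod G (\<lambda>j. s j [^]\<^bsub>G\<^esub> (v i j :: nat)) {..<r}) I
    = finprod G (\<lambda>j. s j [^]\<^bsub>G\<^esub> (\<Sum>i\<in>I. v i j)) {..<r}"
  using assms(3)
proof (induction I rule: finite_induct)
  interpret comm_group G by (rule assms(1))
  case empty
  show ?case by (simp add: finprod_one_eqI)
next
  interpret comm_group G by (rule assms(1))
  case (insert i I)
  have sc: "\<And>j. j < r \<Longrightarrow> s j \<in> carrier G" using assms(2) by auto
  have "finprod G (\<lambda>i. finprod G (\<lambda>j. s j [^]\<^bsub>G\<^esub> v i j) {..<r}) (insert i I)
      = finprod G (\<lambda>j. s j [^]\<^bsub>G\<^esub> v i j) {..<r} \<otimes>\<^bsub>G\<^esub> finprod G (\<lambda>j. s j [^]\<^bsub>G\<^esub> (\<Sum>i\<in>I. v i j)) {..<r}"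
    using insert sc by (subst finprod_insert) (auto intro!: finprod_closed)
  also have "\<dots> = finprod G (\<lambda>j. s j [^]\<^bsub>G\<^esub> v i j \<otimes>\<^bsub>G\<^esub> s j [^]\<^bsub>G\<^esub> (\<Sum>i\<in>I. v i j)) {..<r}"
    using sc by (simp add: finprod_multf Pi_def)
  also have "\<dots> = finprod G (\<lambda>j. s j [^]\<^bsub>G\<^esub> (\<Sum>i\<in>insert i I. v i j)) {..<r}"
    using insert.hyps sc by (intro finprod_cong') (auto simp: nat_pow_mult)
  finally show ?case .
qed

theorem theorem6p2:
  fixes G :: "('a, 'b) monoid_scheme"
  assumes "comm_group G" and "finite (carrier G)" and "\<not> trivial_group G"
  shows "real (davenport G) \<le> 16 / 5 * real (group_rank G) * real (group_exponent G) \<and>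
         real_of_int (davenport_excess G) < 16 / 5 * real (group_rank G) * real (group_exponent G)"
proof -
  interpret comm_group G by (rule assms(1))
  define r where "r = group_rank G"
  define n where "n = group_exponent G"
  have r: "r > 0" using group_rank_pos[OF assms] by (simp add: r_def)
  have n: "n \<ge> 2" using group_exponent_ge_2[OF assms] by (simp add: n_def)
  obtain s where s: "s ` {..<r} \<subseteq> carrier G" "generate G (s ` {..<r}) = carrier G"
    using group_rank_generators[OF assms(1,2)] unfolding r_def by blast
  have sc: "\<And>j. j < r \<Longrightarrow> s j \<in> carrier G" using s(1) by auto
  obtain p e m where pem: "prime p" "e > 0" "n = p ^ e * m" "coprime p m" "m > 0"
    "ln (real m) \<le> chebyshev_psi (p ^ e) - ln (real (p ^ e))"
    using largest_prime_power_factor[OF n] by blast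
  define L where "L = nat \<lfloor>16 / 5 * real r * real n\<rfloor>"
  have L: "real L \<le> 16 / 5 * real r * real n" "16 / 5 * real r * real n - 1 \<le> real L"
    unfolding L_def by (simp_all add: of_nat_floor) linarith
  have "p ^ e \<ge> 2" using pem(1,2) by (metis prime_ge_2_nat self_le_power le_trans one_le_numeral)
  then have hits: "real (m ^ r) * (1 - (1 - 5 / 16) / real m) ^ L < (5 / 16) ^ (r * (p ^ e - 1))"
    using pem r L(2) by (intro expected_hits_bound) auto
  have "\<exists>I. I \<subseteq> {..<L} \<and> I \<noteq> {} \<and> finprod G x I = \<one>\<^bsub>G\<^esub>" if x: "x \<in> {..<L} \<rightarrow> carrier G" for x
  proof -
    have "\<forall>i\<in>{..<L}. \<exists>v :: nat \<Rightarrow> nat. x i = finprod G (\<lambda>j. s j [^]\<^bsub>G\<^esub> v j) {..<r}"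
      using x s by (intro ballI generated_monomial[OF assms(1,2) s(1)]) auto
    then obtain v :: "nat \<Rightarrow> nat \<Rightarrow> nat" where
      v: "\<And>i. i < L \<Longrightarrow> x i = finprod G (\<lambda>j. s j [^]\<^bsub>G\<^esub> v i j) {..<r}" by (metis lessThan_iff)
    obtain I where I: "I \<subseteq> {..<L}" "I \<noteq> {}" "\<forall>j<r. p ^ e * m dvd (\<Sum>i\<in>I. v i j)"
      using zero_sum_mod[OF pem(1) refl pem(5,4) _ _ hits, of v] by auto
    have "finprod G x I = finprod G (\<lambda>i. finprod G (\<lambda>j. s j [^]\<^bsub>G\<^esub> v i j) {..<r}) I"
      using I(1) v sc by (intro finprod_cong') (auto intro!: finprod_closed)
    also have "\<dots> = finprod G (\<lambda>j. s j [^]\<^bsub>G\<^esub> (\<Sum>i\<in>I. v i j)) {..<r}"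
      using I(1) finite_subset by (intro finprod_monomials assms(1) s(1)) blast
    also have "\<dots> = \<one>\<^bsub>G\<^esub>"
    proof (rule finprod_one_eqI)
      fix j assume "j \<in> {..<r}"
      then have j: "j < r" by simp
      then obtain k where "(\<Sum>i\<in>I. v i j) = n * k" using I(3) pem(3) by (metis dvdE)
      moreover have "s j [^]\<^bsub>G\<^esub> (n * k) = (s j [^]\<^bsub>G\<^esub> n) [^]\<^bsub>G\<^esub> k" using sc[OF j] by (simp add: nat_pow_pow)
      moreover have "s j [^]\<^bsub>G\<^esub> n = \<one>\<^bsub>G\<^esub>" using group_exponent(2)[OF assms(1,2) sc[OF j]] by (simp add: n_def)
      ultimately show "s j [^]\<^bsub>G\<^esub> (\<Sum>i\<in>I. v i j) = \<one>\<^bsub>G\<^esub>" by simp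
    qed
    finally show ?thesis using I by blast
  qed
  then have "davenport G \<le> L" unfolding davenport_def by (intro Least_le) blast
  then have "real (davenport G) \<le> 16 / 5 * real r * real n" using L(1) by simp
  \<comment> \<open>\<open>davenport_star G\<close> is 1 plus a natural number; subtracting it makes
    the inequality strict.\<close>
  moreover have "real_of_int (davenport_excess G) < real (davenport G)"
    unfolding davenport_excess_def davenport_star_def by simp
  ultimately show ?thesis by (simp add: r_def n_def)
qed

end
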